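(* Let $\rho_1,\rho_2>0$ be sufficiently large penalty parameters. There exists a unique solution $(\mathbf{u}_h,p_h)\in \mathbf{V}_h\times Q_h$ to the pressure-robust enriched Galerkin (PR-EG) method: $$\nu\,\mathbf{a}(\mathbf{u}_h,\mathbf{v})+\tilde{\mathbf{c}}(\mathbf{u}_h,\mathbf{v})-\mathbf{b}(\mathbf{v},p_h)=(\mathbf{f},\mathcal{R}\mathbf{v})\quad\forall \mathbf{v}\in\mathbf{V}_h,\qquad \mathbf{b}(\mathbf{u}_h,q)=0\quad\forall q\in Q_h.$$
   Context: Setting. $\Omega\subset\mathbb{R}^d$, $d\in\{2,3\}$, is a bounded domain with simply connected Lipschitz boundary, $\nu\in[0,1]$, and $\mathbf{f}\in[L^2(\Omega)]^d$. $\mathcal{T}_h$ is a shape-regular triangulation of $\Omega$ into triangles ($d=2$) or tetrahedra ($d=3$); $h_T$ is the diameter of $T\in\mathcal{T}_h$ and $h=\max_T h_T$. $\mathcal{E}_h=\mathcal{E}_h^o\cup\mathcal{E}_h^b$ is the set of all edges/faces (interior and boundary ones). For $e\in\mathcal{E}_h^o$ shared by $T^+,T^-$, $\mathbf{n}_e$ is the unit normal from $T^+$ to $T^-$; for $e\in\mathcal{E}_h^b$ it is the outward unit normal on $\partial\Omega$. $h_e=|e|^{1/(d-1)}$. Jump and average: $[v]=v^+-v^-$, $\{v\}=(v^++v^-)/2$ on interior $e$, and $[v]=\{v\}=v$ on boundary $e$ (componentwise for vectors and tensors). $(\cdot,\cdot)$ is the $L^2(\Omega)$ inner product; $(\cdot,\cdot)_{\mathcal{T}_h}=\sum_T(\cdot,\cdot)_{L^2(T)}$;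 $\langle\cdot,\cdot\rangle_{\mathcal{E}_h}=\sum_e(\cdot,\cdot)_{L^2(e)}$. Spaces. $\mathbf{C}_h=\{\mathbf{v}\in[H_0^1(\Omega)]^d:\mathbf{v}|_T\in[P_1(T)]^d\ \forall T\in\mathcal{T}_h\}$; $\mathbf{D}_h=\{\mathbf{v}\in[L^2(\Omega)]^d:\mathbf{v}|_T=c_T(\mathbf{x}-\mathbf{x}_T),\ c_T\in\mathbb{R},\ \forall T\in\mathcal{T}_h\}$, with $\mathbf{x}_T$ the barycenter of $T$; $\mathbf{V}_h=\mathbf{C}_h\oplus\mathbf{D}_h$; $Q_h=\{q\in L_0^2(\Omega):q|_T\in P_0(T)\ \forall T\in\mathcal{T}_h\}$, where $L_0^2(\Omega)$ is the space of mean-zero $L^2$ functions. Velocity reconstruction. $\mathcal{R}:\mathbf{V}_h\to\mathcal{B}DM_1(\mathcal{T}_h)=\{\mathbf{v}\in H(\mathrm{div},\Omega):\mathbf{v}|_T\in[P_1(T)]^d\ \forall T\}$ is defined by $\int_e(\mathcal{R}\mathbf{v})\cdot\mathbf{n}_e\,p_1\,ds=\int_e\{\mathbf{v}\}\cdot\mathbf{n}_e\,p_1\,ds$ for all $p_1\in P_1(e)$, $e\in\mathcal{E}_h^o$, and $\int_e(\mathcal{R}\mathbf{v})\cdot\mathbf{n}_e\,p_1\,ds=0$ for all $p_1\in P_1(e)$, $e\in\mathcal{E}_h^b$. Bilinear forms (derivatives taken elementwise), with penalty parameters $\rho_1,\rho_2>0$: $\mathbf{a}(\mathbf{v},\mathbf{w})=(\nabla\mathbf{v},\nabla\mathbf{w})_{\mathcal{T}_h}-\langle\{\nabla\mathbf{v}\}\mathbf{n}_e,[\mathbf{w}]\rangle_{\mathcal{E}_h}-\langle\{\nabla\mathbf{w}\}\mathbf{n}_e,[\mathbf{v}]\rangle_{\mathcal{E}_h}+\rho_1\langle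 h_e^{-1}[\mathbf{w}],[\mathbf{v}]\rangle_{\mathcal{E}_h}$, $\tilde{\mathbf{c}}(\mathbf{v},\mathbf{w})=(\mathcal{R}\mathbf{v},\mathcal{R}\mathbf{w})_{\mathcal{T}_h}+\rho_2\langle h_e[\mathbf{w}],[\mathbf{v}]\rangle_{\mathcal{E}_h}$, $\mathbf{b}(\mathbf{w},q)=(\nabla\cdot\mathbf{w},q)_{\mathcal{T}_h}-\langle[\mathbf{w}]\cdot\mathbf{n}_e,\{q\}\rangle_{\mathcal{E}_h}$. "Sufficiently large" means larger than a threshold independent of $\nu$ and $h$. *)

theory Defs
  imports "HOL-Analysis.Analysis"
begin

text \<open>
  Elements of the function spaces are represented by ordinary functions on the whole of
  \<open>real ^ 'n\<close>; only their values almost everywhere on the domain matter.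
\<close>

section \<open>The domain\<close>

text \<open>
  Near each boundary point the domain is, in suitable orthonormal coordinates, the region above the
  graph of a Lipschitz function \<open>\<gamma>\<close>. The vertical direction is \<open>w\<close>, and \<open>\<gamma>\<close> is only ever evaluated on the
  hyperplane orthogonal to it.
\<close>
definition lipschitz_boundary :: "'a::euclidean_space set \<Rightarrow> bool" where
  "lipschitz_boundary \<Omega> \<longleftrightarrow>
     (\<forall>z\<in>frontier \<Omega>. \<exists>U w L. \<exists>\<gamma> :: 'a \<Rightarrow> real.
        open U \<and> z \<in> U \<and> norm w = 1 \<and> L-lipschitz_on {y. y \<bullet> w = 0} \<gamma> \<and>
        \<Omega> \<inter> U = {y\<in>U. \<gamma> (y - (y \<bullet> w) *\<^sub>R w) < y \<bullet> w})"

definition bounded_lipschitz_domain :: "'a::euclidean_space set \<Rightarrow> bool" where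
  "bounded_lipschitz_domain \<Omega> \<longleftrightarrow>
     open \<Omega> \<and> connected \<Omega> \<and> \<Omega> \<noteq> {} \<and> bounded \<Omega> \<and> lipschitz_boundary \<Omega>"


section \<open>Sobolev spaces\<close>

definition L2 :: "'a::euclidean_space set \<Rightarrow> ('a \<Rightarrow> 'b::euclidean_space) set" where
  "L2 \<Omega> = {f. f \<in> borel_measurable (lebesgue_on \<Omega>) \<and>
               integrable (lebesgue_on \<Omega>) (\<lambda>x. (norm (f x))\<^sup>2)}"

definition grad :: "(real ^ 'n \<Rightarrow> real) \<Rightarrow> real ^ 'n \<Rightarrow> real ^ 'n" where
  "grad \<phi> x = (\<chi> i. frechet_derivative \<phi> (at x) (axis i 1))"

fun Ck :: "nat \<Rightarrow> (real ^ 'n \<Rightarrow> real) \<Rightarrow> bool" where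
  "Ck 0 \<phi> \<longleftrightarrow> continuous_on UNIV \<phi>"
| "Ck (Suc k) \<phi> \<longleftrightarrow> (\<forall>x. \<phi> differentiable (at x)) \<and> (\<forall>i. Ck k (\<lambda>x. grad \<phi> x $ i))"

definition test_functions :: "(real ^ 'n) set \<Rightarrow> (real ^ 'n \<Rightarrow> real) set" where
  "test_functions \<Omega> = {\<phi>. (\<forall>k. Ck k \<phi>) \<and> (\<exists>K. compact K \<and> K \<subseteq> \<Omega> \<and> (\<forall>x. x \<notin> K \<longrightarrow> \<phi> x = 0))}"

definition weak_gradient ::
  "(real ^ 'n) set \<Rightarrow> (real ^ 'n \<Rightarrow> real) \<Rightarrow> (real ^ 'n \<Rightarrow> real ^ 'n) \<Rightarrow> bool" where
  "weak_gradient \<Omega> v G \<longleftrightarrow>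
     (\<forall>\<phi>\<in>test_functions \<Omega>.
        (\<integral>x. v x *\<^sub>R grad \<phi> x \<partial>lebesgue_on \<Omega>) = - (\<integral>x. \<phi> x *\<^sub>R G x \<partial>lebesgue_on \<Omega>))"

definition weak_divergence ::
  "(real ^ 'n) set \<Rightarrow> (real ^ 'n \<Rightarrow> real ^ 'n) \<Rightarrow> (real ^ 'n \<Rightarrow> real) \<Rightarrow> bool" where
  "weak_divergence \<Omega> v g \<longleftrightarrow>
     (\<forall>\<phi>\<in>test_functions \<Omega>.
        (\<integral>x. v x \<bullet> grad \<phi> x \<partial>lebesgue_on \<Omega>) = - (\<integral>x. g x * \<phi> x \<partial>lebesgue_on \<Omega>))"

text \<open>The closure of the test functions in the norm of $H^1(\Omega)$.\<close>
definition H10 :: "(real ^ 'n) set \<Rightarrow> (real ^ 'n \<Rightarrow> real) set" where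
  "H10 \<Omega> = {v \<in> L2 \<Omega>. \<exists>G\<in>L2 \<Omega>. weak_gradient \<Omega> v G \<and>
     (\<exists>\<phi>. (\<forall>k. \<phi> k \<in> test_functions \<Omega>) \<and>
        (\<lambda>k::nat. \<integral>x. (\<phi> k x - v x)\<^sup>2 \<partial>lebesgue_on \<Omega>) \<longlonglongrightarrow> 0 \<and>
        (\<lambda>k. \<integral>x. (norm (grad (\<phi> k) x - G x))\<^sup>2 \<partial>lebesgue_on \<Omega>) \<longlonglongrightarrow> 0)}"

definition Hdiv :: "(real ^ 'n) set \<Rightarrow> (real ^ 'n \<Rightarrow> real ^ 'n) set" where
  "Hdiv \<Omega> = {v \<in> L2 \<Omega>. \<exists>g\<in>L2 \<Omega>. weak_divergence \<Omega> v g}"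


section \<open>Meshes\<close>

definition simplicial_mesh :: "(real ^ 'n) set \<Rightarrow> (real ^ 'n) set set \<Rightarrow> bool" where
  "simplicial_mesh \<Omega> \<T> \<longleftrightarrow>
     triangulation \<T> \<and> (\<forall>T\<in>\<T>. int CARD('n) simplex T) \<and> \<Union>\<T> = closure \<Omega>"

definition inball_diameter :: "'a::euclidean_space set \<Rightarrow> real" where
  "inball_diameter T = 2 * Sup {r. 0 \<le> r \<and> (\<exists>x. cball x r \<subseteq> T)}"

definition shape_regular :: "real \<Rightarrow> 'a::euclidean_space set set \<Rightarrow> bool" where
  "shape_regular \<sigma> \<T> \<longleftrightarrow> (\<forall>T\<in>\<T>. diameter T \<le> \<sigma> * inball_diameter T)"

definition barycenter :: "'a::euclidean_space set \<Rightarrow> 'a" where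
  "barycenter T = (1 / real (card {x. x extreme_point_of T})) *\<^sub>R (\<Sum>x | x extreme_point_of T. x)"

definition facets :: "'a::euclidean_space set set \<Rightarrow> 'a set set" where
  "facets \<T> = {e. \<exists>T\<in>\<T>. e facet_of T}"

definition interior_facets :: "'a::euclidean_space set set \<Rightarrow> 'a set set" where
  "interior_facets \<T> = {e. \<exists>T\<in>\<T>. \<exists>T'\<in>\<T>. T \<noteq> T' \<and> e facet_of T \<and> e facet_of T'}"

definition boundary_facets :: "'a::euclidean_space set set \<Rightarrow> 'a set set" where
  "boundary_facets \<T> = facets \<T> - interior_facets \<T>"

text \<open>
  An orientation \<open>tp\<close> names, for each facet $e$, the element $T^+$; on a boundary facet this is the
  only adjacent element. The element $T^-$ is the other one.
\<close>
definition orientation ::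
  "'a::euclidean_space set set \<Rightarrow> ('a set \<Rightarrow> 'a set) \<Rightarrow> bool" where
  "orientation \<T> tp \<longleftrightarrow> (\<forall>e\<in>facets \<T>. tp e \<in> \<T> \<and> e facet_of tp e)"

definition tminus ::
  "'a::euclidean_space set set \<Rightarrow> ('a set \<Rightarrow> 'a set) \<Rightarrow> 'a set \<Rightarrow> 'a set" where
  "tminus \<T> tp e = (THE T. T \<in> \<T> \<and> e facet_of T \<and> T \<noteq> tp e)"

definition outward_normal :: "'a::euclidean_space set \<Rightarrow> 'a set \<Rightarrow> 'a" where
  "outward_normal T e = (THE n. norm n = 1 \<and> (\<forall>x\<in>e. \<forall>y\<in>e. n \<bullet> (y - x) = 0) \<and>
                                (\<forall>x\<in>e. \<forall>y\<in>T. n \<bullet> (y - x) \<le> 0))"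

text \<open>
  The outward normal of $T^+$ points from $T^+$ to $T^-$ on an interior facet and out of the domain
  on a boundary facet.
\<close>
definition facet_normal :: "('a::euclidean_space set \<Rightarrow> 'a set) \<Rightarrow> 'a set \<Rightarrow> 'a" where
  "facet_normal tp e = outward_normal (tp e) e"

text \<open>
  The $(d-1)$-dimensional Lebesgue measure on a facet $e$: by Fubini in orthonormal coordinates, the
  measure of $A \subseteq e$ is the volume of the right prism over $A$ that extends by $1/2$ to both
  sides of the hyperplane spanned by $e$, hence has height $1$.
\<close>
definition surface_measure :: "'a::euclidean_space set \<Rightarrow> 'a measure" where
  "surface_measure e =
     (let \<pi> = closest_point (affine hull e)
      in distr (restrict_space lborel {x. \<pi> x \<in> e \<and> dist x (\<pi> x) \<le> 1 / 2}) borel \<pi>)"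

definition facet_size :: "(real ^ 'n) set \<Rightarrow> real" where
  "facet_size e = measure (surface_measure e) e powr (1 / (real CARD('n) - 1))"


section \<open>Piecewise polynomials, jumps and averages\<close>

definition P1 :: "('a::real_vector \<Rightarrow> 'b::real_vector) set" where
  "P1 = {p. \<exists>L b. linear L \<and> p = (\<lambda>x. L x + b)}"

text \<open>
  For \<open>v\<close> piecewise in \<open>P1\<close>, \<open>piece v T\<close> is its polynomial representative on the element \<open>T\<close>. Traces on
  facets and elementwise derivatives are those of this polynomial.
\<close>
definition piece ::
  "('a::euclidean_space \<Rightarrow> 'b::euclidean_space) \<Rightarrow> 'a set \<Rightarrow> 'a \<Rightarrow> 'b" where
  "piece v T = (THE p. p \<in> P1 \<and> (AE x in lebesgue_on T. v x = p x))"

definition elem_grad ::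
  "(real ^ 'n \<Rightarrow> real ^ 'm) \<Rightarrow> (real ^ 'n) set \<Rightarrow> real ^ 'n \<Rightarrow> real ^ 'n ^ 'm" where
  "elem_grad v T x = jacobian (piece v T) (at x)"

definition elem_div :: "(real ^ 'n \<Rightarrow> real ^ 'n) \<Rightarrow> (real ^ 'n) set \<Rightarrow> real ^ 'n \<Rightarrow> real" where
  "elem_div v T x = trace (elem_grad v T x)"

text \<open>The argument \<open>g\<close> of jumps and averages assigns a function to each element.\<close>
definition jump ::
  "'a::euclidean_space set set \<Rightarrow> ('a set \<Rightarrow> 'a set) \<Rightarrow> ('a set \<Rightarrow> 'a \<Rightarrow> 'b::real_vector) \<Rightarrow>
   'a set \<Rightarrow> 'a \<Rightarrow> 'b" where
  "jump \<T> tp g e x =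
     (if e \<in> interior_facets \<T> then g (tp e) x - g (tminus \<T> tp e) x else g (tp e) x)"

definition average ::
  "'a::euclidean_space set set \<Rightarrow> ('a set \<Rightarrow> 'a set) \<Rightarrow> ('a set \<Rightarrow> 'a \<Rightarrow> 'b::real_vector) \<Rightarrow>
   'a set \<Rightarrow> 'a \<Rightarrow> 'b" where
  "average \<T> tp g e x =
     (if e \<in> interior_facets \<T> then (1 / 2) *\<^sub>R (g (tp e) x + g (tminus \<T> tp e) x) else g (tp e) x)"


section \<open>Discrete spaces\<close>

definition C_space :: "(real ^ 'n) set \<Rightarrow> (real ^ 'n) set set \<Rightarrow> (real ^ 'n \<Rightarrow> real ^ 'n) set" where
  "C_space \<Omega> \<T> = {v. (\<forall>i. (\<lambda>x. v x $ i) \<in> H10 \<Omega>) \<and>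
                     (\<forall>T\<in>\<T>. \<exists>p\<in>P1. AE x in lebesgue_on T. v x = p x)}"

definition D_space :: "(real ^ 'n) set \<Rightarrow> (real ^ 'n) set set \<Rightarrow> (real ^ 'n \<Rightarrow> real ^ 'n) set" where
  "D_space \<Omega> \<T> = {v \<in> L2 \<Omega>. \<forall>T\<in>\<T>. \<exists>c. AE x in lebesgue_on T. v x = c *\<^sub>R (x - barycenter T)}"

definition V_space :: "(real ^ 'n) set \<Rightarrow> (real ^ 'n) set set \<Rightarrow> (real ^ 'n \<Rightarrow> real ^ 'n) set" where
  "V_space \<Omega> \<T> = {v. \<exists>c\<in>C_space \<Omega> \<T>. \<exists>w\<in>D_space \<Omega> \<T>. v = (\<lambda>x. c x + w x)}"

definition Q_space :: "(real ^ 'n) set \<Rightarrow> (real ^ 'n) set set \<Rightarrow> (real ^ 'n \<Rightarrow> real) set" where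
  "Q_space \<Omega> \<T> = {q \<in> L2 \<Omega>. (\<integral>x. q x \<partial>lebesgue_on \<Omega>) = 0 \<and>
                            (\<forall>T\<in>\<T>. \<exists>c. AE x in lebesgue_on T. q x = c)}"

definition BDM1 :: "(real ^ 'n) set \<Rightarrow> (real ^ 'n) set set \<Rightarrow> (real ^ 'n \<Rightarrow> real ^ 'n) set" where
  "BDM1 \<Omega> \<T> = {v \<in> Hdiv \<Omega>. \<forall>T\<in>\<T>. \<exists>p\<in>P1. AE x in lebesgue_on T. v x = p x}"


section \<open>Velocity reconstruction\<close>

text \<open>
  The normal trace of a function in $H(\mathrm{div})$ on an interior facet is single-valued, so its
  moments are those of the trace from either adjacent element.
\<close>
definition is_reconstruction ::
  "(real ^ 'n) set \<Rightarrow> (real ^ 'n) set set \<Rightarrow> ((real ^ 'n) set \<Rightarrow> (real ^ 'n) set) \<Rightarrow>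
   (real ^ 'n \<Rightarrow> real ^ 'n) \<Rightarrow> (real ^ 'n \<Rightarrow> real ^ 'n) \<Rightarrow> bool" where
  "is_reconstruction \<Omega> \<T> tp v w \<longleftrightarrow>
     w \<in> BDM1 \<Omega> \<T> \<and>
     (\<forall>e\<in>interior_facets \<T>. \<forall>T\<in>\<T>. e facet_of T \<longrightarrow> (\<forall>p1\<in>P1.
        (\<integral>x. (piece w T x \<bullet> facet_normal tp e) * p1 x \<partial>surface_measure e) =
        (\<integral>x. (average \<T> tp (piece v) e x \<bullet> facet_normal tp e) * p1 x \<partial>surface_measure e))) \<and>
     (\<forall>e\<in>boundary_facets \<T>. \<forall>p1\<in>P1.
        (\<integral>x. (piece w (tp e) x \<bullet> facet_normal tp e) * p1 x \<partial>surface_measure e) = 0)"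

text \<open>The moments determine the reconstruction up to equality almost everywhere.\<close>
definition reconstruction ::
  "(real ^ 'n) set \<Rightarrow> (real ^ 'n) set set \<Rightarrow> ((real ^ 'n) set \<Rightarrow> (real ^ 'n) set) \<Rightarrow>
   (real ^ 'n \<Rightarrow> real ^ 'n) \<Rightarrow> (real ^ 'n \<Rightarrow> real ^ 'n)" where
  "reconstruction \<Omega> \<T> tp v = (SOME w. is_reconstruction \<Omega> \<T> tp v w)"


section \<open>The pressure-robust enriched Galerkin method\<close>

text \<open>On matrices, \<open>\<bullet>\<close> is the Frobenius inner product.\<close>
definition form_a ::
  "(real ^ 'n) set set \<Rightarrow> ((real ^ 'n) set \<Rightarrow> (real ^ 'n) set) \<Rightarrow> real \<Rightarrow>
   (real ^ 'n \<Rightarrow> real ^ 'n) \<Rightarrow> (real ^ 'n \<Rightarrow> real ^ 'n) \<Rightarrow> real" where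
  "form_a \<T> tp \<rho>1 v w =
     (\<Sum>T\<in>\<T>. \<integral>x. elem_grad v T x \<bullet> elem_grad w T x \<partial>lebesgue_on T)
     - (\<Sum>e\<in>facets \<T>. \<integral>x. (average \<T> tp (elem_grad v) e x *v facet_normal tp e)
                            \<bullet> jump \<T> tp (piece w) e x \<partial>surface_measure e)
     - (\<Sum>e\<in>facets \<T>. \<integral>x. (average \<T> tp (elem_grad w) e x *v facet_normal tp e)
                            \<bullet> jump \<T> tp (piece v) e x \<partial>surface_measure e)
     + \<rho>1 * (\<Sum>e\<in>facets \<T>. \<integral>x. inverse (facet_size e) *
          (jump \<T> tp (piece w) e x \<bullet> jump \<T> tp (piece v) e x) \<partial>surface_measure e)"

definition form_c ::
  "(real ^ 'n) set \<Rightarrow> (real ^ 'n) set set \<Rightarrow> ((real ^ 'n) set \<Rightarrow> (real ^ 'n) set) \<Rightarrow> real \<Rightarrow>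
   (real ^ 'n \<Rightarrow> real ^ 'n) \<Rightarrow> (real ^ 'n \<Rightarrow> real ^ 'n) \<Rightarrow> real" where
  "form_c \<Omega> \<T> tp \<rho>2 v w =
     (\<Sum>T\<in>\<T>. \<integral>x. reconstruction \<Omega> \<T> tp v x \<bullet> reconstruction \<Omega> \<T> tp w x \<partial>lebesgue_on T)
     + \<rho>2 * (\<Sum>e\<in>facets \<T>. \<integral>x. facet_size e *
          (jump \<T> tp (piece w) e x \<bullet> jump \<T> tp (piece v) e x) \<partial>surface_measure e)"

definition form_b ::
  "(real ^ 'n) set set \<Rightarrow> ((real ^ 'n) set \<Rightarrow> (real ^ 'n) set) \<Rightarrow>
   (real ^ 'n \<Rightarrow> real ^ 'n) \<Rightarrow> (real ^ 'n \<Rightarrow> real) \<Rightarrow> real" where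
  "form_b \<T> tp w q =
     (\<Sum>T\<in>\<T>. \<integral>x. elem_div w T x * q x \<partial>lebesgue_on T)
     - (\<Sum>e\<in>facets \<T>. \<integral>x. (jump \<T> tp (piece w) e x \<bullet> facet_normal tp e)
                            * average \<T> tp (piece q) e x \<partial>surface_measure e)"

definition pr_eg_solution ::
  "(real ^ 'n) set \<Rightarrow> (real ^ 'n) set set \<Rightarrow> ((real ^ 'n) set \<Rightarrow> (real ^ 'n) set) \<Rightarrow>
   real \<Rightarrow> real \<Rightarrow> real \<Rightarrow> (real ^ 'n \<Rightarrow> real ^ 'n) \<Rightarrow>
   (real ^ 'n \<Rightarrow> real ^ 'n) \<Rightarrow> (real ^ 'n \<Rightarrow> real) \<Rightarrow> bool" where
  "pr_eg_solution \<Omega> \<T> tp \<nu> \<rho>1 \<rho>2 f u p \<longleftrightarrow>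
     u \<in> V_space \<Omega> \<T> \<and> p \<in> Q_space \<Omega> \<T> \<and>
     (\<forall>v\<in>V_space \<Omega> \<T>.
        \<nu> * form_a \<T> tp \<rho>1 u v + form_c \<Omega> \<T> tp \<rho>2 u v - form_b \<T> tp v p =
        (\<integral>x. f x \<bullet> reconstruction \<Omega> \<T> tp v x \<partial>lebesgue_on \<Omega>)) \<and>
     (\<forall>q\<in>Q_space \<Omega> \<T>. form_b \<T> tp u q = 0)"

end

theory Submission
  imports Defs
begin

text \<open>
  The method is a linear system whose trial and test spaces coincide and are finite dimensional up to
  equality almost everywhere. Existence follows once every test pair that annihilates the trial space
  is also annihilated by the load (\<open>finite_rank_system_solvable\<close>), and uniqueness once the homogeneous
  problem has only the trivial solution. Testing a pair \<open>(v, q)\<close> with itself cancels the two pressure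
  terms, so both statements come down to the velocity form
  $\nu\,\mathbf{a} + \tilde{\mathbf{c}}$ being positive definite, and uniqueness of the pressure to
  $\mathbf{b}$ having no kernel on $Q_h$.

  Positivity of the velocity form (\<open>form_c_definite\<close>, \<open>form_a_nonneg\<close>). If
  $\tilde{\mathbf{c}}(v,v)=0$, then all jumps of \<open>v\<close> vanish and its reconstruction is zero. Without
  jumps the average is the trace itself, so the normal component of \<open>v\<close> vanishes on every facet. Each
  vertex of a simplex lies on $d$ facets with linearly independent normals; hence \<open>v\<close> vanishes at all
  vertices and, being affine, everywhere. So $\tilde{\mathbf{c}}$ alone is positive definite for every
  $\rho_2>0$, and $\mathbf{a}$ only has to be nonnegative, which also covers $\nu=0$. As gradients are
  constant on elements, the trace inequality behind this is the geometric bound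
  $h_e|e| \le \kappa|T|$ of \<open>facet_size_bound\<close>, where $\kappa$ depends on $d$ and $\sigma$ only; the
  threshold for $\rho_1$ is $\kappa(d+1)$.

  Injectivity of the pressure (\<open>pressure_zero\<close>). Test functions from $\mathbf{D}_h$ suffice. For the
  field that equals $x-x_T$ on one element and zero on the others, $\mathbf{b}(v,q)$ is a positive
  multiple of the sum of $q_T-\{q\}_e$ over the facets $e$ of $T$. If all these sums vanish, $q$ obeys a
  discrete maximum principle on the graph of elements that share a facet. This graph is connected,
  because a segment inside the domain can be moved off all faces of codimension two
  (\<open>facet_connected\<close>). So $q$ is constant, and zero as its mean vanishes.

  The reconstruction is selected from the fields with the right moments, so such fields have to exist.
  On one simplex an explicit formula in barycentric coordinates prescribes affine normal components on
  all facets (\<open>normal_lift\<close>). That the assembled field lies in $H(\mathrm{div})$ is Green's formula on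
  each simplex. The formula is a combination of terms $\lambda_a\,(b-a)$ along edges, for which it
  reduces to integrating the derivative of a function along the lines parallel to an edge
  (\<open>integral_edge_derivative\<close>), that is, to Fubini's theorem in sheared coordinates. The same identity
  gives the volume formula $|e| = d\,|T|\,|\nabla\lambda_b|$ for the facet $e$ opposite to $b$
  (\<open>measure_simplex\<close>), on which all the geometric estimates rest.
\<close>

section \<open>Solvability of finite-rank linear systems\<close>

text \<open>
  The Fredholm alternative for a bilinear form \<open>B\<close> that sees a test vector \<open>y\<close> only through the finitely
  many coordinates \<open>D k y\<close>. Working with a combination operation \<open>comb u c v\<close>, to be read as $u + c v$,
  instead of a vector space structure allows vectors that are pairs of functions, considered up to the
  null vectors of \<open>D\<close>. The induction removes one coordinate at a time. If some test vector \<open>y0\<close> has a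
  nonzero coordinate \<open>k\<close>, every test vector is a multiple of \<open>y0\<close> plus one on which \<open>D k\<close> vanishes.
  Either no trial vector sees \<open>y0\<close>, and then the load vanishes on it; or some \<open>x0\<close> does, and then the
  equation for \<open>y0\<close> fixes the component along \<open>x0\<close> and leaves a smaller system.
\<close>
lemma finite_rank_system_solvable:
  fixes B :: "'s \<Rightarrow> 's \<Rightarrow> real" and l :: "'s \<Rightarrow> real" and D :: "'k \<Rightarrow> 's \<Rightarrow> real"
    and comb :: "'s \<Rightarrow> real \<Rightarrow> 's \<Rightarrow> 's"
  assumes "finite K" and "X \<noteq> {}"
    and "\<And>u v c. u \<in> X \<Longrightarrow> v \<in> X \<Longrightarrow> comb u c v \<in> X"
    and "\<And>u v c. u \<in> Y \<Longrightarrow> v \<in> Y \<Longrightarrow> comb u c v \<in> Y"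
    and "\<And>k u v c. k \<in> K \<Longrightarrow> u \<in> Y \<Longrightarrow> v \<in> Y \<Longrightarrow> D k (comb u c v) = D k u + c * D k v"
    and "\<And>u v w c. u \<in> X \<Longrightarrow> v \<in> X \<Longrightarrow> w \<in> Y \<Longrightarrow> B (comb u c v) w = B u w + c * B v w"
    and "\<And>u v w c. u \<in> Y \<Longrightarrow> v \<in> Y \<Longrightarrow> w \<in> X \<Longrightarrow> B w (comb u c v) = B w u + c * B w v"
    and "\<And>u v c. u \<in> Y \<Longrightarrow> v \<in> Y \<Longrightarrow> l (comb u c v) = l u + c * l v"
    and "\<And>x y. x \<in> X \<Longrightarrow> y \<in> Y \<Longrightarrow> (\<And>k. k \<in> K \<Longrightarrow> D k y = 0) \<Longrightarrow> B x y = 0"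
    and "\<And>y. y \<in> Y \<Longrightarrow> (\<And>x. x \<in> X \<Longrightarrow> B x y = 0) \<Longrightarrow> l y = 0"
  shows "\<exists>x\<in>X. \<forall>y\<in>Y. B x y = l y"
  using assms
proof (induction K arbitrary: X Y l rule: finite_induct)
  case empty
  note ne = empty(1) and null = empty(8) and compat = empty(9)
  have "B x y = 0 \<and> l y = 0" if "x \<in> X" "y \<in> Y" for x y
    using null compat that by (metis empty_iff)
  then show ?case using ne by fastforce
next
  case (insert k K)
  note ne = insert.prems(1) and cX = insert.prems(2) and cY = insert.prems(3)
    and linD = insert.prems(4) and linB1 = insert.prems(5) and linB2 = insert.prems(6)
    and linl = insert.prems(7) and null = insert.prems(8) and compat = insert.prems(9)
  have linDK: "D j (comb u c v) = D j u + c * D j v" if "j \<in> K" "u \<in> Y" "v \<in> Y" for j u v c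
    using that by (intro linD) auto
  show ?case
  proof (cases "\<forall>y\<in>Y. D k y = 0")
    case True
    have nullY: "B x y = 0" if "x \<in> X" "y \<in> Y" "\<And>j. j \<in> K \<Longrightarrow> D j y = 0" for x y
      using True that by (intro null) auto
    show ?thesis
      by (rule insert.IH[OF ne cX cY linDK linB1 linB2 linl nullY compat]) assumption+
  next
    case False
    then obtain y0 where y0: "y0 \<in> Y" "D k y0 \<noteq> 0" by blast
    define Z where "Z = {y \<in> Y. D k y = 0}"
    have cZ: "comb u c v \<in> Z" if "u \<in> Z" "v \<in> Z" for u v c
      using that cY linD by (auto simp: Z_def)
    have split: "comb y (- D k y / D k y0) y0 \<in> Z" if "y \<in> Y" for y
      using that y0 cY linD by (auto simp: Z_def)
    have nullZ: "B x y = 0" if "x \<in> X" "y \<in> Z" "\<And>j. j \<in> K \<Longrightarrow> D j y = 0" for x y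
      using that by (intro null) (auto simp: Z_def)
    have ZY: "y \<in> Y" if "y \<in> Z" for y using that by (simp add: Z_def)
    have linDZ: "D j (comb u c v) = D j u + c * D j v" if "j \<in> K" "u \<in> Z" "v \<in> Z" for j u v c
      using linDK that ZY by simp
    have linB2Z: "B w (comb u c v) = B w u + c * B w v" if "u \<in> Z" "v \<in> Z" "w \<in> X" for u v w c
      using linB2 that ZY by simp
    have linlZ: "l (comb u c v) = l u + c * l v" if "u \<in> Z" "v \<in> Z" for u v c
      using linl that ZY by simp
    show ?thesis
    proof (cases "\<forall>x\<in>X. B x y0 = 0")
      case True
      have "\<exists>x\<in>X. \<forall>y\<in>Z. B x y = l y"
        by (rule insert.IH[OF ne cX cZ linDZ linB1 linB2Z linlZ nullZ compat])
          (assumption | rule ZY)+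
      then obtain x where x: "x \<in> X" "\<forall>y\<in>Z. B x y = l y" by blast
      have "l y0 = 0" using compat[OF y0(1)] True by blast
      have "B x y = l y" if "y \<in> Y" for y
        using x split[OF that] linB2[OF that y0(1) x(1)] linl[OF that y0(1)] True \<open>l y0 = 0\<close>
        by (metis add.right_neutral mult_zero_right)
      then show ?thesis using x(1) by blast
    next
      case False
      then obtain x0 where x0: "x0 \<in> X" "B x0 y0 \<noteq> 0" by blast
      define W where "W = {x \<in> X. B x y0 = 0}"
      define r where "r = l y0 / B x0 y0"
      have proj: "comb x (- B x y0 / B x0 y0) x0 \<in> W" if "x \<in> X" for x
        using that x0 cX linB1 y0 by (auto simp: W_def)
      have "\<exists>x\<in>W. \<forall>y\<in>Z. B x y = l y - r * B x0 y"
      proof (rule insert.IH)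
        show "W \<noteq> {}" using proj ne by blast
        show "comb u c v \<in> W" if "u \<in> W" "v \<in> W" for u v c
          using that cX linB1 y0 by (simp add: W_def)
        show "l y - r * B x0 y = 0" if y: "y \<in> Z" and van: "\<And>x. x \<in> W \<Longrightarrow> B x y = 0" for y
        proof -
          have yY: "y \<in> Y" using y by (rule ZY)
          let ?c = "- B x0 y / B x0 y0"
          have "B x (comb y ?c y0) = 0" if x: "x \<in> X" for x
            using van[OF proj[OF x]] linB1[OF x x0(1) yY, of "- B x y0 / B x0 y0"]
              linB2[OF yY y0(1) x, of ?c] x0
            by (simp add: field_simps)
          then have "l (comb y ?c y0) = 0" by (rule compat[OF cY[OF yY y0(1)]])
          then show ?thesis using linl[OF yY y0(1), of ?c] x0 by (simp add: r_def field_simps)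
        qed
        show "l (comb u c v) - r * B x0 (comb u c v) =
            (l u - r * B x0 u) + c * (l v - r * B x0 v)" if "u \<in> Z" "v \<in> Z" for u v c
          using linlZ[OF that] linB2Z[OF that x0(1)] by (simp add: algebra_simps)
        show "B (comb u c v) w = B u w + c * B v w" if "u \<in> W" "v \<in> W" "w \<in> Z" for u v w c
          using linB1 that ZY by (simp add: W_def)
        show "B w (comb u c v) = B w u + c * B w v" if "u \<in> Z" "v \<in> Z" "w \<in> W" for u v w c
          using linB2Z that by (simp add: W_def)
        show "B x y = 0" if "x \<in> W" "y \<in> Z" "\<And>k. k \<in> K \<Longrightarrow> D k y = 0" for x y
          using nullZ[OF _ that(2,3)] that(1) by (simp add: W_def)
      qed (fact cZ linDZ)+
      then obtain x where x: "x \<in> W" "\<forall>y\<in>Z. B x y = l y - r * B x0 y" by blast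
      then have xX: "x \<in> X" by (simp add: W_def)
      have "B (comb x r x0) y = l y" if yY: "y \<in> Y" for y
      proof -
        let ?c = "- D k y / D k y0"
        have 1: "B (comb x r x0) (comb y ?c y0) = l (comb y ?c y0)"
          using x split[OF yY] linB1[OF xX x0(1)] by (simp add: Z_def)
        have 2: "B (comb x r x0) y0 = l y0"
          using x linB1[OF xX x0(1) y0(1)] x0 by (simp add: W_def r_def)
        show ?thesis
          using 1 2 linB2[OF yY y0(1) cX[OF xX x0(1)]] linl[OF yY y0(1)] by simp
      qed
      then show ?thesis using cX[OF xX x0(1)] by blast
    qed
  qed
qed

section \<open>Affine functions\<close>

lemma P1_iff_linear: "p \<in> P1 \<longleftrightarrow> linear (\<lambda>x. p x - p 0)"
proof
  assume "p \<in> P1"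
  then obtain L b where "linear L" "p = (\<lambda>x. L x + b)" by (auto simp: P1_def)
  then show "linear (\<lambda>x. p x - p 0)" by (simp add: linear_0)
next
  assume "linear (\<lambda>x. p x - p 0)"
  then show "p \<in> P1" unfolding P1_def by (intro CollectI exI[of _ "\<lambda>x. p x - p 0"] exI[of _ "p 0"]) auto
qed

lemma P1_const [intro, simp]: "(\<lambda>_. c) \<in> P1"
  by (simp add: P1_iff_linear linear_zero)

lemma P1_linear: "linear L \<Longrightarrow> L \<in> P1"
  by (auto simp: P1_iff_linear linear_0)

lemma P1_add [intro]: "p \<in> P1 \<Longrightarrow> q \<in> P1 \<Longrightarrow> (\<lambda>x. p x + q x) \<in> P1"
  unfolding P1_iff_linear by (drule (1) linear_compose_add) (simp add: algebra_simps)

lemma P1_scaleR [intro]: "p \<in> P1 \<Longrightarrow> (\<lambda>x. c *\<^sub>R p x) \<in> P1"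
  unfolding P1_iff_linear by (drule linear_compose_scale_right[of _ c]) (simp add: algebra_simps)

lemma P1_diff [intro]: "p \<in> P1 \<Longrightarrow> q \<in> P1 \<Longrightarrow> (\<lambda>x. p x - q x) \<in> P1"
  unfolding P1_iff_linear by (drule (1) linear_compose_sub) (simp add: algebra_simps)

lemma P1_sum [intro]: "(\<And>i. i \<in> I \<Longrightarrow> p i \<in> P1) \<Longrightarrow> (\<lambda>x. \<Sum>i\<in>I. p i x) \<in> P1"
  by (induction I rule: infinite_finite_induct) auto

lemma P1_linear_compose: "linear f \<Longrightarrow> p \<in> P1 \<Longrightarrow> (\<lambda>x. f (p x)) \<in> P1"
  unfolding P1_iff_linear
  using linear_compose[of "\<lambda>x. p x - p 0" f] by (simp add: o_def linear_diff)

lemma P1_inner [intro]: "p \<in> P1 \<Longrightarrow> (\<lambda>x. p x \<bullet> n) \<in> P1"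
  by (rule P1_linear_compose) (auto intro: bounded_linear.linear bounded_linear_inner_left)

lemma P1_mult_vector [intro]:
  assumes "(p :: 'a::real_vector \<Rightarrow> real) \<in> P1" shows "(\<lambda>x. p x *\<^sub>R v) \<in> P1"
  by (rule P1_linear_compose[OF _ assms]) (auto intro: bounded_linear.linear bounded_linear_scaleR_left)

lemma P1_affine_sum:
  assumes "p \<in> P1" "sum u C = 1"
  shows "p (\<Sum>c\<in>C. u c *\<^sub>R c) = (\<Sum>c\<in>C. u c *\<^sub>R p c)"
proof -
  obtain L b where L: "linear L" "p = (\<lambda>x. L x + b)" using assms by (auto simp: P1_def)
  then show ?thesis
    using assms(2) by (simp add: linear_sum linear_scale scaleR_add_right sum.distrib flip: scaleR_sum_left)
qed

text \<open>
  The form in which affine functions are restricted to a line in the direction of an edge.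
\<close>
lemma P1_along_line:
  assumes "p \<in> P1" shows "p (y + r *\<^sub>R (b - a)) = p y + r *\<^sub>R (p b - p a)"
proof -
  obtain L c where L: "linear L" "p = (\<lambda>x. L x + c)" using assms by (auto simp: P1_def)
  then show ?thesis by (simp add: linear_add linear_scale linear_diff)
qed

lemma P1_eq_on_affine_hull:
  assumes "p \<in> P1" "q \<in> P1" "finite C" "\<And>c. c \<in> C \<Longrightarrow> p c = q c" "x \<in> affine hull C"
  shows "p x = q x"
  using assms(5) P1_affine_sum[OF assms(1)] P1_affine_sum[OF assms(2)] assms(4)
  by (auto simp: affine_hull_finite[OF assms(3)])

lemma P1_continuous_on:
  fixes p :: "'a::euclidean_space \<Rightarrow> 'b::real_normed_vector"
  assumes "p \<in> P1" shows "continuous_on A p"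
proof -
  obtain L c where L: "linear L" "p = (\<lambda>x. L x + c)" using assms by (auto simp: P1_def)
  show ?thesis unfolding L(2)
    by (intro continuous_on_add continuous_on_const linear_continuous_on)
      (use L(1) linear_conv_bounded_linear in blast)
qed

section \<open>Barycentric coordinates\<close>

text \<open>
  The barycentric coordinate $\lambda_a$ with respect to the vertex set \<open>C\<close>, as an affine function on the
  whole space.
\<close>
definition bary :: "'a::euclidean_space set \<Rightarrow> 'a \<Rightarrow> 'a \<Rightarrow> real" where
  "bary C a = (SOME p. p \<in> P1 \<and> (\<forall>c\<in>C. p c = (if c = a then 1 else 0)))"

definition bary_grad :: "'a::euclidean_space set \<Rightarrow> 'a \<Rightarrow> 'a" where
  "bary_grad C a = (\<Sum>i\<in>Basis. (bary C a i - bary C a 0) *\<^sub>R i)"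

locale full_simplex =
  fixes C :: "'a::euclidean_space set"
  assumes indep: "\<not> affine_dependent C" and card_C: "card C = Suc DIM('a)"
begin

lemma finite_C [simp]: "finite C" using indep by (rule aff_independent_finite)

lemma affine_hull_C: "affine hull C = UNIV"
proof -
  have "aff_dim C = DIM('a)" using aff_dim_affine_independent[OF indep] card_C by linarith
  then show ?thesis by (simp add: aff_dim_eq_full)
qed

text \<open>
  Affine independence means that the edges issuing from \<open>a\<close> are linearly independent, so a linear
  functional can be prescribed on them.
\<close>
lemma bary_exists:
  assumes "a \<in> C"
  shows "\<exists>p. p \<in> P1 \<and> (\<forall>c\<in>C. p c = (if c = a then 1 else (0::real)))"
proof -
  have "independent ((\<lambda>x. -a + x) ` (C - {a}))"
    using indep affine_dependent_iff_dependent2[OF assms] by simp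
  then obtain L :: "'a \<Rightarrow> real" where L: "linear L" "\<forall>x\<in>(\<lambda>x. -a + x) ` (C - {a}). L x = -1"
    using linear_independent_extend[of _ "\<lambda>_. -1 :: real"] by metis
  have P1: "(\<lambda>x. L x + (1 - L a)) \<in> P1" by (rule P1_add[OF P1_linear[OF L(1)] P1_const])
  have "L c + (1 - L a) = (if c = a then 1 else 0)" if c: "c \<in> C" for c
  proof (cases "c = a")
    case False
    then have "-a + c \<in> (\<lambda>x. -a + x) ` (C - {a})" using c by blast
    then have "L (-a + c) = -1" using L(2) by blast
    then show ?thesis using False linear_add[OF L(1), of "-a" c] linear_neg[OF L(1), of a] by simp
  qed simp
  with P1 show ?thesis by blast
qed

lemma bary_P1 [simp, intro]: "a \<in> C \<Longrightarrow> bary C a \<in> P1"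
  and bary_vertex: "a \<in> C \<Longrightarrow> c \<in> C \<Longrightarrow> bary C a c = (if c = a then 1 else 0)"
  unfolding bary_def using someI_ex[OF bary_exists, of a] by auto

lemma P1_eqI:
  assumes "p \<in> P1" "q \<in> P1" "\<And>c. c \<in> C \<Longrightarrow> p c = q c"
  shows "p = q"
proof
  show "p x = q x" for x
    by (rule P1_eq_on_affine_hull[OF assms(1,2) finite_C assms(3)]) (simp_all add: affine_hull_C)
qed

lemma P1_bary_combination: "A \<subseteq> C \<Longrightarrow> (\<lambda>x. \<Sum>a\<in>A. bary C a x *\<^sub>R w a) \<in> P1"
  by (rule P1_sum, rule P1_mult_vector, rule bary_P1) blast

lemma P1_expand:
  assumes "p \<in> P1" shows "p x = (\<Sum>a\<in>C. bary C a x *\<^sub>R p a)"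
proof -
  have "p = (\<lambda>x. \<Sum>a\<in>C. bary C a x *\<^sub>R p a)"
    by (rule P1_eqI[OF assms P1_bary_combination])
      (simp_all add: bary_vertex if_distrib[of "\<lambda>r. r *\<^sub>R _"] cong: if_cong)
  then show ?thesis by (rule fun_cong)
qed

lemma sum_bary: "(\<Sum>a\<in>C. bary C a x) = 1"
  using P1_expand[of "\<lambda>_. 1::real" x] by simp

lemma bary_sum: "(\<Sum>a\<in>C. bary C a x *\<^sub>R a) = x"
  using P1_expand[of "\<lambda>x. x" x] P1_linear[OF linear_ident] by metis

lemma bary_combination:
  assumes "sum u C = 1" "a \<in> C" shows "bary C a (\<Sum>c\<in>C. u c *\<^sub>R c) = u a"
  using P1_affine_sum[OF bary_P1[OF assms(2)] assms(1)] assms(2)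
  by (simp add: bary_vertex if_distrib[of "\<lambda>r. _ * r"] cong: if_cong)

lemma mem_simplex_iff: "x \<in> convex hull C \<longleftrightarrow> (\<forall>a\<in>C. 0 \<le> bary C a x)"
proof
  assume "x \<in> convex hull C"
  then obtain u where "\<forall>a\<in>C. 0 \<le> u a" "sum u C = 1" "x = (\<Sum>a\<in>C. u a *\<^sub>R a)"
    by (auto simp: convex_hull_finite)
  then show "\<forall>a\<in>C. 0 \<le> bary C a x" using bary_combination by simp
next
  assume "\<forall>a\<in>C. 0 \<le> bary C a x"
  then show "x \<in> convex hull C"
    using sum_bary[of x] bary_sum[of x] by (auto simp: convex_hull_finite)
qed

lemma bary_le_one:
  assumes "x \<in> convex hull C" "a \<in> C" shows "bary C a x \<le> 1"
  using assms sum_bary[of x] sum_nonneg_leq_bound[of C "\<lambda>a. bary C a x" 1 a]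
  by (auto simp: mem_simplex_iff)

lemma bary_eq_affine:
  assumes "a \<in> C" shows "bary C a x = bary C a y + bary_grad C a \<bullet> (x - y)"
proof -
  obtain L b where L: "linear L" "bary C a = (\<lambda>x. L x + b)" using bary_P1[OF assms] by (auto simp: P1_def)
  have "L (x - y) = bary_grad C a \<bullet> (x - y)"
  proof -
    have "L (x - y) = L (\<Sum>i\<in>Basis. ((x - y) \<bullet> i) *\<^sub>R i)" by (simp add: euclidean_representation)
    also have "\<dots> = (\<Sum>i\<in>Basis. ((x - y) \<bullet> i) * L i)" by (simp add: linear_sum[OF L(1)] linear_scale[OF L(1)])
    also have "\<dots> = bary_grad C a \<bullet> (x - y)"
      by (simp add: bary_grad_def L(2) inner_sum_right inner_commute[of _ "x - y"] linear_0[OF L(1)]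
          mult.commute[of "L _"])
    finally show ?thesis .
  qed
  then show ?thesis using linear_diff[OF L(1)] by (simp add: L(2))
qed

lemma other_vertex:
  obtains c where "c \<in> C" "c \<noteq> a"
proof -
  have "\<not> C \<subseteq> {a}" using card_C card_mono[of "{a}" C] by auto
  then show ?thesis using that by blast
qed

lemma bary_grad_nonzero:
  assumes "a \<in> C" shows "bary_grad C a \<noteq> 0"
proof
  assume 0: "bary_grad C a = 0"
  obtain c where "c \<in> C" "c \<noteq> a" using other_vertex .
  then show False using bary_eq_affine[OF assms, of a c] bary_vertex[OF assms] assms 0 by simp
qed

text \<open>
  The height of \<open>b\<close> over the opposite facet is thus the reciprocal of the norm of this gradient.
\<close>
lemma bary_grad_edge: "b \<in> C \<Longrightarrow> a \<in> C \<Longrightarrow> a \<noteq> b \<Longrightarrow> bary_grad C b \<bullet> (b - a) = 1"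
  using bary_eq_affine[of b b a] bary_vertex[of b] by simp

subsection \<open>Facets\<close>

abbreviation opp :: "'a \<Rightarrow> 'a set" where "opp b \<equiv> convex hull (C - {b})"

lemma facet_iff: "e facet_of (convex hull C) \<longleftrightarrow> (\<exists>b\<in>C. e = opp b)"
proof -
  have "opp b \<noteq> {}" if "b \<in> C" for b
  proof -
    obtain c where "c \<in> C" "c \<noteq> b" using other_vertex .
    then show ?thesis by auto
  qed
  then show ?thesis using facet_of_convex_hull_affine_independent[OF indep] by blast
qed

lemma affine_hull_opp:
  assumes "b \<in> C" shows "affine hull (opp b) = {x. bary C b x = 0}"
proof (intro set_eqI iffI CollectI; (drule CollectD)?)
  fix x assume x: "x \<in> affine hull opp b"
  have "bary C b x = (\<lambda>_. 0) x"
    by (rule P1_eq_on_affine_hull[of _ _ "C - {b}"])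
      (use assms x in \<open>auto simp: bary_vertex affine_hull_convex_hull\<close>)
  then show "bary C b x = 0" .
next
  fix x assume x: "bary C b x = 0"
  have "(\<Sum>a\<in>C - {b}. bary C a x) = 1" "(\<Sum>a\<in>C - {b}. bary C a x *\<^sub>R a) = x"
    using sum_bary[of x] bary_sum[of x] assms x by (simp_all add: sum.remove[of C b])
  then show "x \<in> affine hull opp b" by (auto simp: affine_hull_convex_hull affine_hull_finite)
qed

lemma mem_opp_iff:
  assumes "b \<in> C" shows "x \<in> opp b \<longleftrightarrow> bary C b x = 0 \<and> (\<forall>a\<in>C. 0 \<le> bary C a x)"
proof
  assume x: "x \<in> opp b"
  then have "x \<in> affine hull (opp b)" by (rule hull_inc)
  moreover have "x \<in> convex hull C" using x hull_mono[of "C - {b}" C convex] by blast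
  ultimately show "bary C b x = 0 \<and> (\<forall>a\<in>C. 0 \<le> bary C a x)"
    using affine_hull_opp[OF assms] mem_simplex_iff by auto
next
  assume x: "bary C b x = 0 \<and> (\<forall>a\<in>C. 0 \<le> bary C a x)"
  then have "(\<Sum>a\<in>C - {b}. bary C a x) = 1" "(\<Sum>a\<in>C - {b}. bary C a x *\<^sub>R a) = x"
    using sum_bary[of x] bary_sum[of x] assms by (simp_all add: sum.remove[of C b])
  then show "x \<in> opp b" using x by (auto simp: convex_hull_finite)
qed

lemma opp_inj: "b \<in> C \<Longrightarrow> c \<in> C \<Longrightarrow> opp b = opp c \<Longrightarrow> b = c"
proof (rule ccontr)
  assume b: "b \<in> C" and c: "c \<in> C" and eq: "opp b = opp c" and ne: "b \<noteq> c"
  have "b \<in> opp c" using b ne by (auto intro: hull_inc)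
  then have "b \<in> opp b" using eq by simp
  then show False using mem_opp_iff[OF b, of b] bary_vertex[OF b b] by simp
qed

definition onormal :: "'a \<Rightarrow> 'a" where "onormal b = - (1 / norm (bary_grad C b)) *\<^sub>R bary_grad C b"

lemma norm_onormal: "b \<in> C \<Longrightarrow> norm (onormal b) = 1"
  using bary_grad_nonzero by (simp add: onormal_def)

lemma bary_along_normal:
  "b \<in> C \<Longrightarrow> bary C b x = bary C b y - norm (bary_grad C b) * (onormal b \<bullet> (x - y))"
  using bary_eq_affine[of b x y] bary_grad_nonzero[of b] by (simp add: onormal_def)

text \<open>
  An affine function that vanishes on the facet vanishes at all vertices but \<open>b\<close> and is therefore a
  multiple of $\lambda_b$. Applied to $x \mapsto (x-y_0)\cdot n$, this makes \<open>n\<close> parallel to the gradient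
  of $\lambda_b$.
\<close>
lemma normal_unique:
  assumes b: "b \<in> C" and n: "norm n = 1" "\<And>x y. x \<in> opp b \<Longrightarrow> y \<in> opp b \<Longrightarrow> n \<bullet> (y - x) = 0"
  shows "n = onormal b \<or> n = - onormal b"
proof -
  obtain y0 where y0: "y0 \<in> C" "y0 \<noteq> b" using other_vertex .
  have p: "(\<lambda>x. (x - y0) \<bullet> n) \<in> P1" 
    by (rule P1_inner[OF P1_diff[OF P1_linear[OF linear_ident] P1_const]])
  have "(\<lambda>x. (x - y0) \<bullet> n) = (\<lambda>x. ((b - y0) \<bullet> n) *\<^sub>R bary C b x)"
  proof (rule P1_eqI[OF p])
    fix c assume c: "c \<in> C"
    show "(c - y0) \<bullet> n = ((b - y0) \<bullet> n) *\<^sub>R bary C b c"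
    proof (cases "c = b")
      case False
      then have "c \<in> opp b" "y0 \<in> opp b" using c y0 by (auto intro: hull_inc)
      then show ?thesis using n(2)[of y0 c] False by (simp add: bary_vertex[OF b c] inner_commute)
    qed (simp add: bary_vertex b)
  qed (rule P1_scaleR[OF bary_P1[OF b]])
  from fun_cong[OF this] have eq: "(x - y0) \<bullet> n = ((b - y0) \<bullet> n) * bary C b x" for x
    unfolding real_scaleR_def .
  define k where "k = - ((b - y0) \<bullet> n) * norm (bary_grad C b)"
  have "z \<bullet> n = z \<bullet> (k *\<^sub>R onormal b)" for z
  proof -
    have "bary C b y0 = 0" using bary_vertex b y0 by simp
    then have 1: "bary C b (y0 + z) = - norm (bary_grad C b) * (onormal b \<bullet> z)"
      using bary_along_normal[OF b, of "y0 + z" y0] by simp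
    have "z \<bullet> n = ((b - y0) \<bullet> n) * bary C b (y0 + z)"
      using eq[of "y0 + z"] by (simp only: add_diff_cancel_left')
    then show ?thesis by (simp add: 1 k_def inner_commute[of z "onormal b"])
  qed
  then have nk: "n = k *\<^sub>R onormal b" using vector_eq_ldot[of n "k *\<^sub>R onormal b"] by blast
  have "norm n = \<bar>k\<bar>" unfolding nk using norm_onormal[OF b] by simp
  then have "k = 1 \<or> k = -1" using n(1) by linarith
  then show ?thesis using nk by auto
qed

lemma onormal_opp: "b \<in> C \<Longrightarrow> x \<in> opp b \<Longrightarrow> y \<in> opp b \<Longrightarrow> onormal b \<bullet> (y - x) = 0"
  using bary_along_normal[of b y x] mem_opp_iff[of b] bary_grad_nonzero[of b] by simp

lemma onormal_simplex: "b \<in> C \<Longrightarrow> x \<in> opp b \<Longrightarrow> y \<in> convex hull C \<Longrightarrow> onormal b \<bullet> (y - x) \<le> 0"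
proof -
  assume b: "b \<in> C" and x: "x \<in> opp b" and y: "y \<in> convex hull C"
  have "0 \<le> 0 - norm (bary_grad C b) * (onormal b \<bullet> (y - x))"
    using bary_along_normal[OF b, of y x] x y b mem_opp_iff[OF b, of x] mem_simplex_iff[of y] by metis
  then have "norm (bary_grad C b) * (onormal b \<bullet> (y - x)) \<le> 0" by simp
  then show ?thesis using bary_grad_nonzero[OF b] by (simp add: mult_le_0_iff)
qed

lemma outward_normal_opp:
  assumes b: "b \<in> C" shows "outward_normal (convex hull C) (opp b) = onormal b"
  unfolding outward_normal_def
proof (rule the_equality)
  show "norm (onormal b) = 1 \<and> (\<forall>x\<in>opp b. \<forall>y\<in>opp b. onormal b \<bullet> (y - x) = 0) \<and>
        (\<forall>x\<in>opp b. \<forall>y\<in>convex hull C. onormal b \<bullet> (y - x) \<le> 0)"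
    using onormal_opp onormal_simplex norm_onormal b by blast
next
  fix n assume n: "norm n = 1 \<and> (\<forall>x\<in>opp b. \<forall>y\<in>opp b. n \<bullet> (y - x) = 0) \<and>
        (\<forall>x\<in>opp b. \<forall>y\<in>convex hull C. n \<bullet> (y - x) \<le> 0)"
  obtain y0 where y0: "y0 \<in> C" "y0 \<noteq> b" using other_vertex .
  then have "y0 \<in> opp b" by (auto intro: hull_inc)
  moreover have "b \<in> convex hull C" using b by (rule hull_inc)
  ultimately have le: "n \<bullet> (b - y0) \<le> 0" using n by blast
  have "onormal b \<bullet> (b - y0) < 0"
    using bary_grad_edge[OF b y0] bary_grad_nonzero[OF b] by (simp add: onormal_def)
  then have "n \<noteq> - onormal b" using le by auto
  then show "n = onormal b" using normal_unique[OF b, of n] n by blast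
qed

text \<open>
  The projection behind the surface measure is explicit: move along the normal by the signed distance
  $\lambda_b/|\nabla\lambda_b|$.
\<close>
lemma closest_point_opp:
  assumes b: "b \<in> C"
  shows "closest_point (affine hull (opp b)) x = x + (bary C b x / norm (bary_grad C b)) *\<^sub>R onormal b"
    (is "_ = ?p")
proof -
  let ?g = "norm (bary_grad C b)"
  have g: "?g > 0" using bary_grad_nonzero[OF b] by simp
  have nn: "onormal b \<bullet> onormal b = 1" using norm_onormal[OF b] by (simp add: norm_eq_1)
  have "bary C b ?p = 0" using bary_along_normal[OF b, of ?p x] g nn by simp
  then have p: "?p \<in> affine hull (opp b)" using affine_hull_opp[OF b] by simp
  have "dist x ?p \<le> dist x z" if z: "z \<in> affine hull (opp b)" for z
  proof -
    have "bary C b x = ?g * (onormal b \<bullet> (z - x))"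
      using bary_along_normal[OF b, of z x] z affine_hull_opp[OF b] by simp
    then have "\<bar>bary C b x\<bar> / ?g = \<bar>onormal b \<bullet> (z - x)\<bar>" using g by (simp add: abs_mult)
    also have "\<dots> \<le> norm (onormal b) * norm (z - x)" by (rule Cauchy_Schwarz_ineq2)
    finally show ?thesis using norm_onormal[OF b] g by (simp add: dist_norm norm_minus_commute)
  qed
  then show ?thesis using closest_point_unique[OF _ _ p, of x] by (simp add: convex_affine_hull closed_affine_hull)
qed

end

section \<open>Surface measure\<close>

lemma nn_integral_lborel_shift:
  fixes v :: "'a::euclidean_space"
  assumes [measurable]: "f \<in> borel_measurable borel"
  shows "(\<integral>\<^sup>+x. f (x + v) \<partial>lborel) = (\<integral>\<^sup>+x. f x \<partial>lborel)"
proof -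
  have "(\<integral>\<^sup>+x. f x \<partial>lborel) = (\<integral>\<^sup>+x. f x \<partial>distr lborel borel ((+) v))"
    by (simp add: lborel_distr_plus)
  also have "\<dots> = (\<integral>\<^sup>+x. f (v + x) \<partial>lborel)" by (rule nn_integral_distr) auto
  finally show ?thesis by (simp add: add.commute)
qed

text \<open>
  Fubini's theorem in the oblique coordinates $(y, r)\mapsto y + r t$, with \<open>y\<close> in the hyperplane
  $n\cdot y = k$. The surface measure on the hyperplane is represented by the slab of height one around
  it, in agreement with its definition. Because of this representation, translations and a rescaling of
  the line suffice: translate by $rt$, rescale \<open>r\<close> to the slab coordinate, and translate back along \<open>n\<close>,
  so that no orthonormal frame has to be chosen.
\<close>
lemma nn_integral_shear:
  fixes n t :: "'a::euclidean_space" and G :: "'a \<Rightarrow> ennreal"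
  assumes [measurable]: "G \<in> borel_measurable borel" and \<tau>: "n \<bullet> t \<noteq> 0"
    and n: "norm n = 1"
  shows "(\<integral>\<^sup>+x. \<integral>\<^sup>+r. indicator {-1/2..1/2} (n \<bullet> x - k) * G (x - (n \<bullet> x - k) *\<^sub>R n + r *\<^sub>R t) \<partial>lborel \<partial>lborel)
       = ennreal (1 / \<bar>n \<bullet> t\<bar>) * (\<integral>\<^sup>+x. G x \<partial>lborel)"
proof -
  let ?I = "\<lambda>s::real. indicator {-1/2..1/2} s :: ennreal"
  let ?H = "\<lambda>x s. ?I s * G (x - s *\<^sub>R n)"
  have "(\<integral>\<^sup>+x. \<integral>\<^sup>+r. ?I (n \<bullet> x - k) * G (x - (n \<bullet> x - k) *\<^sub>R n + r *\<^sub>R t) \<partial>lborel \<partial>lborel)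
     = (\<integral>\<^sup>+r. \<integral>\<^sup>+x. ?I (n \<bullet> x - k) * G (x - (n \<bullet> x - k) *\<^sub>R n + r *\<^sub>R t) \<partial>lborel \<partial>lborel)"
    by (subst lborel_pair.Fubini') auto
  also have "\<dots> = (\<integral>\<^sup>+r. \<integral>\<^sup>+x. ?H x ((n \<bullet> x - k) + (- (n \<bullet> t)) * r) \<partial>lborel \<partial>lborel)"
  proof (rule nn_integral_cong)
    fix r :: real
    \<comment> \<open>translate by $r t$, which shifts the slab coordinate by $r\,(n\cdot t)$\<close>
    have "(\<integral>\<^sup>+x. ?H x ((n \<bullet> x - k) + (- (n \<bullet> t)) * r) \<partial>lborel)
        = (\<integral>\<^sup>+x. ?H (x + r *\<^sub>R t) ((n \<bullet> (x + r *\<^sub>R t) - k) + (- (n \<bullet> t)) * r) \<partial>lborel)"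
      by (rule nn_integral_lborel_shift[symmetric]) measurable
    then show "(\<integral>\<^sup>+x. ?I (n \<bullet> x - k) * G (x - (n \<bullet> x - k) *\<^sub>R n + r *\<^sub>R t) \<partial>lborel)
        = (\<integral>\<^sup>+x. ?H x ((n \<bullet> x - k) + (- (n \<bullet> t)) * r) \<partial>lborel)"
      by (simp add: inner_add_right algebra_simps)
  qed
  also have "\<dots> = (\<integral>\<^sup>+x. \<integral>\<^sup>+r. ?H x ((n \<bullet> x - k) + (- (n \<bullet> t)) * r) \<partial>lborel \<partial>lborel)"
    by (subst lborel_pair.Fubini') auto
  also have "\<dots> = (\<integral>\<^sup>+x. ennreal (1 / \<bar>n \<bullet> t\<bar>) * (\<integral>\<^sup>+s. ?H x s \<partial>lborel) \<partial>lborel)"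
  proof (rule nn_integral_cong)
    fix x
    \<comment> \<open>for fixed \<open>x\<close>, the slab coordinate is an affine function of \<open>r\<close> with slope $-(n\cdot t)$\<close>
    have "(\<integral>\<^sup>+s. ?H x s \<partial>lborel)
        = \<bar>- (n \<bullet> t)\<bar> * (\<integral>\<^sup>+r. ?H x ((n \<bullet> x - k) + (- (n \<bullet> t)) * r) \<partial>lborel)"
      by (rule nn_integral_real_affine) (use \<tau> in auto)
    moreover have "ennreal (1 / \<bar>n \<bullet> t\<bar>) * ennreal \<bar>n \<bullet> t\<bar> = 1"
      using \<tau> by (simp flip: ennreal_mult)
    ultimately show "(\<integral>\<^sup>+r. ?H x ((n \<bullet> x - k) + (- (n \<bullet> t)) * r) \<partial>lborel)
        = ennreal (1 / \<bar>n \<bullet> t\<bar>) * (\<integral>\<^sup>+s. ?H x s \<partial>lborel)"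
      by (simp flip: mult.assoc)
  qed
  also have "\<dots> = ennreal (1 / \<bar>n \<bullet> t\<bar>) * (\<integral>\<^sup>+x. \<integral>\<^sup>+s. ?H x s \<partial>lborel \<partial>lborel)"
    by (rule nn_integral_cmult) auto
  also have "(\<integral>\<^sup>+x. \<integral>\<^sup>+s. ?H x s \<partial>lborel \<partial>lborel) = (\<integral>\<^sup>+s. \<integral>\<^sup>+x. ?H x s \<partial>lborel \<partial>lborel)"
    by (subst lborel_pair.Fubini') auto
  also have "\<dots> = (\<integral>\<^sup>+s. ?I s * (\<integral>\<^sup>+x. G x \<partial>lborel) \<partial>lborel)"
  proof (rule nn_integral_cong)
    fix s
    have "(\<integral>\<^sup>+x. G (x - s *\<^sub>R n) \<partial>lborel) = (\<integral>\<^sup>+x. G x \<partial>lborel)"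
      using nn_integral_lborel_shift[of G "- (s *\<^sub>R n)"] by simp
    then show "(\<integral>\<^sup>+x. ?H x s \<partial>lborel) = ?I s * (\<integral>\<^sup>+x. G x \<partial>lborel)"
      by (subst nn_integral_cmult) auto
  qed
  also have "\<dots> = (\<integral>\<^sup>+x. G x \<partial>lborel)"
    by (subst nn_integral_multc) auto
  finally show ?thesis .
qed

text \<open>
  The statement for integrable functions follows from the one for indicator functions, read as an
  identity of measures.
\<close>
lemma integral_shear:
  fixes n t :: "'a::euclidean_space" and G :: "'a \<Rightarrow> real"
  assumes G: "integrable lborel G" and \<tau>: "n \<bullet> t \<noteq> 0" and n: "norm n = 1"
  shows "(\<integral>x. \<integral>r. indicator {-1/2..1/2} (n \<bullet> x - k) * G (x - (n \<bullet> x - k) *\<^sub>R n + r *\<^sub>R t) \<partial>lborel \<partial>lborel)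
       = (1 / \<bar>n \<bullet> t\<bar>) * (\<integral>x. G x \<partial>lborel)"
proof -
  let ?I = "\<lambda>x. indicator {-1/2..1/2} (n \<bullet> x - k) :: real"
  let ?\<Phi> = "\<lambda>p. fst p - (n \<bullet> fst p - k) *\<^sub>R n + snd p *\<^sub>R t"
  let ?N = "density (lborel \<Otimes>\<^sub>M lborel) (\<lambda>p. ennreal (?I (fst p)))"
  have G' [measurable]: "G \<in> borel_measurable borel" using G by auto
  have [measurable]: "?\<Phi> \<in> borel_measurable (lborel \<Otimes>\<^sub>M lborel)" by measurable
  have eq: "distr ?N borel ?\<Phi> = density lborel (\<lambda>_. ennreal (1 / \<bar>n \<bullet> t\<bar>))"
  proof (rule measure_eqI)
    fix A :: "'a set" assume "A \<in> sets (distr ?N borel ?\<Phi>)"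
    then have A [measurable]: "A \<in> sets borel" by simp
    have "emeasure (distr ?N borel ?\<Phi>) A = (\<integral>\<^sup>+z. indicator A z \<partial>distr ?N borel ?\<Phi>)"
      by simp
    also have "\<dots> = (\<integral>\<^sup>+p. indicator A (?\<Phi> p) \<partial>?N)"
      by (rule nn_integral_distr) auto
    also have "\<dots> = (\<integral>\<^sup>+p. ennreal (?I (fst p)) * indicator A (?\<Phi> p) \<partial>(lborel \<Otimes>\<^sub>M lborel))"
      by (rule nn_integral_density) auto
    also have "\<dots> = (\<integral>\<^sup>+x. \<integral>\<^sup>+r. ennreal (?I x) * indicator A (?\<Phi> (x, r)) \<partial>lborel \<partial>lborel)"
      by (subst lborel.nn_integral_fst[symmetric]) auto
    also have "\<dots> = ennreal (1 / \<bar>n \<bullet> t\<bar>) * (\<integral>\<^sup>+x. indicator A x \<partial>lborel)"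
      using nn_integral_shear[OF _ \<tau> n, of "indicator A" k]
      by (simp add: ennreal_indicator)
    also have "\<dots> = emeasure (density lborel (\<lambda>_. ennreal (1 / \<bar>n \<bullet> t\<bar>))) A"
      by (simp add: emeasure_density_const)
    finally show "emeasure (distr ?N borel ?\<Phi>) A = emeasure (density lborel (\<lambda>_. ennreal (1 / \<bar>n \<bullet> t\<bar>))) A" .
  qed simp
  have int: "integrable (distr ?N borel ?\<Phi>) G"
    unfolding eq by (subst integrable_density) (use G in auto)
  then have "integrable ?N (\<lambda>p. G (?\<Phi> p))"
    by (subst (asm) integrable_distr_eq) auto
  then have intK: "integrable (lborel \<Otimes>\<^sub>M lborel) (\<lambda>p. ?I (fst p) * G (?\<Phi> p))"
    by (subst (asm) integrable_density) auto
  have "(\<integral>x. \<integral>r. ?I x * G (?\<Phi> (x, r)) \<partial>lborel \<partial>lborel) = (\<integral>p. ?I (fst p) * G (?\<Phi> p) \<partial>(lborel \<Otimes>\<^sub>M lborel))"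
    using lborel_pair.integral_fst'[OF intK] by simp
  also have "\<dots> = (\<integral>p. G (?\<Phi> p) \<partial>?N)"
    by (subst integral_density) auto
  also have "\<dots> = (\<integral>z. G z \<partial>distr ?N borel ?\<Phi>)"
    by (subst integral_distr) auto
  also have "\<dots> = (1 / \<bar>n \<bullet> t\<bar>) * (\<integral>x. G x \<partial>lborel)"
    unfolding eq by (subst integral_density) (use G in auto)
  finally show ?thesis by simp
qed

context full_simplex
begin

text \<open>
  The barycenter of the facet opposite to \<open>b\<close>.
\<close>
definition facet_center :: "'a \<Rightarrow> 'a" where
  "facet_center b = (\<Sum>c\<in>C - {b}. (1 / real DIM('a)) *\<^sub>R c)"

lemma bary_facet_center:
  assumes b: "b \<in> C" and c: "c \<in> C"
  shows "bary C c (facet_center b) = (if c = b then 0 else 1 / real DIM('a))"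
proof -
  let ?u = "\<lambda>c. if c = b then 0 else 1 / real DIM('a)"
  have *: "(\<Sum>c\<in>C. (?u c) *\<^sub>R f c) = (\<Sum>c\<in>C - {b}. (1 / real DIM('a)) *\<^sub>R f c)" for f :: "'a \<Rightarrow> 'b::real_vector"
  proof -
    have "(\<Sum>c\<in>C - {b}. (?u c) *\<^sub>R f c) = (\<Sum>c\<in>C - {b}. (1 / real DIM('a)) *\<^sub>R f c)"
      by (rule sum.cong) auto
    then show ?thesis by (simp add: sum.remove[OF finite_C b])
  qed
  have "facet_center b = (\<Sum>c\<in>C. ?u c *\<^sub>R c)" using *[of "\<lambda>c. c"] by (simp only: facet_center_def)
  moreover have "sum ?u C = 1"
    using *[of "\<lambda>_. 1::real"] card_C b by simp
  ultimately show ?thesis using bary_combination[OF _ c, of ?u] by (simp only:)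
qed

definition proj :: "'a \<Rightarrow> 'a \<Rightarrow> 'a" where
  "proj b x = x + (bary C b x / norm (bary_grad C b)) *\<^sub>R onormal b"

lemma bary_continuous [continuous_intros]:
  "b \<in> C \<Longrightarrow> continuous_on A f \<Longrightarrow> continuous_on A (\<lambda>x. bary C b (f x))"
  using continuous_on_compose2[OF P1_continuous_on[OF bary_P1, of b UNIV]] by blast

lemma continuous_on_proj [continuous_intros]:
  "b \<in> C \<Longrightarrow> continuous_on A (proj b)"
  unfolding proj_def by (intro continuous_intros) (auto simp: bary_grad_nonzero)

lemma bary_proj: "b \<in> C \<Longrightarrow> bary C b (proj b x) = 0"
  using bary_along_normal[of b "proj b x" x] bary_grad_nonzero[of b] norm_onormal[of b]
  by (simp add: proj_def norm_eq_1)

lemma dist_proj: "b \<in> C \<Longrightarrow> dist x (proj b x) = \<bar>bary C b x\<bar> / norm (bary_grad C b)"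
  by (simp add: dist_norm proj_def norm_onormal)

definition prism :: "'a \<Rightarrow> 'a set" where
  "prism b = {x. proj b x \<in> opp b \<and> dist x (proj b x) \<le> 1 / 2}"

lemma surface_measure_opp:
  "b \<in> C \<Longrightarrow> surface_measure (opp b) = distr (restrict_space lborel (prism b)) borel (proj b)"
proof -
  assume "b \<in> C"
  then have "closest_point (affine hull (opp b)) = proj b"
    by (intro ext) (simp only: closest_point_opp proj_def)
  then show ?thesis unfolding surface_measure_def Let_def prism_def by (simp only:)
qed

lemma compact_opp: "compact (opp b)"
  using finite_C by (simp add: finite_imp_compact_convex_hull)

lemma opp_borel [measurable]: "opp b \<in> sets borel"
  using compact_opp by (simp add: borel_closed compact_imp_closed)

lemma proj_measurable [measurable]: "b \<in> C \<Longrightarrow> proj b \<in> borel_measurable borel"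
  by (intro borel_measurable_continuous_onI continuous_on_proj)

lemma prism_borel: "b \<in> C \<Longrightarrow> prism b \<in> sets borel"
  unfolding prism_def by measurable

lemma sets_surface_measure [simp, measurable_cong]:
  "b \<in> C \<Longrightarrow> sets (surface_measure (opp b)) = sets borel"
  by (simp add: surface_measure_opp)

lemma space_surface_measure [simp]: "b \<in> C \<Longrightarrow> space (surface_measure (opp b)) = UNIV"
  by (simp add: surface_measure_opp)

lemma proj_restrict_measurable:
  "b \<in> C \<Longrightarrow> proj b \<in> borel_measurable (restrict_space lborel (prism b))"
  by (rule measurable_restrict_space1) simp

lemma AE_surface_measure: "b \<in> C \<Longrightarrow> AE x in surface_measure (opp b). x \<in> opp b"
  unfolding surface_measure_opp
  by (subst AE_distr_iff[OF proj_restrict_measurable])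
    (auto simp: space_restrict_space simp del: divide_le_eq_numeral1, auto simp: prism_def)

lemma finite_surface_measure:
  assumes b: "b \<in> C" shows "finite_measure (surface_measure (opp b))"
proof (rule finite_measureI)
  obtain B where B: "\<And>x. x \<in> opp b \<Longrightarrow> norm x \<le> B"
    using compact_imp_bounded[OF compact_opp] unfolding bounded_iff by blast
  have "bounded (prism b)"
  proof (rule boundedI)
    fix x assume "x \<in> prism b"
    then have "norm (proj b x) \<le> B" "norm (x - proj b x) \<le> 1/2" using B by (auto simp: dist_norm prism_def)
    then show "norm x \<le> B + 1/2" using norm_triangle_ineq[of "x - proj b x" "proj b x"] by simp
  qed
  then have "emeasure lborel (prism b) < \<infinity>" by (rule emeasure_bounded_finite)
  then show "emeasure (surface_measure (opp b)) (space (surface_measure (opp b))) \<noteq> \<infinity>"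
    using b prism_borel[OF b]
    by (simp add: surface_measure_opp emeasure_distr proj_restrict_measurable space_restrict_space
        emeasure_restrict_space)
qed

lemma integrable_surface_measure:
  fixes h :: "'a \<Rightarrow> 'b::{banach, second_countable_topology}"
  assumes b: "b \<in> C" and h: "continuous_on UNIV h"
  shows "integrable (surface_measure (opp b)) h"
proof -
  interpret finite_measure "surface_measure (opp b)" by (rule finite_surface_measure[OF b])
  have "compact (h ` opp b)"
    by (rule compact_continuous_image[OF continuous_on_subset[OF h subset_UNIV] compact_opp])
  from compact_imp_bounded[OF this] obtain B where B: "\<And>x. x \<in> opp b \<Longrightarrow> norm (h x) \<le> B"
    unfolding bounded_iff by auto
  show ?thesis
  proof (rule integrable_const_bound[of _ B])
    show "AE x in surface_measure (opp b). norm (h x) \<le> B" using AE_surface_measure[OF b] B by auto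
    show "h \<in> borel_measurable (surface_measure (opp b))"
      using borel_measurable_continuous_onI[OF h] sets_surface_measure[OF b]
      by (simp cong: measurable_cong_sets)
  qed
qed

lemma integral_surface_cong:
  fixes h h' :: "'a \<Rightarrow> 'b::{banach, second_countable_topology}"
  assumes "b \<in> C" "continuous_on UNIV h" "continuous_on UNIV h'" "\<And>x. x \<in> opp b \<Longrightarrow> h x = h' x"
  shows "(\<integral>x. h x \<partial>surface_measure (opp b)) = (\<integral>x. h' x \<partial>surface_measure (opp b))"
  using assms integrable_surface_measure[OF assms(1,2)] integrable_surface_measure[OF assms(1,3)]
    AE_surface_measure[OF assms(1)]
  by (intro integral_cong_AE) auto

text \<open>
  The indicator of the slab is kept apart from that of the facet, since it is the part that appears in
  \<open>integral_shear\<close>.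
\<close>
lemma integral_surface_measure:
  fixes h :: "'a \<Rightarrow> real"
  assumes b: "b \<in> C" and h: "continuous_on UNIV h"
  shows "(\<integral>x. h x \<partial>surface_measure (opp b))
       = (\<integral>x. indicator {-1/2..1/2} (bary C b x / norm (bary_grad C b)) *
               (indicator (opp b) (proj b x) * h (proj b x)) \<partial>lborel)"
proof -
  have [measurable]: "h \<in> borel_measurable borel" using borel_measurable_continuous_onI[OF h] .
  have slab: "dist x (proj b x) \<le> 1 / 2 \<longleftrightarrow> bary C b x / norm (bary_grad C b) \<in> {-1/2..1/2}" for x
  proof -
    have "dist x (proj b x) = \<bar>bary C b x / norm (bary_grad C b)\<bar>" by (simp add: dist_proj b)
    then show ?thesis by (simp only: abs_le_iff atLeastAtMost_iff) linarith
  qed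
  have "(\<integral>x. h x \<partial>surface_measure (opp b)) = (\<integral>x. h (proj b x) \<partial>restrict_space lborel (prism b))"
    using b by (simp add: surface_measure_opp integral_distr proj_restrict_measurable)
  also have "\<dots> = (\<integral>x. indicator (prism b) x *\<^sub>R h (proj b x) \<partial>lborel)"
    using prism_borel[OF b] by (subst integral_restrict_space) auto
  also have "\<dots> = (\<integral>x. indicator {-1/2..1/2} (bary C b x / norm (bary_grad C b)) *
               (indicator (opp b) (proj b x) * h (proj b x)) \<partial>lborel)"
    by (intro Bochner_Integration.integral_cong)
      (use slab in \<open>auto simp: indicator_def prism_def split: if_splits\<close>)
  finally show ?thesis .
qed

text \<open>
  The points whose projection lies in the relative interior of the facet form an open subset of the
  prism, so a continuous function with vanishing integral vanishes on the relative interior. Every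
  point of the facet is a limit of relative interior points on the way to the center of the facet.
\<close>
lemma continuous_zero_if_surface_integral_zero:
  fixes h :: "'a \<Rightarrow> real"
  assumes b: "b \<in> C" and h: "continuous_on UNIV h" "\<And>x. 0 \<le> h x"
    and 0: "(\<integral>x. h x \<partial>surface_measure (opp b)) = 0" and y: "y \<in> opp b"
  shows "h y = 0"
proof -
  let ?g = "norm (bary_grad C b)"
  have g: "?g > 0" using bary_grad_nonzero[OF b] by simp
  have [measurable]: "h \<in> borel_measurable borel" using borel_measurable_continuous_onI[OF h(1)] .
  have "AE x in surface_measure (opp b). h x = 0"
    using 0 integral_nonneg_eq_0_iff_AE[OF integrable_surface_measure[OF b h(1)]] h(2) by simp
  then have "AE x in restrict_space lborel (prism b). h (proj b x) = 0"
    unfolding surface_measure_opp[OF b]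
    by (subst (asm) AE_distr_iff[OF proj_restrict_measurable[OF b]]) simp_all
  then have ae: "AE x in lborel. x \<in> prism b \<longrightarrow> h (proj b x) = 0"
    using prism_borel[OF b] by (subst (asm) AE_restrict_space_iff) auto
  define W where "W = {x. \<bar>bary C b x\<bar> / ?g < 1/2} \<inter> (\<Inter>c\<in>C - {b}. {x. 0 < bary C c (proj b x)})
      \<inter> {x. h (proj b x) \<noteq> 0}"
  have hp: "continuous_on UNIV (\<lambda>x. h (proj b x))"
    by (rule continuous_on_compose2[OF h(1) continuous_on_proj[OF b]]) auto
  have "open {x. \<bar>bary C b x\<bar> / ?g < 1/2}"
    using g by (intro open_Collect_less continuous_intros b) auto
  moreover have "open {x. 0 < bary C c (proj b x)}" if "c \<in> C - {b}" for c
    using that by (intro open_Collect_less continuous_intros b) auto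
  moreover have "open {x. h (proj b x) \<noteq> 0}"
    by (intro open_Collect_neq hp continuous_on_const)
  ultimately have "open W" unfolding W_def by (intro open_Int open_INT finite_Diff finite_C ballI)
  have W_sub: "W \<subseteq> {x. \<not> (x \<in> prism b \<longrightarrow> h (proj b x) = 0)}"
  proof
    fix x assume x: "x \<in> W"
    then have "0 \<le> bary C c (proj b x)" if "c \<in> C" for c
      using bary_proj[OF b, of x] that unfolding W_def by (cases "c = b") (auto intro: less_imp_le)
    then have "proj b x \<in> opp b"
      using bary_proj[OF b, of x] mem_opp_iff[OF b] by simp
    then show "x \<in> {x. \<not> (x \<in> prism b \<longrightarrow> h (proj b x) = 0)}"
      using x by (auto simp: W_def dist_proj b prism_def)
  qed
  have "AE x in lborel. x \<notin> W"
    using ae by eventually_elim (use W_sub in blast)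
  then have "W \<in> null_sets lborel"
    using AE_iff_null_sets[of W lborel] \<open>open W\<close> by simp
  then have "negligible W"
    by (simp add: negligible_iff_null_sets null_sets_completionI)
  then have W: "W = {}" using \<open>open W\<close> open_not_negligible by blast
  have pos: "h z = 0" if z: "bary C b z = 0" "\<And>c. c \<in> C - {b} \<Longrightarrow> 0 < bary C c z" for z
  proof -
    have "proj b z = z" using z by (simp add: proj_def)
    then have "z \<in> W" if "h z \<noteq> 0" using z that by (simp add: W_def)
    then show ?thesis using W by blast
  qed
  let ?m = "facet_center b"
  define z where "z r = y + r *\<^sub>R (?m - y)" for r :: real
  have bz: "bary C c (z r) = bary C c y + r * (bary C c ?m - bary C c y)" if "c \<in> C" for c r
    unfolding z_def using P1_along_line[OF bary_P1[OF that], of y r ?m y] by simp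
  have "h (z r) = 0" if r: "r \<in> {0<..1}" for r
  proof (rule pos)
    show "bary C b (z r) = 0" using bz[OF b] bary_facet_center[OF b b] y mem_opp_iff[OF b] by simp
    fix c assume c: "c \<in> C - {b}"
    have "bary C c (z r) = (1 - r) * bary C c y + r * (1 / real DIM('a))"
      using bz[of c r] bary_facet_center[OF b, of c] c by (simp add: algebra_simps)
    moreover have "0 \<le> (1 - r) * bary C c y" using r y mem_opp_iff[OF b] c by simp
    moreover have "0 < r * (1 / real DIM('a))" using r by simp
    ultimately show "0 < bary C c (z r)" by linarith
  qed
  moreover have "continuous_on (closure {0<..1}) (\<lambda>r. h (z r))"
    unfolding z_def by (rule continuous_on_compose2[OF h(1) _ subset_UNIV]) (intro continuous_intros)
  moreover have "(0::real) \<in> closure {0<..1}" by simp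
  ultimately have "h (z 0) = 0"
    using continuous_constant_on_closure[of "{0<..1}" "\<lambda>r. h (z r)" 0 0] by blast
  then show ?thesis by (simp add: z_def)
qed

lemma surface_measure_pos:
  assumes b: "b \<in> C" shows "0 < measure (surface_measure (opp b)) UNIV"
proof (rule ccontr)
  assume "\<not> ?thesis"
  then have "measure (surface_measure (opp b)) UNIV = 0" using zero_less_measure_iff by blast
  then have "(\<integral>x. 1 \<partial>surface_measure (opp b)) = (0::real)" using b by simp
  moreover obtain c where "c \<in> C" "c \<noteq> b" using other_vertex .
  moreover from this have "c \<in> opp b" by (auto intro: hull_inc)
  ultimately show False
    using continuous_zero_if_surface_integral_zero[OF b, of "\<lambda>_. 1" c] by simp
qed

lemma measure_facet: "b \<in> C \<Longrightarrow> measure (surface_measure (opp b)) (opp b) = measure (surface_measure (opp b)) UNIV"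
  using AE_surface_measure[of b] finite_measure.finite_measure_eq_AE[OF finite_surface_measure, of b "opp b" UNIV]
  by auto

lemma compact_simplex: "compact (convex hull C)"
  by (simp add: finite_imp_compact_convex_hull)

lemma simplex_borel [measurable]: "convex hull C \<in> sets borel"
  using compact_simplex by (simp add: borel_closed compact_imp_closed)

lemma integrable_simplex:
  fixes h :: "'a \<Rightarrow> real"
  assumes h: "continuous_on UNIV h" shows "integrable lborel (\<lambda>x. indicator (convex hull C) x * h x)"
  using borel_integrable_compact[OF compact_simplex, of h] continuous_on_subset[OF h]
  by (simp add: indicator_def if_distrib[of "\<lambda>r. r * _"] cong: if_cong)

text \<open>
  Green's formula for the direction of the edge from \<open>a\<close> to \<open>b\<close>. A line in this direction that starts at
  a point \<open>y\<close> of the facet opposite to \<open>b\<close> meets the simplex in the segment $0\le r\le\lambda_a(y)$, because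
  $\lambda_a$ decreases and $\lambda_b$ increases with unit speed while the other coordinates stay fixed.
  The segment ends where $\lambda_a=0$, and there $\psi$ vanishes by assumption; so the fundamental theorem
  of calculus leaves only $-\psi(y)$.
\<close>
lemma integral_edge_derivative:
  fixes \<psi> :: "'a \<Rightarrow> real" and \<psi>' :: "'a \<Rightarrow> 'a"
  assumes a: "a \<in> C" and b: "b \<in> C" and ab: "a \<noteq> b"
    and der: "\<And>x. (\<psi> has_derivative (\<lambda>h. \<psi>' x \<bullet> h)) (at x)" and cont: "continuous_on UNIV \<psi>'"
    and zero: "\<And>x. bary C a x = 0 \<Longrightarrow> \<psi> x = 0"
  shows "(\<integral>x. indicator (convex hull C) x * (\<psi>' x \<bullet> (b - a)) \<partial>lborel)
       = - (1 / norm (bary_grad C b)) * (\<integral>x. \<psi> x \<partial>surface_measure (opp b))"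
proof -
  let ?g = "norm (bary_grad C b)" and ?n = "onormal b" and ?t = "b - a"
  let ?G = "\<lambda>x. indicator (convex hull C) x * (\<psi>' x \<bullet> ?t)"
  let ?I = "\<lambda>x. indicator {-1/2..1/2} (bary C b x / ?g) :: real"
  have g: "?g > 0" using bary_grad_nonzero[OF b] by simp
  have nt: "?n \<bullet> ?t = - (1 / ?g)" using bary_grad_edge[OF b a] ab by (simp add: onormal_def)
  define k where "k = ?n \<bullet> proj b 0"
  have s: "?n \<bullet> x - k = - (bary C b x / ?g)" for x
    using bary_along_normal[OF b, of x "proj b 0"] bary_proj[OF b, of 0] g
    by (simp add: k_def inner_diff_right field_simps)
  have pr: "x - (?n \<bullet> x - k) *\<^sub>R ?n = proj b x" for x by (simp add: s proj_def)
  have "- q \<in> {-1/2..1/2} \<longleftrightarrow> q \<in> {-1/2..1/2}" for q :: real by auto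
  then have ind: "indicator {-1/2..1/2} (?n \<bullet> x - k) = ?I x" for x by (simp only: s indicator_def)
  have c\<psi>: "continuous_on UNIV \<psi>"
    using der has_derivative_continuous by (blast intro: continuous_at_imp_continuous_on)
  have inner: "(\<integral>r. ?I x * ?G (y + r *\<^sub>R ?t) \<partial>lborel) = ?I x * (indicator (opp b) y * (- \<psi> y))"
    if y: "bary C b y = 0" for x y
  proof -
    have bb: "bary C b (y + r *\<^sub>R ?t) = r" for r
      using P1_along_line[OF bary_P1[OF b], of y r b a] y bary_vertex a b ab by simp
    have ba: "bary C a (y + r *\<^sub>R ?t) = bary C a y - r" for r
      using P1_along_line[OF bary_P1[OF a], of y r b a] bary_vertex a b ab by simp
    have bc: "bary C c (y + r *\<^sub>R ?t) = bary C c y" if "c \<in> C" "c \<noteq> a" "c \<noteq> b" for r c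
      using P1_along_line[OF bary_P1[OF that(1)], of y r b a] bary_vertex a b that by simp
    have inT: "y + r *\<^sub>R ?t \<in> convex hull C \<longleftrightarrow>
        0 \<le> r \<and> r \<le> bary C a y \<and> (\<forall>c\<in>C - {a, b}. 0 \<le> bary C c y)" for r
      unfolding mem_simplex_iff using bb ba bc a b
      by (metis DiffE DiffI diff_ge_0_iff_ge insert_iff singletonD)
    show ?thesis
    proof (cases "y \<in> opp b")
      case False
      then have "y + r *\<^sub>R ?t \<notin> convex hull C" for r
        unfolding inT mem_opp_iff[OF b] using y by (smt (verit) Diff_iff insert_iff singletonD)
      then show ?thesis using False by simp
    next
      case True
      then have pos: "\<And>c. c \<in> C \<Longrightarrow> 0 \<le> bary C c y" by (simp add: mem_opp_iff[OF b])
      have "indicator (convex hull C) (y + r *\<^sub>R ?t) = (indicator {0..bary C a y} r :: real)" for r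
        using pos by (auto simp: inT indicator_def)
      then have "(\<integral>r. ?G (y + r *\<^sub>R ?t) \<partial>lborel)
          = (\<integral>r. (\<psi>' (y + r *\<^sub>R ?t) \<bullet> ?t) * indicator {0..bary C a y} r \<partial>lborel)"
        by (simp add: mult.commute)
      also have "\<dots> = \<psi> (y + bary C a y *\<^sub>R ?t) - \<psi> (y + 0 *\<^sub>R ?t)"
      proof (rule integral_FTC_Icc_real)
        show "0 \<le> bary C a y" using pos a by simp
        fix r
        have "((\<lambda>r. y + r *\<^sub>R ?t) has_derivative (\<lambda>r. r *\<^sub>R ?t)) (at r)"
          by (auto intro!: derivative_eq_intros)
        from has_derivative_compose[OF this der]
        have "((\<lambda>r. \<psi> (y + r *\<^sub>R ?t)) has_derivative (\<lambda>h. \<psi>' (y + r *\<^sub>R ?t) \<bullet> (h *\<^sub>R ?t))) (at r)" .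
        moreover have "(\<lambda>h. \<psi>' (y + r *\<^sub>R ?t) \<bullet> (h *\<^sub>R ?t)) = (*) (\<psi>' (y + r *\<^sub>R ?t) \<bullet> ?t)"
          by (simp add: fun_eq_iff)
        ultimately show "((\<lambda>r. \<psi> (y + r *\<^sub>R ?t)) has_real_derivative \<psi>' (y + r *\<^sub>R ?t) \<bullet> ?t) (at r)"
          unfolding has_field_derivative_def by (simp only:)
        have "continuous_on UNIV (\<lambda>r. \<psi>' (y + r *\<^sub>R ?t) \<bullet> ?t)"
          by (intro continuous_intros continuous_on_compose2[OF cont]) auto
        then show "isCont (\<lambda>r. \<psi>' (y + r *\<^sub>R ?t) \<bullet> ?t) r"
          by (simp add: continuous_on_eq_continuous_at)
      qed
      also have "\<dots> = - \<psi> y" using zero[of "y + bary C a y *\<^sub>R ?t"] ba by simp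
      finally show ?thesis using True by simp
    qed
  qed
  have "integrable lborel ?G"
    by (intro integrable_simplex continuous_intros cont)
  from integral_shear[OF this _ norm_onormal[OF b], of ?t k]
  have "(\<integral>x. \<integral>r. ?I x * ?G (proj b x + r *\<^sub>R ?t) \<partial>lborel \<partial>lborel) = ?g * (\<integral>x. ?G x \<partial>lborel)"
    unfolding pr ind using nt g by simp
  moreover have "(\<integral>x. \<integral>r. ?I x * ?G (proj b x + r *\<^sub>R ?t) \<partial>lborel \<partial>lborel)
      = (\<integral>x. - (?I x * (indicator (opp b) (proj b x) * \<psi> (proj b x))) \<partial>lborel)"
    using inner[OF bary_proj[OF b]] by simp
  moreover have "\<dots> = - (\<integral>x. \<psi> x \<partial>surface_measure (opp b))"
    by (simp add: integral_surface_measure[OF b c\<psi>])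
  ultimately show ?thesis using g by (simp add: field_simps)
qed

lemma bary_has_derivative: "a \<in> C \<Longrightarrow> (bary C a has_derivative (\<lambda>h. bary_grad C a \<bullet> h)) (at x)"
proof -
  assume a: "a \<in> C"
  have "bary C a = (\<lambda>x. bary C a 0 + bary_grad C a \<bullet> x)" 
  proof
    show "bary C a y = bary C a 0 + bary_grad C a \<bullet> y" for y
      using bary_eq_affine[OF a, of y 0] by simp
  qed
  moreover have "((\<lambda>x. bary C a 0 + bary_grad C a \<bullet> x) has_derivative (\<lambda>h. bary_grad C a \<bullet> h)) (at x)"
    by (auto intro!: derivative_eq_intros)
  ultimately show ?thesis by (simp only:)
qed

text \<open>
  Apply the previous identity to $\psi=\lambda_a$, whose derivative along the edge is $-1$, and sum over the
  $d$ vertices of the facet, on which the coordinates $\lambda_a$ add up to one. This is the formula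
  ``volume equals base times height divided by $d$''.
\<close>
lemma measure_simplex:
  assumes b: "b \<in> C"
  shows "measure (surface_measure (opp b)) UNIV = real DIM('a) * norm (bary_grad C b) * measure lborel (convex hull C)"
proof -
  let ?g = "norm (bary_grad C b)" and ?S = "surface_measure (opp b)"
  have g: "?g > 0" using bary_grad_nonzero[OF b] by simp
  have each: "(\<integral>x. bary C a x \<partial>?S) = ?g * measure lborel (convex hull C)" if a: "a \<in> C - {b}" for a
  proof -
    have "(\<integral>x. indicator (convex hull C) x * (bary_grad C a \<bullet> (b - a)) \<partial>lborel)
        = - (1 / ?g) * (\<integral>x. bary C a x \<partial>?S)"
      by (rule integral_edge_derivative) (use a b bary_has_derivative in auto)
    moreover have "bary_grad C a \<bullet> (b - a) = -1"
      using bary_grad_edge[of a b] a b by (auto simp: inner_diff_right)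
    ultimately show ?thesis using g by (simp add: field_simps)
  qed
  have "measure ?S UNIV = (\<integral>x. 1 \<partial>?S)" using b by simp
  also have "\<dots> = (\<integral>x. (\<Sum>a\<in>C - {b}. bary C a x) \<partial>?S)"
  proof (rule integral_surface_cong[OF b])
    show "1 = (\<Sum>a\<in>C - {b}. bary C a x)" if "x \<in> opp b" for x
      using sum_bary[of x] that b mem_opp_iff[OF b] by (simp add: sum.remove[of C b])
  qed (auto intro!: continuous_intros)
  also have "\<dots> = (\<Sum>a\<in>C - {b}. \<integral>x. bary C a x \<partial>?S)"
    by (intro Bochner_Integration.integral_sum integrable_surface_measure b P1_continuous_on) auto
  also have "\<dots> = real DIM('a) * ?g * measure lborel (convex hull C)"
    using each card_C b by (simp add: card_Diff_singleton)
  finally show ?thesis .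
qed

lemma measure_simplex_pos: "0 < measure lborel (convex hull C)"
proof -
  obtain b where b: "b \<in> C" using card_C by fastforce
  show ?thesis
    using measure_simplex[OF b] surface_measure_pos[OF b] zero_less_measure_iff[of lborel "convex hull C"]
    by auto
qed

end

lemma integral_double_sum:
  fixes f :: "'b \<Rightarrow> 'c \<Rightarrow> 'a \<Rightarrow> real"
  assumes int: "\<And>b a. b \<in> B \<Longrightarrow> a \<in> A b \<Longrightarrow> integrable M (f b a)"
  shows "(\<integral>x. (\<Sum>b\<in>B. \<Sum>a\<in>A b. k b a * f b a x) \<partial>M) = (\<Sum>b\<in>B. \<Sum>a\<in>A b. k b a * (\<integral>x. f b a x \<partial>M))"
proof -
  have kint: "integrable M (\<lambda>x. k b a * f b a x)" if "b \<in> B" "a \<in> A b" for b a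
    using int[OF that] by (rule integrable_mult_right)
  have "(\<integral>x. (\<Sum>b\<in>B. \<Sum>a\<in>A b. k b a * f b a x) \<partial>M) = (\<Sum>b\<in>B. \<integral>x. (\<Sum>a\<in>A b. k b a * f b a x) \<partial>M)"
    by (intro Bochner_Integration.integral_sum Bochner_Integration.integrable_sum kint)
  also have "\<dots> = (\<Sum>b\<in>B. \<Sum>a\<in>A b. \<integral>x. k b a * f b a x \<partial>M)"
    by (intro sum.cong refl Bochner_Integration.integral_sum kint)
  finally show ?thesis by simp
qed

context full_simplex
begin

lemma sum_bary_grad: "(\<Sum>b\<in>C. bary_grad C b) = 0"
proof -
  have "(\<Sum>b\<in>C. bary_grad C b) \<bullet> z = 0" for z
  proof -
    have "(\<Sum>b\<in>C. bary C b z) = (\<Sum>b\<in>C. bary C b 0 + bary_grad C b \<bullet> z)"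
      using bary_eq_affine[of _ z 0] by (intro sum.cong) auto
    then show ?thesis by (simp add: sum_bary sum.distrib inner_sum_left)
  qed
  then show ?thesis by (metis inner_eq_zero_iff)
qed

text \<open>
  The vectors $\nabla\lambda_b$ and the vertices are dual to each other: this is the linear part of the
  expansion of \<open>z\<close> in barycentric coordinates.
\<close>
lemma bary_grad_reconstruct: "z = (\<Sum>b\<in>C. (bary_grad C b \<bullet> z) *\<^sub>R b)"
proof -
  have "(\<Sum>b\<in>C. (bary_grad C b \<bullet> z) *\<^sub>R b) = (\<Sum>b\<in>C. bary C b z *\<^sub>R b - bary C b 0 *\<^sub>R b)"
    using bary_eq_affine[of _ z 0] by (intro sum.cong) (auto simp: scaleR_add_left)
  also have "\<dots> = z" by (simp add: sum_subtractf bary_sum)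
  finally show ?thesis by simp
qed

lemma onormal_eq_zero_iff: "b \<in> C \<Longrightarrow> w \<bullet> onormal b = 0 \<longleftrightarrow> bary_grad C b \<bullet> w = 0"
  using bary_grad_nonzero[of b] by (simp add: onormal_def inner_commute)

text \<open>
  At a vertex \<open>a\<close>, which lies on all facets but the opposite one, \<open>w a\<close> is orthogonal to $\nabla\lambda_b$
  for every $b\ne a$. As the gradients add up to zero, it is orthogonal to $\nabla\lambda_a$ as well, so all
  coefficients in \<open>bary_grad_reconstruct\<close> vanish.
\<close>
lemma zero_if_normal_components_zero:
  assumes w: "w \<in> P1" and zero: "\<And>b x. b \<in> C \<Longrightarrow> x \<in> opp b \<Longrightarrow> w x \<bullet> onormal b = 0"
  shows "w = (\<lambda>_. 0)"
proof (rule P1_eqI[OF w P1_const])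
  fix a assume a: "a \<in> C"
  have off: "bary_grad C b \<bullet> w a = 0" if "b \<in> C" "b \<noteq> a" for b
  proof -
    have "a \<in> opp b" using a that by (intro hull_inc) auto
    then show ?thesis using zero[OF that(1)] onormal_eq_zero_iff[OF that(1)] by blast
  qed
  have "(\<Sum>b\<in>C. bary_grad C b \<bullet> w a) = 0"
    using sum_bary_grad by (simp flip: inner_sum_left)
  moreover have "(\<Sum>b\<in>C - {a}. bary_grad C b \<bullet> w a) = 0" using off by (intro sum.neutral) auto
  ultimately have "bary_grad C a \<bullet> w a = 0" using a by (simp add: sum.remove[of C a])
  then have "bary_grad C b \<bullet> w a = 0" if "b \<in> C" for b using off that by blast
  then have "(\<Sum>b\<in>C. (bary_grad C b \<bullet> w a) *\<^sub>R b) = 0" by simp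
  then show "w a = 0" using bary_grad_reconstruct[of "w a"] by (simp only:)
qed

lemma zero_if_surface_moments_zero:
  fixes f :: "'a \<Rightarrow> real"
  assumes b: "b \<in> C" and f: "f \<in> P1"
    and mom: "\<And>p. p \<in> P1 \<Longrightarrow> (\<integral>x. f x * p x \<partial>surface_measure (opp b)) = 0" and x: "x \<in> opp b"
  shows "f x = 0"
proof -
  have "continuous_on UNIV (\<lambda>x. f x * f x)" by (intro continuous_intros P1_continuous_on[OF f])
  then have "f x * f x = 0"
    by (rule continuous_zero_if_surface_integral_zero[OF b _ _ mom[OF f] x]) simp
  then show ?thesis by simp
qed

lemma eq_if_surface_moments_eq:
  fixes f g :: "'a \<Rightarrow> real"
  assumes b: "b \<in> C" and f: "f \<in> P1" and g: "g \<in> P1"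
    and mom: "\<And>p. p \<in> P1 \<Longrightarrow>
      (\<integral>x. f x * p x \<partial>surface_measure (opp b)) = (\<integral>x. g x * p x \<partial>surface_measure (opp b))"
    and x: "x \<in> opp b"
  shows "f x = g x"
proof -
  have "f x - g x = 0"
  proof (rule zero_if_surface_moments_zero[OF b P1_diff[OF f g] _ x])
    fix p :: "'a \<Rightarrow> real" assume p: "p \<in> P1"
    have "integrable (surface_measure (opp b)) (\<lambda>x. f x * p x)"
      "integrable (surface_measure (opp b)) (\<lambda>x. g x * p x)"
      by (intro integrable_surface_measure b continuous_intros P1_continuous_on f g p)+
    then show "(\<integral>x. (f x - g x) * p x \<partial>surface_measure (opp b)) = 0"
      using mom[OF p] by (simp add: left_diff_distrib)
  qed
  then show ?thesis by simp
qed

subsection \<open>Affine fields with prescribed normal components\<close>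

text \<open>
  The affine field whose normal component on the facet opposite to \<open>b\<close> takes the value \<open>g b a\<close> at the
  vertex \<open>a\<close>. The summand for \<open>a\<close> and \<open>b\<close> has a normal component on this facet only: on the facet opposite
  to \<open>a\<close> the factor $\lambda_a$ vanishes, and all remaining facets contain the edge from \<open>a\<close> to \<open>b\<close>.
\<close>
definition normal_lift :: "('a \<Rightarrow> 'a \<Rightarrow> real) \<Rightarrow> 'a \<Rightarrow> 'a" where
  "normal_lift g x = (\<Sum>b\<in>C. \<Sum>a\<in>C - {b}. bary C a x *\<^sub>R ((g b a / (onormal b \<bullet> (b - a))) *\<^sub>R (b - a)))"

text \<open>
  The divergence of \<open>normal_lift g\<close>, which is constant.
\<close>
definition normal_lift_div :: "('a \<Rightarrow> 'a \<Rightarrow> real) \<Rightarrow> real" where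
  "normal_lift_div g = (\<Sum>b\<in>C. \<Sum>a\<in>C - {b}. (g b a / (onormal b \<bullet> (b - a))) * (bary_grad C a \<bullet> (b - a)))"

lemma normal_lift_P1: "normal_lift g \<in> P1"
  unfolding normal_lift_def by (intro P1_sum P1_bary_combination) auto

lemma onormal_edge: "b \<in> C \<Longrightarrow> a \<in> C \<Longrightarrow> a \<noteq> b \<Longrightarrow> onormal b \<bullet> (b - a) = - (1 / norm (bary_grad C b))"
  using bary_grad_edge[of b a] by (simp add: onormal_def)

lemma normal_lift_normal:
  assumes b: "b \<in> C" and x: "x \<in> opp b"
  shows "normal_lift g x \<bullet> onormal b = (\<Sum>a\<in>C - {b}. bary C a x * g b a)"
proof -
  have summand: "(bary C a x *\<^sub>R ((g c a / (onormal c \<bullet> (c - a))) *\<^sub>R (c - a))) \<bullet> onormal b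
      = (if c = b then bary C a x * g b a else 0)" if c: "c \<in> C" and a: "a \<in> C - {c}" for a c
  proof (cases "c = b")
    case True
    have "onormal b \<bullet> (b - a) \<noteq> 0"
      using onormal_edge[OF b, of a] a True bary_grad_nonzero[OF b] by auto
    then show ?thesis using True by (simp add: inner_commute)
  next
    case False
    then have cb: "c \<in> opp b" using c by (intro hull_inc) auto
    show ?thesis
    proof (cases "a = b")
      case True
      then show ?thesis using False x mem_opp_iff[OF b] by simp
    next
      case ab: False
      then have "a \<in> opp b" using a by (intro hull_inc) auto
      then have "(c - a) \<bullet> onormal b = 0"
        using onormal_opp[OF b _ cb] by (simp add: inner_commute)
      then show ?thesis using False by simp
    qed
  qed
  have "normal_lift g x \<bullet> onormal b = (\<Sum>c\<in>C. \<Sum>a\<in>C - {c}. if c = b then bary C a x * g b a else 0)"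
    unfolding normal_lift_def inner_sum_left by (intro sum.cong refl summand)
  also have "\<dots> = (\<Sum>c\<in>C. if c = b then (\<Sum>a\<in>C - {b}. bary C a x * g b a) else 0)"
    by (intro sum.cong) auto
  also have "\<dots> = (\<Sum>a\<in>C - {b}. bary C a x * g b a)" using b by simp
  finally show ?thesis .
qed

lemma normal_lift_normal_P1:
  assumes b: "b \<in> C" and x: "x \<in> opp b" and p: "p \<in> P1" and g: "\<And>a. a \<in> C - {b} \<Longrightarrow> g b a = p a"
  shows "normal_lift g x \<bullet> onormal b = p x"
proof -
  have "p x = (\<Sum>a\<in>C - {b}. bary C a x * p a)"
    using P1_expand[OF p, of x] x b mem_opp_iff[OF b] by (simp add: sum.remove[of C b])
  then show ?thesis using normal_lift_normal[OF b x, of g] g by simp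
qed

text \<open>
  Each summand of the lift is treated by \<open>integral_edge_derivative\<close> with $\psi=\lambda_a\varphi$. The factor
  $1/(n\cdot(b-a))$ in the lift cancels the height that appears there.
\<close>
lemma normal_lift_green:
  fixes \<phi> :: "'a \<Rightarrow> real" and \<phi>' :: "'a \<Rightarrow> 'a"
  assumes der: "\<And>x. (\<phi> has_derivative (\<lambda>h. \<phi>' x \<bullet> h)) (at x)" and cont: "continuous_on UNIV \<phi>'"
  shows "(\<integral>x. indicator (convex hull C) x * (normal_lift g x \<bullet> \<phi>' x) \<partial>lborel)
    = (\<Sum>b\<in>C. \<integral>x. \<phi> x * (normal_lift g x \<bullet> onormal b) \<partial>surface_measure (opp b))
      - normal_lift_div g * (\<integral>x. indicator (convex hull C) x * \<phi> x \<partial>lborel)"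
proof -
  let ?I = "\<lambda>x. indicator (convex hull C) x :: real"
  have c\<phi>: "continuous_on UNIV \<phi>"
    using der has_derivative_continuous by (intro continuous_at_imp_continuous_on) blast
  define k where "k b a = g b a / (onormal b \<bullet> (b - a))" for b a
  have int1: "integrable lborel (\<lambda>x. ?I x * (bary C a x * (\<phi>' x \<bullet> t)))" if "a \<in> C" for a t
    by (intro integrable_simplex continuous_intros cont that)
  have int2: "integrable lborel (\<lambda>x. ?I x * \<phi> x)"
    by (intro integrable_simplex c\<phi>)
  have ints: "integrable (surface_measure (opp b)) (\<lambda>x. bary C a x * \<phi> x)" if "a \<in> C" "b \<in> C" for a b
    using that by (intro integrable_surface_measure continuous_intros c\<phi>)
  have edge: "k b a * (\<integral>x. ?I x * (bary C a x * (\<phi>' x \<bullet> (b - a))) \<partial>lborel)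
      = (\<integral>x. \<phi> x * (bary C a x * g b a) \<partial>surface_measure (opp b))
        - (k b a * (bary_grad C a \<bullet> (b - a))) * (\<integral>x. ?I x * \<phi> x \<partial>lborel)"
    if b: "b \<in> C" and a: "a \<in> C - {b}" for a b
  proof -
    have aC: "a \<in> C" and ab: "a \<noteq> b" using a by auto
    let ?\<psi>' = "\<lambda>x. \<phi> x *\<^sub>R bary_grad C a + bary C a x *\<^sub>R \<phi>' x"
    have gpos: "norm (bary_grad C b) > 0" using bary_grad_nonzero[OF b] by simp
    have 1: "(\<integral>x. ?I x * (?\<psi>' x \<bullet> (b - a)) \<partial>lborel)
        = - (1 / norm (bary_grad C b)) * (\<integral>x. bary C a x * \<phi> x \<partial>surface_measure (opp b))"
    proof (rule integral_edge_derivative[OF aC b ab])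
      show "((\<lambda>x. bary C a x * \<phi> x) has_derivative (\<lambda>h. ?\<psi>' x \<bullet> h)) (at x)" for x
        by (rule has_derivative_eq_rhs[OF has_derivative_mult[OF bary_has_derivative[OF aC] der]])
          (simp add: fun_eq_iff inner_add_left)
      show "continuous_on UNIV ?\<psi>'" by (intro continuous_intros c\<phi> cont aC)
    qed simp
    have 2: "(\<integral>x. ?I x * (?\<psi>' x \<bullet> (b - a)) \<partial>lborel)
        = (bary_grad C a \<bullet> (b - a)) * (\<integral>x. ?I x * \<phi> x \<partial>lborel)
          + (\<integral>x. ?I x * (bary C a x * (\<phi>' x \<bullet> (b - a))) \<partial>lborel)"
    proof -
      have "(\<integral>x. ?I x * (?\<psi>' x \<bullet> (b - a)) \<partial>lborel)
          = (\<integral>x. (bary_grad C a \<bullet> (b - a)) * (?I x * \<phi> x) + ?I x * (bary C a x * (\<phi>' x \<bullet> (b - a))) \<partial>lborel)"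
        by (intro Bochner_Integration.integral_cong refl)
          (simp only: inner_add_left inner_scaleR_left, simp only: algebra_simps)
      then show ?thesis using int1[OF aC, of "b - a"] int2 by simp
    qed
    have 3: "k b a = - (g b a * norm (bary_grad C b))"
      unfolding k_def onormal_edge[OF b aC ab] by simp
    have 4: "(\<integral>x. \<phi> x * (bary C a x * g b a) \<partial>surface_measure (opp b))
        = g b a * (\<integral>x. bary C a x * \<phi> x \<partial>surface_measure (opp b))"
      by (subst Bochner_Integration.integral_mult_right_zero[symmetric]) (simp add: mult_ac)
    have arith: "k * B = c * Z - k * A" if "A + B = - (1 / n) * Z" "k = - (c * n)" "n > 0"
      for A B Z n k c :: real
    proof -
      have "k * (A + B) = c * Z" using that by (simp only: that(1,2)) simp
      then show ?thesis by (simp add: algebra_simps)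
    qed
    show ?thesis unfolding 4 mult.assoc by (rule arith[OF trans[OF 2[symmetric] 1] 3 gpos])
  qed
  have "(\<integral>x. ?I x * (normal_lift g x \<bullet> \<phi>' x) \<partial>lborel)
      = (\<integral>x. (\<Sum>b\<in>C. \<Sum>a\<in>C - {b}. k b a * (?I x * (bary C a x * (\<phi>' x \<bullet> (b - a))))) \<partial>lborel)"
    unfolding normal_lift_def k_def
  proof (intro Bochner_Integration.integral_cong refl)
    fix x
    have "(\<Sum>b\<in>C. \<Sum>a\<in>C - {b}. bary C a x *\<^sub>R ((g b a / (onormal b \<bullet> (b - a))) *\<^sub>R (b - a))) \<bullet> \<phi>' x
        = (\<Sum>b\<in>C. \<Sum>a\<in>C - {b}. (g b a / (onormal b \<bullet> (b - a))) * (bary C a x * (\<phi>' x \<bullet> (b - a))))"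
      unfolding inner_sum_left inner_scaleR_left
      by (intro sum.cong refl) (simp only: inner_commute[of _ "\<phi>' x"] mult.left_commute)
    then show "?I x * ((\<Sum>b\<in>C. \<Sum>a\<in>C - {b}. bary C a x *\<^sub>R ((g b a / (onormal b \<bullet> (b - a))) *\<^sub>R (b - a))) \<bullet> \<phi>' x)
        = (\<Sum>b\<in>C. \<Sum>a\<in>C - {b}. (g b a / (onormal b \<bullet> (b - a))) * (?I x * (bary C a x * (\<phi>' x \<bullet> (b - a)))))"
      by (simp only: sum_distrib_left mult.left_commute[of "?I x"])
  qed
  also have "\<dots> = (\<Sum>b\<in>C. \<Sum>a\<in>C - {b}. k b a * (\<integral>x. ?I x * (bary C a x * (\<phi>' x \<bullet> (b - a))) \<partial>lborel))"
    by (rule integral_double_sum) (rule int1, blast)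
  also have "\<dots> = (\<Sum>b\<in>C. \<Sum>a\<in>C - {b}. (\<integral>x. \<phi> x * (bary C a x * g b a) \<partial>surface_measure (opp b)))
        - normal_lift_div g * (\<integral>x. ?I x * \<phi> x \<partial>lborel)"
    using edge by (simp add: normal_lift_div_def k_def sum_subtractf sum_distrib_right)
  also have "(\<Sum>b\<in>C. \<Sum>a\<in>C - {b}. (\<integral>x. \<phi> x * (bary C a x * g b a) \<partial>surface_measure (opp b)))
      = (\<Sum>b\<in>C. \<integral>x. \<phi> x * (normal_lift g x \<bullet> onormal b) \<partial>surface_measure (opp b))"
  proof (rule sum.cong[OF refl])
    fix b assume b: "b \<in> C"
    have "(\<Sum>a\<in>C - {b}. (\<integral>x. \<phi> x * (bary C a x * g b a) \<partial>surface_measure (opp b)))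
        = (\<integral>x. (\<Sum>a\<in>C - {b}. \<phi> x * (bary C a x * g b a)) \<partial>surface_measure (opp b))"
      by (rule Bochner_Integration.integral_sum[symmetric])
        (intro integrable_surface_measure continuous_intros c\<phi> b; simp)
    also have "\<dots> = (\<integral>x. \<phi> x * (normal_lift g x \<bullet> onormal b) \<partial>surface_measure (opp b))"
    proof (rule integral_surface_cong[OF b])
      show "continuous_on UNIV (\<lambda>x. \<Sum>a\<in>C - {b}. \<phi> x * (bary C a x * g b a))"
        by (intro continuous_intros c\<phi>) auto
      show "continuous_on UNIV (\<lambda>x. \<phi> x * (normal_lift g x \<bullet> onormal b))"
        by (intro continuous_intros c\<phi> P1_continuous_on normal_lift_P1)
    qed (simp add: normal_lift_normal[OF b] sum_distrib_left)
    finally show "(\<Sum>a\<in>C - {b}. (\<integral>x. \<phi> x * (bary C a x * g b a) \<partial>surface_measure (opp b)))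
      = (\<integral>x. \<phi> x * (normal_lift g x \<bullet> onormal b) \<partial>surface_measure (opp b))" .
  qed
  finally show ?thesis .
qed

subsection \<open>Shape regularity\<close>

text \<open>
  Across a ball inside the simplex, in the direction of its gradient, $\lambda_b$ varies by the diameter of
  the ball times the norm of the gradient; on the simplex its values lie between zero and one.
\<close>
lemma inball_diameter_bound:
  assumes b: "b \<in> C" shows "0 \<le> inball_diameter (convex hull C)"
    and "inball_diameter (convex hull C) * norm (bary_grad C b) \<le> 1"
proof -
  let ?g = "norm (bary_grad C b)"
  let ?R = "{r. 0 \<le> r \<and> (\<exists>x. cball x r \<subseteq> convex hull C)}"
  have g: "?g > 0" using bary_grad_nonzero[OF b] by simp
  have le: "r \<le> 1 / (2 * ?g)" if "r \<in> ?R" for r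
  proof -
    from that obtain x where r: "0 \<le> r" and x: "cball x r \<subseteq> convex hull C" by auto
    define v where "v = (r / ?g) *\<^sub>R bary_grad C b"
    have nv: "norm v = r" using g r by (simp add: v_def)
    have "x + v \<in> cball x r" "x - v \<in> cball x r" using nv by (auto simp: dist_norm)
    then have m: "x + v \<in> convex hull C" "x - v \<in> convex hull C" using x by auto
    have "bary C b (x + v) \<le> 1" by (rule bary_le_one[OF m(1) b])
    moreover have "0 \<le> bary C b (x - v)" using m(2) mem_simplex_iff b by blast
    moreover have "bary C b (x + v) = bary C b (x - v) + bary_grad C b \<bullet> (2 *\<^sub>R v)"
      using bary_eq_affine[OF b, of "x + v" "x - v"] by (simp add: scaleR_2)
    moreover have "bary_grad C b \<bullet> (2 *\<^sub>R v) = 2 * r * ?g"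
      using g by (simp add: v_def dot_square_norm power2_eq_square)
    ultimately show ?thesis using g by (simp add: field_simps)
  qed
  obtain c where "c \<in> C" "c \<noteq> b" using other_vertex .
  then have "cball c 0 \<subseteq> convex hull C" by (simp add: hull_inc)
  then have "0 \<in> ?R" by blast
  moreover have "bdd_above ?R" using le by (rule bdd_aboveI)
  ultimately have "0 \<le> Sup ?R" by (intro cSup_upper)
  moreover have "?R \<noteq> {}" using \<open>0 \<in> ?R\<close> by blast
  then have "Sup ?R \<le> 1 / (2 * ?g)" by (rule cSup_least) (rule le)
  ultimately show "0 \<le> inball_diameter (convex hull C)" "inball_diameter (convex hull C) * ?g \<le> 1"
    using g by (simp_all add: inball_diameter_def field_simps)
qed

end

text \<open>
  By \<open>measure_simplex\<close> the claim is a bound on the product of $h_e$ and $|\nabla\lambda_b|$. Shape regularity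
  and the previous lemma bound $D\,|\nabla\lambda_b|$ by $|\sigma|$, where $D$ is the diameter, and hence
  $|e| = d\,|\nabla\lambda_b|\,|T|$ by a multiple of $D^{d-1}$, as $|T|$ is at most the volume of a ball of radius
  $D$. Taking the root bounds $h_e$ by a multiple of $D$.
\<close>
lemma facet_size_bound:
  fixes C :: "(real ^ 'n) set"
  assumes simplex: "full_simplex C" and b: "b \<in> C" and d: "CARD('n) \<ge> 2"
    and reg: "diameter (convex hull C) \<le> \<sigma> * inball_diameter (convex hull C)"
  defines "\<kappa> \<equiv> real CARD('n) * \<bar>\<sigma>\<bar> *
      (real CARD('n) * \<bar>\<sigma>\<bar> * unit_ball_vol CARD('n)) powr (1 / (real CARD('n) - 1))"
  shows "facet_size (convex hull (C - {b})) * measure (surface_measure (convex hull (C - {b}))) UNIV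
    \<le> \<kappa> * measure lborel (convex hull C)"
proof -
  interpret full_simplex C by fact
  let ?d = "real CARD('n)" and ?g = "norm (bary_grad C b)" and ?D = "diameter (convex hull C)"
    and ?m = "measure (surface_measure (opp b)) UNIV" and ?V = "measure lborel (convex hull C)"
    and ?u = "unit_ball_vol (real CARD('n))"
  have g: "?g > 0" using bary_grad_nonzero[OF b] by simp
  have bd: "bounded (convex hull C)" using compact_simplex by (rule compact_imp_bounded)
  have D0: "0 \<le> ?D" by (rule diameter_ge_0[OF bd])
  have "?D \<le> \<bar>\<sigma>\<bar> * inball_diameter (convex hull C)"
    using reg inball_diameter_bound(1)[OF b] by (meson abs_ge_self mult_right_mono order_trans)
  then have "?D * ?g \<le> \<bar>\<sigma>\<bar> * (inball_diameter (convex hull C) * ?g)"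
    using g by (simp add: mult.assoc[symmetric])
  also have "\<dots> \<le> \<bar>\<sigma>\<bar> * 1" by (intro mult_left_mono inball_diameter_bound(2) b) simp
  finally have Dg: "?D * ?g \<le> \<bar>\<sigma>\<bar>" by simp
  have "convex hull C \<subseteq> cball b ?D"
    using diameter_bounded_bound[OF bd] hull_inc[OF b] by auto
  then have "?V \<le> measure lborel (cball b ?D)"
    by (intro measure_mono_fmeasurable) (auto intro!: fmeasurableI emeasure_bounded_finite)
  also have "\<dots> = ?u * ?D ^ CARD('n)" using content_cball[OF D0, of b] by simp
  finally have V: "?V \<le> ?u * ?D ^ CARD('n)" .
  have m: "?m = ?d * ?g * ?V" using measure_simplex[OF b] by simp
  also have "\<dots> \<le> ?d * ?g * (?u * ?D ^ CARD('n))" using V g by (intro mult_left_mono) auto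
  also have "\<dots> = ?d * (?D * ?g) * ?u * ?D ^ (CARD('n) - 1)"
    using d by (cases "CARD('n)") auto
  also have "\<dots> \<le> ?d * \<bar>\<sigma>\<bar> * ?u * ?D ^ (CARD('n) - 1)"
    using Dg D0 by (intro mult_right_mono mult_left_mono) auto
  finally have "?m \<le> ?d * \<bar>\<sigma>\<bar> * ?u * ?D ^ (CARD('n) - 1)" .
  then have "?m powr (1 / (?d - 1)) \<le> (?d * \<bar>\<sigma>\<bar> * ?u * ?D ^ (CARD('n) - 1)) powr (1 / (?d - 1))"
    using d by (intro powr_mono2) auto
  also have "\<dots> = (?d * \<bar>\<sigma>\<bar> * ?u) powr (1 / (?d - 1)) * (?D ^ (CARD('n) - 1)) powr (1 / (?d - 1))"
    by (rule powr_mult)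
  also have "(?D ^ (CARD('n) - 1)) powr (1 / (?d - 1)) = ?D"
  proof (cases "?D = 0")
    case False
    then have "?D ^ (CARD('n) - 1) = ?D powr (?d - 1)"
      using D0 d by (simp add: of_nat_diff flip: powr_realpow)
    then show ?thesis using D0 d False by (simp add: powr_powr)
  qed (use d in auto)
  finally have "facet_size (opp b) \<le> (?d * \<bar>\<sigma>\<bar> * ?u) powr (1 / (?d - 1)) * ?D"
    by (simp add: facet_size_def measure_facet[OF b])
  then have "facet_size (opp b) * ?m \<le> ((?d * \<bar>\<sigma>\<bar> * ?u) powr (1 / (?d - 1)) * ?D) * (?d * ?g * ?V)"
    unfolding m using g by (intro mult_right_mono) auto
  also have "\<dots> = ((?d * \<bar>\<sigma>\<bar> * ?u) powr (1 / (?d - 1)) * ?d * ?V) * (?D * ?g)" by (simp add: mult_ac)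
  also have "\<dots> \<le> ((?d * \<bar>\<sigma>\<bar> * ?u) powr (1 / (?d - 1)) * ?d * ?V) * \<bar>\<sigma>\<bar>"
    using Dg by (intro mult_left_mono) auto
  finally show ?thesis by (simp add: \<kappa>_def mult_ac)
qed

subsection \<open>Interior points\<close>

context full_simplex
begin

lemma eventually_interior_near_facet:
  assumes b: "b \<in> C" and y: "bary C b y = 0" "\<And>c. c \<in> C - {b} \<Longrightarrow> 0 < bary C c y"
  shows "eventually (\<lambda>r. \<forall>c\<in>C. 0 < bary C c (y - r *\<^sub>R onormal b)) (at_right (0::real))"
proof (rule eventually_ball_finite[OF finite_C], intro ballI)
  fix c assume c: "c \<in> C"
  have lin: "bary C c (y - r *\<^sub>R onormal b) = bary C c y - r * (bary_grad C c \<bullet> onormal b)" for r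
    using bary_eq_affine[OF c, of "y - r *\<^sub>R onormal b" y] by simp
  show "eventually (\<lambda>r. 0 < bary C c (y - r *\<^sub>R onormal b)) (at_right (0::real))"
  proof (cases "c = b")
    case True
    have "bary_grad C b \<bullet> onormal b = - norm (bary_grad C b)"
      using bary_grad_nonzero[OF b] by (simp add: onormal_def dot_square_norm power2_eq_square)
    then have "bary C c (y - r *\<^sub>R onormal b) = r * norm (bary_grad C b)" for r
      using lin[of r] y(1) True by simp
    then show ?thesis
      using eventually_at_right_less[of "0::real"] bary_grad_nonzero[OF b] by (auto elim: eventually_mono)
  next
    case False
    have "((\<lambda>r. bary C c y - r * (bary_grad C c \<bullet> onormal b)) \<longlongrightarrow> bary C c y - 0 * (bary_grad C c \<bullet> onormal b)) (at_right 0)"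
      by (intro tendsto_intros)
    from order_tendstoD(1)[OF this, of 0] show ?thesis
      using y(2)[of c] c False by (simp add: lin)
  qed
qed

lemma simplex_not_negligible: "\<not> negligible (convex hull C)"
  using measure_simplex_pos by (auto simp: negligible_iff_null_sets null_sets_def measure_def
      dest: emeasure_completion)

lemma interior_simplex_nonempty: "interior (convex hull C) \<noteq> {}"
  using simplex_not_negligible negligible_convex_interior[of "convex hull C"] by simp

lemma closure_interior_simplex: "closure (interior (convex hull C)) = convex hull C"
  using convex_closure_interior[OF convex_convex_hull interior_simplex_nonempty] compact_simplex
  by (simp add: closure_closed compact_imp_closed)

lemma positive_subset_simplex: "{x. \<forall>c\<in>C. 0 < bary C c x} \<subseteq> convex hull C"
  using mem_simplex_iff by (auto intro: less_imp_le)

lemma open_positive: "open {x. \<forall>c\<in>C. 0 < bary C c x}"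
proof -
  have "open (\<Inter>c\<in>C. {x. 0 < bary C c x})"
    by (intro open_INT finite_C ballI open_Collect_less continuous_intros)
  moreover have "(\<Inter>c\<in>C. {x. 0 < bary C c x}) = {x. \<forall>c\<in>C. 0 < bary C c x}" by blast
  ultimately show ?thesis by simp
qed

text \<open>
  This makes the polynomial representative of a function on an element well defined.
\<close>
lemma P1_eq_if_AE_eq:
  fixes p q :: "'a \<Rightarrow> 'b::euclidean_space"
  assumes p: "p \<in> P1" and q: "q \<in> P1" and ae: "AE x in lebesgue_on (convex hull C). p x = q x"
  shows "p = q"
proof -
  have cont: "continuous_on A p" "continuous_on A q" for A
    using p q by (auto intro: P1_continuous_on)
  define W where "W = interior (convex hull C) \<inter> {x. p x \<noteq> q x}"
  have "open W" unfolding W_def by (intro open_Int open_interior open_Collect_neq cont)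
  have "convex hull C \<in> sets lebesgue" using simplex_borel by simp
  then have "AE x in lebesgue. x \<in> convex hull C \<longrightarrow> p x = q x"
    using ae by (simp add: AE_restrict_space_iff)
  then have "AE x in lebesgue. x \<notin> W"
    by eventually_elim (use interior_subset in \<open>auto simp: W_def\<close>)
  then have "negligible W"
    using AE_iff_null_sets[of W lebesgue] \<open>open W\<close> by (simp add: negligible_iff_null_sets)
  then have "W = {}" using open_not_negligible[OF \<open>open W\<close>] by blast
  then have "\<And>x. x \<in> interior (convex hull C) \<Longrightarrow> p x - q x = 0" by (auto simp: W_def)
  moreover have "continuous_on (closure (interior (convex hull C))) (\<lambda>x. p x - q x)"
    by (intro continuous_intros cont)
  ultimately have "p x - q x = 0" if "x \<in> convex hull C" for x
    using continuous_constant_on_closure[of "interior (convex hull C)" "\<lambda>x. p x - q x" 0 x] that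
    by (simp add: closure_interior_simplex)
  then show ?thesis by (intro P1_eqI p q) (auto intro: hull_inc)
qed

end

text \<open>
  Both outward normals are unit vectors orthogonal to the facet, so they agree up to sign. If they were
  equal, both simplices would contain a neighbourhood of a point just inside the center of the facet,
  and their intersection would not be a null set.
\<close>
lemma opposite_normals:
  assumes C: "full_simplex C" and C': "full_simplex C'" and b: "b \<in> C" and b': "b' \<in> C'"
    and same: "convex hull (C - {b}) = convex hull (C' - {b'})"
    and thin: "negligible (convex hull C \<inter> convex hull C')"
  shows "full_simplex.onormal C' b' = - full_simplex.onormal C b"
proof -
  interpret A: full_simplex C by fact
  interpret B: full_simplex C' by fact
  have verts: "C - {b} = C' - {b'}"
  proof -
    have "\<not> affine_dependent (C - {b})" "\<not> affine_dependent (C' - {b'})"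
      using A.indep B.indep affine_independent_subset by blast+
    then have "x \<in> C - {b} \<longleftrightarrow> x \<in> C' - {b'}" for x
      using extreme_point_of_convex_hull_affine_independent same by metis
    then show ?thesis by blast
  qed
  have "A.onormal b = B.onormal b' \<or> A.onormal b = - B.onormal b'"
    by (rule B.normal_unique[OF b' A.norm_onormal[OF b] A.onormal_opp[OF b]]) (simp_all add: same)
  moreover have False if eq: "A.onormal b = B.onormal b'"
  proof -
    have y: "A.facet_center b = B.facet_center b'"
      by (simp add: A.facet_center_def B.facet_center_def verts)
    have "eventually (\<lambda>r. \<forall>c\<in>C. 0 < bary C c (A.facet_center b - r *\<^sub>R A.onormal b)) (at_right (0::real))"
      by (rule A.eventually_interior_near_facet[OF b]) (use b in \<open>auto simp: A.bary_facet_center\<close>)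
    moreover have "eventually (\<lambda>r. \<forall>c\<in>C'. 0 < bary C' c (A.facet_center b - r *\<^sub>R A.onormal b)) (at_right (0::real))"
      unfolding eq y
      by (rule B.eventually_interior_near_facet[OF b']) (use b' in \<open>auto simp: B.bary_facet_center\<close>)
    ultimately have "eventually (\<lambda>r. (\<forall>c\<in>C. 0 < bary C c (A.facet_center b - r *\<^sub>R A.onormal b)) \<and>
        (\<forall>c\<in>C'. 0 < bary C' c (A.facet_center b - r *\<^sub>R A.onormal b))) (at_right (0::real))"
      by (rule eventually_conj)
    then obtain r where r: "\<forall>c\<in>C. 0 < bary C c (A.facet_center b - r *\<^sub>R A.onormal b)"
        "\<forall>c\<in>C'. 0 < bary C' c (A.facet_center b - r *\<^sub>R A.onormal b)"
      using eventually_happens'[OF trivial_limit_at_right_real] by blast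
    let ?W = "{x. \<forall>c\<in>C. 0 < bary C c x} \<inter> {x. \<forall>c\<in>C'. 0 < bary C' c x}"
    have "open ?W" by (intro open_Int A.open_positive B.open_positive)
    moreover have "?W \<noteq> {}" using r by blast
    moreover have "negligible ?W"
      by (rule negligible_subset[OF thin]) (use A.positive_subset_simplex B.positive_subset_simplex in blast)
    ultimately show False using open_not_negligible by blast
  qed
  ultimately show ?thesis by force
qed

section \<open>Meshes\<close>

definition verts :: "'a::euclidean_space set \<Rightarrow> 'a set" where
  "verts T = {x. x extreme_point_of T}"

locale mesh =
  fixes \<Omega> :: "(real ^ 'n) set" and \<T> :: "(real ^ 'n) set set"
    and tp :: "(real ^ 'n) set \<Rightarrow> (real ^ 'n) set"
  assumes open_\<Omega>: "open \<Omega>" and connected_\<Omega>: "connected \<Omega>" and ne_\<Omega>: "\<Omega> \<noteq> {}"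
    and bounded_\<Omega>: "bounded \<Omega>" and mesh: "simplicial_mesh \<Omega> \<T>" and orient: "orientation \<T> tp"
begin

lemma finite_\<T> [simp]: "finite \<T>"
  using mesh by (simp add: simplicial_mesh_def triangulation_def)

lemma Union_\<T>: "\<Union>\<T> = closure \<Omega>"
  using mesh by (simp add: simplicial_mesh_def)

lemma \<Omega>_subset: "\<Omega> \<subseteq> \<Union>\<T>"
  using closure_subset Union_\<T> by blast

lemma verts_simplex:
  assumes "T \<in> \<T>" shows "full_simplex (verts T)" and "convex hull (verts T) = T"
proof -
  have "int CARD('n) simplex T" using mesh assms by (simp add: simplicial_mesh_def)
  then obtain C where C: "\<not> affine_dependent C" "int (card C) = int CARD('n) + 1" "T = convex hull C"
    by (auto simp: simplex)
  have "verts T = C"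
    using extreme_point_of_convex_hull_affine_independent[OF C(1)] by (auto simp: verts_def C(3))
  then show "full_simplex (verts T)" "convex hull (verts T) = T"
    using C by (auto simp: full_simplex_def)
qed

lemma facet_iff_opp:
  assumes "T \<in> \<T>" shows "e facet_of T \<longleftrightarrow> (\<exists>b\<in>verts T. e = convex hull (verts T - {b}))"
  using full_simplex.facet_iff[OF verts_simplex(1)[OF assms]] by (simp add: verts_simplex(2)[OF assms])

lemma sum_facets_of:
  assumes "T \<in> \<T>"
  shows "(\<Sum>e | e facet_of T. F e) = (\<Sum>b\<in>verts T. F (convex hull (verts T - {b})))"
proof -
  have "{e. e facet_of T} = (\<lambda>b. convex hull (verts T - {b})) ` verts T"
    using facet_iff_opp[OF assms] by blast
  moreover have "inj_on (\<lambda>b. convex hull (verts T - {b})) (verts T)"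
    using full_simplex.opp_inj[OF verts_simplex(1)[OF assms]] by (intro inj_onI)
  ultimately show ?thesis by (simp add: sum.reindex)
qed

lemma finite_facets_of: "T \<in> \<T> \<Longrightarrow> finite {e. e facet_of T}"
  using facet_iff_opp[of T] full_simplex.finite_C[OF verts_simplex(1), of T] by simp

lemma card_facets_of: "T \<in> \<T> \<Longrightarrow> card {e. e facet_of T} = Suc CARD('n)"
  using sum_facets_of[of T "\<lambda>_. 1::nat"] full_simplex.card_C[OF verts_simplex(1), of T] by simp

lemma finite_facets [simp]: "finite (facets \<T>)"
proof -
  have "facets \<T> = (\<Union>T\<in>\<T>. {e. e facet_of T})" by (auto simp: facets_def)
  then show ?thesis using finite_facets_of by simp
qed

lemma element_convex: "T \<in> \<T> \<Longrightarrow> convex T"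
  and element_compact: "T \<in> \<T> \<Longrightarrow> compact T"
  and element_borel: "T \<in> \<T> \<Longrightarrow> T \<in> sets borel"
  using verts_simplex full_simplex.compact_simplex full_simplex.simplex_borel convex_convex_hull by metis+

lemma element_aff_dim: "T \<in> \<T> \<Longrightarrow> aff_dim T = int CARD('n)"
  using mesh by (auto simp: simplicial_mesh_def aff_dim_simplex)

lemma meet_face:
  assumes "T \<in> \<T>" "T' \<in> \<T>" shows "(T \<inter> T') face_of T" "(T \<inter> T') face_of T'"
proof -
  have *: "(A \<inter> B) face_of A" if "A \<in> \<T>" "B \<in> \<T>" for A B
    using mesh that by (simp add: simplicial_mesh_def triangulation_def)
  show "(T \<inter> T') face_of T" "(T \<inter> T') face_of T'"
    using *[OF assms] *[OF assms(2,1)] by (simp_all add: Int_commute)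
qed

text \<open>
  The intersection is a common face; if it had full dimension it would equal both elements.
\<close>
lemma meet_aff_dim:
  assumes T: "T \<in> \<T>" and T': "T' \<in> \<T>" and ne: "T \<noteq> T'"
  shows "aff_dim (T \<inter> T') < int CARD('n)"
proof (rule ccontr)
  assume "\<not> ?thesis"
  then have "\<not> aff_dim (T \<inter> T') < aff_dim T" "\<not> aff_dim (T \<inter> T') < aff_dim T'"
    by (simp_all add: element_aff_dim T T')
  then have "T \<inter> T' = T" "T \<inter> T' = T'"
    using face_of_aff_dim_lt[OF element_convex[OF T] meet_face(1)[OF T T']]
      face_of_aff_dim_lt[OF element_convex[OF T'] meet_face(2)[OF T T']] by blast+
  then show False using ne by simp
qed

lemma lowdim_negligible:
  fixes S :: "(real ^ 'n) set"
  assumes "aff_dim S < int CARD('n)" shows "negligible (affine hull S)"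
proof -
  have "interior (affine hull S) = {}"
    using aff_dim_nonempty_interior[of "affine hull S"] assms by auto
  then show ?thesis by (simp add: negligible_convex_interior convex_affine_hull)
qed

lemma meet_negligible: "T \<in> \<T> \<Longrightarrow> T' \<in> \<T> \<Longrightarrow> T \<noteq> T' \<Longrightarrow> negligible (T \<inter> T')"
  using lowdim_negligible[OF meet_aff_dim] negligible_subset hull_subset by metis

lemma outward_normal_facet:
  assumes "T \<in> \<T>" "b \<in> verts T"
  shows "outward_normal T (convex hull (verts T - {b})) = full_simplex.onormal (verts T) b"
  using full_simplex.outward_normal_opp[OF verts_simplex(1) assms(2)] assms verts_simplex(2) by simp

lemma outward_normal_opposite:
  assumes T: "T \<in> \<T>" and T': "T' \<in> \<T>" and ne: "T \<noteq> T'" and e: "e facet_of T" "e facet_of T'"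
  shows "outward_normal T' e = - outward_normal T e"
proof -
  obtain b where b: "b \<in> verts T" "e = convex hull (verts T - {b})" using e(1) facet_iff_opp[OF T] by blast
  obtain b' where b': "b' \<in> verts T'" "e = convex hull (verts T' - {b'})" using e(2) facet_iff_opp[OF T'] by blast
  have "full_simplex.onormal (verts T') b' = - full_simplex.onormal (verts T) b"
    using opposite_normals[OF verts_simplex(1)[OF T] verts_simplex(1)[OF T'] b(1) b'(1)] b(2) b'(2)
      meet_negligible[OF T T' ne] by (simp add: verts_simplex(2) T T')
  then show ?thesis using outward_normal_facet[OF T b(1)] outward_normal_facet[OF T' b'(1)] b(2) b'(2) by simp
qed

lemma norm_outward_normal:
  assumes "T \<in> \<T>" "e facet_of T" shows "norm (outward_normal T e) = 1"
  using assms facet_iff_opp[OF assms(1)] outward_normal_facet[OF assms(1)]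
    full_simplex.norm_onormal[OF verts_simplex(1)[OF assms(1)]] by auto

text \<open>
  Of three elements at one facet, two would have the same outward normal.
\<close>
lemma at_most_two_elements:
  assumes "T1 \<in> \<T>" "T2 \<in> \<T>" "T3 \<in> \<T>" "e facet_of T1" "e facet_of T2" "e facet_of T3" "T1 \<noteq> T2" "T3 \<noteq> T1"
  shows "T3 = T2"
proof (rule ccontr)
  assume "T3 \<noteq> T2"
  then have "outward_normal T3 e = - outward_normal T3 e"
    using outward_normal_opposite[of T1 T2 e] outward_normal_opposite[of T2 T3 e]
      outward_normal_opposite[of T1 T3 e] assms by auto
  then have "outward_normal T3 e = 0" by (metis eq_neg_iff_add_eq_0 scaleR_2 scaleR_eq_0_iff zero_neq_numeral)
  then show False using norm_outward_normal[OF assms(3,6)] by simp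
qed

lemma tp_mem: "e \<in> facets \<T> \<Longrightarrow> tp e \<in> \<T>" and tp_facet: "e \<in> facets \<T> \<Longrightarrow> e facet_of tp e"
  using orient by (auto simp: orientation_def)

lemma interior_facet_in_facets: "e \<in> interior_facets \<T> \<Longrightarrow> e \<in> facets \<T>"
  by (auto simp: interior_facets_def facets_def)

lemma facetsI: "T \<in> \<T> \<Longrightarrow> e facet_of T \<Longrightarrow> e \<in> facets \<T>"
  by (auto simp: facets_def)

text \<open>
  So the element $T^-$, defined by a unique description, is well defined.
\<close>
lemma interior_facet_elements:
  assumes e: "e \<in> interior_facets \<T>"
  shows "tminus \<T> tp e \<in> \<T>" "e facet_of tminus \<T> tp e" "tminus \<T> tp e \<noteq> tp e"
    and "{T \<in> \<T>. e facet_of T} = {tp e, tminus \<T> tp e}"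
proof -
  have f: "e \<in> facets \<T>" using e by (rule interior_facet_in_facets)
  obtain T T' where T: "T \<in> \<T>" "T' \<in> \<T>" "T \<noteq> T'" "e facet_of T" "e facet_of T'"
    using e by (auto simp: interior_facets_def)
  have "\<exists>!S. S \<in> \<T> \<and> e facet_of S \<and> S \<noteq> tp e"
  proof (rule ex_ex1I)
    show "\<exists>S. S \<in> \<T> \<and> e facet_of S \<and> S \<noteq> tp e" using T by metis
    show "S = S'" if "S \<in> \<T> \<and> e facet_of S \<and> S \<noteq> tp e" "S' \<in> \<T> \<and> e facet_of S' \<and> S' \<noteq> tp e" for S S'
      using at_most_two_elements[of "tp e" S' S e] tp_mem[OF f] tp_facet[OF f] that by auto
  qed
  from theI'[OF this, folded tminus_def]
  show 1: "tminus \<T> tp e \<in> \<T>" "e facet_of tminus \<T> tp e" "tminus \<T> tp e \<noteq> tp e" by auto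
  show "{T \<in> \<T>. e facet_of T} = {tp e, tminus \<T> tp e}"
  proof (intro subset_antisym subsetI)
    fix T assume "T \<in> {T \<in> \<T>. e facet_of T}"
    then have "T \<in> \<T>" "e facet_of T" by auto
    then have "T = tminus \<T> tp e" if "T \<noteq> tp e"
      using at_most_two_elements[OF tp_mem[OF f] 1(1) _ tp_facet[OF f] 1(2)] 1(3) that by metis
    then show "T \<in> {tp e, tminus \<T> tp e}" by blast
  qed (use 1 tp_mem[OF f] tp_facet[OF f] in auto)
qed

lemma boundary_facet_elements:
  assumes "e \<in> facets \<T>" "e \<notin> interior_facets \<T>"
  shows "{T \<in> \<T>. e facet_of T} = {tp e}"
  using assms tp_mem[OF assms(1)] tp_facet[OF assms(1)] by (auto simp: interior_facets_def)

lemma facet_normal_tminus: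
  assumes e: "e \<in> interior_facets \<T>"
  shows "outward_normal (tminus \<T> tp e) e = - facet_normal tp e"
  using outward_normal_opposite[of "tp e" "tminus \<T> tp e" e] interior_facet_elements[OF e]
    tp_mem[OF interior_facet_in_facets[OF e]] tp_facet[OF interior_facet_in_facets[OF e]]
  by (simp add: facet_normal_def)

lemma sum_facets_swap:
  "(\<Sum>e\<in>facets \<T>. \<Sum>T | T \<in> \<T> \<and> e facet_of T. F T e) = (\<Sum>T\<in>\<T>. \<Sum>e | e facet_of T. F T e)"
proof -
  have "(\<Sum>e\<in>facets \<T>. \<Sum>T | T \<in> \<T> \<and> e facet_of T. F T e)
      = (\<Sum>T\<in>\<T>. \<Sum>e | e \<in> facets \<T> \<and> e facet_of T. F T e)"
    by (rule sum.swap_restrict) simp_all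
  also have "\<dots> = (\<Sum>T\<in>\<T>. \<Sum>e | e facet_of T. F T e)"
    by (intro sum.cong refl) (auto intro: facetsI)
  finally show ?thesis .
qed

lemma element_interior: "T \<in> \<T> \<Longrightarrow> interior T \<noteq> {}"
  and element_closure_interior: "T \<in> \<T> \<Longrightarrow> closure (interior T) = T"
  using full_simplex.interior_simplex_nonempty[OF verts_simplex(1)]
    full_simplex.closure_interior_simplex[OF verts_simplex(1)] verts_simplex(2) by simp_all

lemma negligible_not_cover_open:
  assumes "open U" "U \<noteq> {}" "negligible N"
  obtains x where "x \<in> U" "x \<notin> N"
proof -
  have "\<not> U \<subseteq> N" using assms negligible_subset open_not_negligible by blast
  then show ?thesis using that by blast
qed

lemma facet_if_meet_codim_one:
  assumes "T \<in> \<T>" "T' \<in> \<T>" "T \<noteq> T'" "\<not> aff_dim (T \<inter> T') \<le> int CARD('n) - 2"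
  shows "(T \<inter> T') facet_of T" "(T \<inter> T') facet_of T'"
proof -
  have dim: "aff_dim (T \<inter> T') = int CARD('n) - 1" using meet_aff_dim[OF assms(1-3)] assms(4) by linarith
  have "aff_dim (T \<inter> T') \<noteq> -1" using dim by simp
  then have "T \<inter> T' \<noteq> {}" by (metis aff_dim_empty)
  then show "(T \<inter> T') facet_of T" "(T \<inter> T') facet_of T'"
    using meet_face[OF assms(1,2)] dim element_aff_dim assms(1,2) by (simp_all add: facet_of_def)
qed

text \<open>
  Suppose that \<open>S\<close> is neither empty nor everything. Elements inside and outside \<open>S\<close> share no facet, so
  they meet in faces of codimension at least two. In a ball inside the domain that meets both parts, join
  a point \<open>x\<close> of one part to a point \<open>y\<close> of the other one by a segment. As lower-dimensional sets do not
  cover an open set, \<open>x\<close> can be chosen outside these faces and \<open>y\<close> outside the affine hull of \<open>x\<close> and each of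
  them, which has codimension at least one. The segment then passes from one
  part to the other without meeting a common face, which is impossible. So each ball in the domain meets
  only one of the two parts, and these split the connected domain into two open sets.
\<close>
lemma facet_connected:
  assumes S: "S \<subseteq> \<T>" "S \<noteq> {}"
    and adj: "\<And>T T' e. T \<in> S \<Longrightarrow> T' \<in> \<T> \<Longrightarrow> e facet_of T \<Longrightarrow> e facet_of T' \<Longrightarrow> T' \<in> S"
  shows "S = \<T>"
proof (rule ccontr)
  assume ne: "S \<noteq> \<T>"
  define A where "A = \<Union>S"
  define B where "B = \<Union>(\<T> - S)"
  define Bad where "Bad = (\<lambda>(T, T'). T \<inter> T') ` (S \<times> (\<T> - S))"
  have fin: "finite S" using S(1) finite_\<T> by (rule finite_subset)
  have "finite Bad" unfolding Bad_def using fin by simp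
  have closed: "closed A" "closed B" unfolding A_def B_def
    by (rule closed_Union; use fin finite_Diff[OF finite_\<T>, of S] S(1) compact_imp_closed[OF element_compact] in blast)+
  have cover: "\<Omega> \<subseteq> A \<union> B" using \<Omega>_subset S by (auto simp: A_def B_def)
  have Bad_dim: "aff_dim F \<le> int CARD('n) - 2" if F: "F \<in> Bad" for F
  proof (rule ccontr)
    assume "\<not> ?thesis"
    moreover obtain T T' where T: "T \<in> S" "T' \<in> \<T>" "T' \<notin> S" "F = T \<inter> T'" using F by (auto simp: Bad_def)
    ultimately have "F facet_of T" "F facet_of T'"
      using facet_if_meet_codim_one[of T T'] S by auto
    then show False using adj[OF T(1,2)] T(3) by blast
  qed
  have Bad_neg: "negligible (\<Union>F\<in>Bad. affine hull (insert x F))" for x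
  proof (rule negligible_Union)
    show "finite ((\<lambda>F. affine hull (insert x F)) ` Bad)" using \<open>finite Bad\<close> by simp
    fix N assume "N \<in> (\<lambda>F. affine hull (insert x F)) ` Bad"
    then obtain F where F: "F \<in> Bad" "N = affine hull (insert x F)" by blast
    have "aff_dim (insert x F) < int CARD('n)"
      using Bad_dim[OF F(1)] by (simp add: aff_dim_insert)
    then show "negligible N" using lowdim_negligible F(2) by blast
  qed
  have hit: "U \<inter> interior T \<noteq> {}" if "open U" "U \<inter> T \<noteq> {}" "T \<in> \<T>" for U T
    using that element_closure_interior[OF that(3)] open_Int_closure_eq_empty[OF that(1), of "interior T"] by auto
  have mono: False if U: "open U" "convex U" "U \<subseteq> \<Omega>" "U \<inter> A \<noteq> {}" "U \<inter> B \<noteq> {}" for U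
  proof -
    obtain T where T: "T \<in> S" "U \<inter> T \<noteq> {}" using U(4) by (auto simp: A_def)
    obtain T' where T': "T' \<in> \<T>" "T' \<notin> S" "U \<inter> T' \<noteq> {}" using U(5) by (auto simp: B_def)
    \<comment> \<open>avoiding these hulls, \<open>x\<close> avoids in particular the common faces\<close>
    obtain x where x: "x \<in> U \<inter> interior T" "x \<notin> (\<Union>F\<in>Bad. affine hull (insert 0 F))"
      using negligible_not_cover_open[OF _ hit[OF U(1) T(2)] Bad_neg] U(1) S T(1) by blast
    obtain y where y: "y \<in> U \<inter> interior T'" "y \<notin> (\<Union>F\<in>Bad. affine hull (insert x F))"
      using negligible_not_cover_open[OF _ hit[OF U(1) T'(3,1)] Bad_neg] U(1) by blast
    have xF: "x \<notin> F" if "F \<in> Bad" for F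
      using x(2) that hull_subset[of "insert 0 F" affine] by blast
    have seg: "closed_segment x y \<subseteq> U" using x(1) y(1) U(2) by (simp add: closed_segment_subset)
    have xA: "x \<in> A" using x(1) T(1) interior_subset by (auto simp: A_def)
    have yB: "y \<in> B" using y(1) T'(1,2) interior_subset by (auto simp: B_def)
    have "A \<inter> B \<inter> closed_segment x y \<noteq> {}"
    proof
      assume "A \<inter> B \<inter> closed_segment x y = {}"
      then have "A \<inter> closed_segment x y = {} \<or> B \<inter> closed_segment x y = {}"
        using connected_closedD[OF connected_segment(1)[of x y] _ _ closed] seg U(3) cover by blast
      then show False using xA yB ends_in_segment by blast
    qed
    then obtain z where z: "z \<in> closed_segment x y" "z \<in> A" "z \<in> B" by blast
    then obtain F where F: "F \<in> Bad" "z \<in> F" by (auto simp: A_def B_def Bad_def)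
    obtain u where "z = (1 - u) *\<^sub>R x + u *\<^sub>R y" using z(1) unfolding in_segment by blast
    then have u: "z = x + u *\<^sub>R (y - x)" by (simp add: algebra_simps)
    \<comment> \<open>a common point other than \<open>x\<close> would put \<open>y\<close> into one of the avoided affine hulls\<close>
    have "u \<noteq> 0" using u xF[OF F(1)] F(2) by auto
    then have "y = x + (1 / u) *\<^sub>R (z - x)" using u by simp
    then have "y \<in> affine hull {x, z}" unfolding affine_hull_2_alt by blast
    also have "\<dots> \<subseteq> affine hull (insert x F)" using F(2) by (intro hull_mono) auto
    finally show False using y(2) F(1) by blast
  qed
  have A_open: "open (\<Omega> \<inter> A)" and B_open: "open (\<Omega> \<inter> B)"
  proof -
    have ball: "ball x r \<subseteq> \<Omega> \<inter> X" if "ball x r \<subseteq> \<Omega>" "0 < r" "x \<in> X" "(X, Y) \<in> {(A, B), (B, A)}" for x r X Y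
    proof -
      have "ball x r \<inter> X \<noteq> {}" using that(2,3) by (metis centre_in_ball disjoint_iff)
      then have "ball x r \<inter> Y = {}" using mono[OF open_ball convex_ball that(1)] that(4) by auto
      then show ?thesis using that(1,4) cover by auto
    qed
    show "open (\<Omega> \<inter> A)" unfolding open_contains_ball
      using ball[of _ _ A B] open_\<Omega>[unfolded open_contains_ball] by (metis IntD1 IntD2 insertCI)
    show "open (\<Omega> \<inter> B)" unfolding open_contains_ball
      using ball[of _ _ B A] open_\<Omega>[unfolded open_contains_ball] by (metis IntD1 IntD2 insertCI)
  qed
  have meets: "\<Omega> \<inter> T \<noteq> {}" if "T \<in> \<T>" for T
  proof -
    have "interior T \<inter> closure \<Omega> \<noteq> {}"
      using element_interior[OF that] Union_\<T> that interior_subset[of T] by blast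
    then have "interior T \<inter> \<Omega> \<noteq> {}" using open_Int_closure_eq_empty[OF open_interior] by blast
    then show ?thesis using interior_subset[of T] by blast
  qed
  have "(\<Omega> \<inter> A) \<inter> (\<Omega> \<inter> B) = {}"
  proof (rule ccontr)
    assume "\<not> ?thesis"
    then obtain x where x: "x \<in> \<Omega>" "x \<in> A" "x \<in> B" by blast
    then obtain r where "0 < r" "ball x r \<subseteq> \<Omega>" using open_\<Omega> open_contains_ball by blast
    then show False using mono[OF open_ball convex_ball, of x r] x by (metis centre_in_ball disjoint_iff)
  qed
  then have "\<Omega> \<inter> A = {} \<or> \<Omega> \<inter> B = {}"
    using connectedD[OF connected_\<Omega> A_open B_open] cover by blast
  moreover have "\<Omega> \<inter> A \<noteq> {}" using S meets by (auto simp: A_def)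
  moreover have "\<Omega> \<inter> B \<noteq> {}" using S ne meets by (auto simp: B_def)
  ultimately show False by blast
qed

subsection \<open>Piecewise affine functions\<close>

text \<open>
  Broken affine functions: no continuity between elements. The spaces $\mathbf{V}_h$ and $Q_h$ and all
  reconstructions consist of such functions.
\<close>
definition broken :: "(real ^ 'n \<Rightarrow> 'b::euclidean_space) \<Rightarrow> bool" where
  "broken v \<longleftrightarrow> (\<forall>T\<in>\<T>. \<exists>p\<in>P1. AE x in lebesgue_on T. v x = p x)"

lemma element_lebesgue: "T \<in> \<T> \<Longrightarrow> T \<in> sets lebesgue"
  using element_borel by simp

lemma piece_eqI:
  fixes v :: "real ^ 'n \<Rightarrow> 'b::euclidean_space"
  assumes T: "T \<in> \<T>" and p: "p \<in> P1" "AE x in lebesgue_on T. v x = p x"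
  shows "piece v T = p"
  unfolding piece_def
proof (rule the_equality)
  fix q :: "real ^ 'n \<Rightarrow> 'b" assume q: "q \<in> P1 \<and> (AE x in lebesgue_on T. v x = q x)"
  then have "AE x in lebesgue_on T. v x = q x" by blast
  with p(2) have "AE x in lebesgue_on T. q x = p x" by eventually_elim simp
  then have "AE x in lebesgue_on (convex hull (verts T)). q x = p x" unfolding verts_simplex(2)[OF T] .
  then show "q = p"
    using full_simplex.P1_eq_if_AE_eq[OF verts_simplex(1)[OF T] _ p(1)] q by blast
qed (use p in blast)

lemma
  fixes v :: "real ^ 'n \<Rightarrow> 'b::euclidean_space"
  assumes "broken v" "T \<in> \<T>"
  shows piece_P1: "piece v T \<in> P1" and piece_AE: "AE x in lebesgue_on T. v x = piece v T x"
proof -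
  obtain p where p: "p \<in> P1" "AE x in lebesgue_on T. v x = p x" using assms by (auto simp: broken_def)
  with piece_eqI[OF assms(2) this] show "piece v T \<in> P1" "AE x in lebesgue_on T. v x = piece v T x" by simp_all
qed

lemma
  fixes u v :: "real ^ 'n \<Rightarrow> 'b::euclidean_space"
  assumes u: "broken u" and v: "broken v"
  shows piece_comb: "T \<in> \<T> \<Longrightarrow> piece (\<lambda>x. u x + c *\<^sub>R v x) T = (\<lambda>x. piece u T x + c *\<^sub>R piece v T x)"
    and broken_comb: "broken (\<lambda>x. u x + c *\<^sub>R v x)"
proof -
  have P: "(\<lambda>x. piece u T x + c *\<^sub>R piece v T x) \<in> P1" if "T \<in> \<T>" for T
    by (intro P1_add P1_scaleR piece_P1 u v that)
  have ae: "AE x in lebesgue_on T. u x + c *\<^sub>R v x = piece u T x + c *\<^sub>R piece v T x" if "T \<in> \<T>" for T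
    using piece_AE[OF u that] piece_AE[OF v that] by eventually_elim simp
  show "piece (\<lambda>x. u x + c *\<^sub>R v x) T = (\<lambda>x. piece u T x + c *\<^sub>R piece v T x)" if "T \<in> \<T>"
    by (rule piece_eqI[OF that P[OF that] ae[OF that]])
  show "broken (\<lambda>x. u x + c *\<^sub>R v x)" unfolding broken_def
    by (intro ballI, rule bexI[OF _ P], rule ae)
qed

lemma AE_domain:
  assumes "\<And>T. T \<in> \<T> \<Longrightarrow> AE x in lebesgue_on T. P x"
  shows "AE x in lebesgue_on \<Omega>. P x"
proof -
  have "AE x in lebesgue. \<forall>T\<in>\<T>. x \<in> T \<longrightarrow> P x"
    using assms element_lebesgue by (intro AE_finite_allI) (auto simp: AE_restrict_space_iff)
  then have "AE x in lebesgue. x \<in> \<Omega> \<longrightarrow> P x"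
    by eventually_elim (use \<Omega>_subset in blast)
  moreover have "\<Omega> \<in> sets lebesgue" using open_\<Omega> by simp
  ultimately show ?thesis by (simp add: AE_restrict_space_iff)
qed

lemma broken_zero_AE:
  assumes "broken v" "\<And>T. T \<in> \<T> \<Longrightarrow> piece v T = (\<lambda>_. 0)"
  shows "AE x in lebesgue_on \<Omega>. v x = 0"
  using piece_AE[OF assms(1)] assms(2) by (intro AE_domain) simp

lemma integral_lebesgue_on_borel:
  fixes g :: "real ^ 'n \<Rightarrow> 'b::{banach, second_countable_topology}"
  assumes S: "S \<in> sets borel" and g: "g \<in> borel_measurable borel"
  shows "(\<integral>x. g x \<partial>lebesgue_on S) = (\<integral>x. indicator S x *\<^sub>R g x \<partial>lborel)"
proof -
  have "(\<integral>x. g x \<partial>lebesgue_on S) = (\<integral>x. indicator S x *\<^sub>R g x \<partial>lebesgue)"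
    using S by (subst integral_restrict_space) auto
  also have "\<dots> = (\<integral>x. indicator S x *\<^sub>R g x \<partial>lborel)"
    by (rule integral_completion) (use S g in auto)
  finally show ?thesis .
qed

lemma integrable_lebesgue_on_borel:
  fixes g :: "real ^ 'n \<Rightarrow> 'b::{banach, second_countable_topology}"
  assumes S: "S \<in> sets borel" and g: "g \<in> borel_measurable borel"
  shows "integrable (lebesgue_on S) g \<longleftrightarrow> integrable lborel (\<lambda>x. indicator S x *\<^sub>R g x)"
proof -
  have "integrable (lebesgue_on S) g \<longleftrightarrow> integrable lebesgue (\<lambda>x. indicator S x *\<^sub>R g x)"
    using S by (subst integrable_restrict_space) auto
  also have "\<dots> \<longleftrightarrow> integrable lborel (\<lambda>x. indicator S x *\<^sub>R g x)"
    by (rule integrable_completion) (use S g in auto)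
  finally show ?thesis .
qed

lemma integrable_element:
  fixes g :: "real ^ 'n \<Rightarrow> 'b::{banach, second_countable_topology}"
  assumes T: "T \<in> \<T>" and g: "continuous_on UNIV g"
  shows "integrable (lebesgue_on T) g"
proof -
  have "g \<in> borel_measurable borel" using g by (rule borel_measurable_continuous_onI)
  moreover have "integrable lborel (\<lambda>x. indicator T x *\<^sub>R g x)"
    using borel_integrable_compact[OF element_compact[OF T] continuous_on_subset[OF g]]
    by (simp add: indicator_def if_distrib[of "\<lambda>r. r *\<^sub>R _"] cong: if_cong)
  ultimately show ?thesis using integrable_lebesgue_on_borel[OF element_borel[OF T]] by blast
qed

end

section \<open>Square integrable functions\<close>

lemma norm_add_scaleR_squared_le:
  fixes a b :: "'a::real_inner"
  shows "(norm (a + c *\<^sub>R b))\<^sup>2 \<le> 2 * (norm a)\<^sup>2 + 2 * c\<^sup>2 * (norm b)\<^sup>2"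
proof -
  have "(norm (a + c *\<^sub>R b))\<^sup>2 \<le> (norm a + norm (c *\<^sub>R b))\<^sup>2"
    by (intro power_mono norm_triangle_ineq) simp
  also have "\<dots> \<le> 2 * (norm a)\<^sup>2 + 2 * (norm (c *\<^sub>R b))\<^sup>2"
    using sum_squares_bound[of "norm a" "norm (c *\<^sub>R b)"] by (simp add: power2_sum)
  finally show ?thesis by (simp add: power_mult_distrib)
qed

lemma L2_measurable: "f \<in> L2 \<Omega> \<Longrightarrow> f \<in> borel_measurable (lebesgue_on \<Omega>)"
  and L2_integrable: "f \<in> L2 \<Omega> \<Longrightarrow> integrable (lebesgue_on \<Omega>) (\<lambda>x. (norm (f x))\<^sup>2)"
  by (simp_all add: L2_def)

lemma L2_comb:
  fixes u v :: "'a::euclidean_space \<Rightarrow> 'b::euclidean_space"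
  assumes u: "u \<in> L2 \<Omega>" and v: "v \<in> L2 \<Omega>"
  shows "(\<lambda>x. u x + c *\<^sub>R v x) \<in> L2 \<Omega>"
    and "(\<integral>x. (norm (u x + c *\<^sub>R v x))\<^sup>2 \<partial>lebesgue_on \<Omega>)
      \<le> 2 * (\<integral>x. (norm (u x))\<^sup>2 \<partial>lebesgue_on \<Omega>) + 2 * c\<^sup>2 * (\<integral>x. (norm (v x))\<^sup>2 \<partial>lebesgue_on \<Omega>)"
proof -
  note [measurable] = L2_measurable[OF u] L2_measurable[OF v]
  have int: "integrable (lebesgue_on \<Omega>) (\<lambda>x. 2 * (norm (u x))\<^sup>2 + 2 * c\<^sup>2 * (norm (v x))\<^sup>2)"
    by (intro Bochner_Integration.integrable_add integrable_mult_right L2_integrable u v)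
  have "integrable (lebesgue_on \<Omega>) (\<lambda>x. (norm (u x + c *\<^sub>R v x))\<^sup>2)"
    by (rule Bochner_Integration.integrable_bound[OF int])
      (auto intro!: AE_I2 order_trans[OF norm_add_scaleR_squared_le] simp: abs_of_nonneg)
  then show "(\<lambda>x. u x + c *\<^sub>R v x) \<in> L2 \<Omega>" by (simp add: L2_def)
  have "(\<integral>x. (norm (u x + c *\<^sub>R v x))\<^sup>2 \<partial>lebesgue_on \<Omega>)
      \<le> (\<integral>x. 2 * (norm (u x))\<^sup>2 + 2 * c\<^sup>2 * (norm (v x))\<^sup>2 \<partial>lebesgue_on \<Omega>)"
    by (intro integral_mono int norm_add_scaleR_squared_le) fact
  also have "\<dots> = 2 * (\<integral>x. (norm (u x))\<^sup>2 \<partial>lebesgue_on \<Omega>) + 2 * c\<^sup>2 * (\<integral>x. (norm (v x))\<^sup>2 \<partial>lebesgue_on \<Omega>)"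
    using L2_integrable[OF u] L2_integrable[OF v] by simp
  finally show "(\<integral>x. (norm (u x + c *\<^sub>R v x))\<^sup>2 \<partial>lebesgue_on \<Omega>)
      \<le> 2 * (\<integral>x. (norm (u x))\<^sup>2 \<partial>lebesgue_on \<Omega>) + 2 * c\<^sup>2 * (\<integral>x. (norm (v x))\<^sup>2 \<partial>lebesgue_on \<Omega>)" .
qed

lemma L2_diff:
  fixes u v :: "'a::euclidean_space \<Rightarrow> 'b::euclidean_space"
  assumes "u \<in> L2 \<Omega>" "v \<in> L2 \<Omega>" shows "(\<lambda>x. u x - v x) \<in> L2 \<Omega>"
  using L2_comb(1)[OF assms, of "-1"] by simp

lemma norm_product_le: "norm a * norm b \<le> (norm a)\<^sup>2 + (norm b)\<^sup>2"
proof -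
  have "2 * (norm a * norm b) \<le> (norm a)\<^sup>2 + (norm b)\<^sup>2"
    using sum_squares_bound[of "norm a" "norm b"] by (simp only: mult.assoc)
  moreover have "0 \<le> norm a * norm b" by simp
  ultimately show ?thesis by linarith
qed

lemma L2_scaleR_integrable:
  fixes v :: "'a::euclidean_space \<Rightarrow> real" and g :: "'a \<Rightarrow> 'b::euclidean_space"
  assumes v: "v \<in> L2 \<Omega>" and g: "g \<in> L2 \<Omega>"
  shows "integrable (lebesgue_on \<Omega>) (\<lambda>x. v x *\<^sub>R g x)"
proof -
  note [measurable] = L2_measurable[OF v] L2_measurable[OF g]
  have int: "integrable (lebesgue_on \<Omega>) (\<lambda>x. (norm (v x))\<^sup>2 + (norm (g x))\<^sup>2)"
    by (intro Bochner_Integration.integrable_add L2_integrable v g)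
  show ?thesis
    by (rule Bochner_Integration.integrable_bound[OF int])
      (use norm_product_le[of "v _" "g _"] in \<open>auto intro!: AE_I2\<close>)
qed

lemma L2_inner_integrable:
  fixes f g :: "'a::euclidean_space \<Rightarrow> 'b::euclidean_space"
  assumes f: "f \<in> L2 \<Omega>" and g: "g \<in> L2 \<Omega>"
  shows "integrable (lebesgue_on \<Omega>) (\<lambda>x. f x \<bullet> g x)"
proof -
  note [measurable] = L2_measurable[OF f] L2_measurable[OF g]
  have int: "integrable (lebesgue_on \<Omega>) (\<lambda>x. (norm (f x))\<^sup>2 + (norm (g x))\<^sup>2)"
    by (intro Bochner_Integration.integrable_add L2_integrable f g)
  have "norm (f x \<bullet> g x) \<le> norm ((norm (f x))\<^sup>2 + (norm (g x))\<^sup>2)" for x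
    using Cauchy_Schwarz_ineq2[of "f x" "g x"] norm_product_le[of "f x" "g x"] by simp
  then show ?thesis
    by (intro Bochner_Integration.integrable_bound[OF int]) auto
qed

lemma L2_bounded_borel:
  fixes g :: "'a::euclidean_space \<Rightarrow> 'b::euclidean_space"
  assumes \<Omega>: "\<Omega> \<in> sets borel" "bounded \<Omega>" and g: "g \<in> borel_measurable borel"
    and B: "\<And>x. x \<in> \<Omega> \<Longrightarrow> norm (g x) \<le> B"
  shows "g \<in> L2 \<Omega>"
proof -
  have meas: "g \<in> borel_measurable (lebesgue_on \<Omega>)"
    using g by (intro measurable_restrict_space1 measurable_completion) simp
  have "emeasure lborel \<Omega> < \<infinity>" using \<Omega>(2) by (rule emeasure_bounded_finite)
  then have "finite_measure (lebesgue_on \<Omega>)"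
    using \<Omega>(1) by (intro finite_measureI) (simp add: emeasure_restrict_space space_restrict_space)
  then interpret finite_measure "lebesgue_on \<Omega>" .
  have "integrable (lebesgue_on \<Omega>) (\<lambda>x. (norm (g x))\<^sup>2)"
    using meas by (intro integrable_const_bound[of _ "B\<^sup>2"] AE_I2)
      (auto simp: space_restrict_space intro!: power_mono B)
  then show ?thesis using meas by (simp add: L2_def)
qed

lemma L2_continuous:
  fixes g :: "'a::euclidean_space \<Rightarrow> 'b::euclidean_space"
  assumes \<Omega>: "open \<Omega>" "bounded \<Omega>" and g: "continuous_on UNIV g"
  shows "g \<in> L2 \<Omega>"
proof -
  have "compact (g ` closure \<Omega>)"
    using \<Omega>(2) by (intro compact_continuous_image continuous_on_subset[OF g subset_UNIV]) simp
  from compact_imp_bounded[OF this] obtain B where "\<forall>y\<in>g ` closure \<Omega>. norm y \<le> B"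
    unfolding bounded_iff by auto
  then have "norm (g x) \<le> B" if "x \<in> \<Omega>" for x using that closure_subset by blast
  then show ?thesis
    using \<Omega> borel_measurable_continuous_onI[OF g] by (intro L2_bounded_borel) auto
qed

section \<open>Test functions and weak derivatives\<close>

lemma differentiable_has_grad:
  fixes \<phi> :: "real ^ 'n \<Rightarrow> real"
  assumes "\<phi> differentiable (at x)"
  shows "(\<phi> has_derivative (\<lambda>h. grad \<phi> x \<bullet> h)) (at x)"
proof -
  let ?D = "frechet_derivative \<phi> (at x)"
  have D: "(\<phi> has_derivative ?D) (at x)" using assms frechet_derivative_works by blast
  then have lin: "linear ?D" by (rule has_derivative_linear)
  have "?D h = grad \<phi> x \<bullet> h" for h
  proof -
    have "?D h = ?D (\<Sum>i\<in>UNIV. h $ i *\<^sub>R axis i 1)"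
      using basis_expansion[of h] by (simp add: scalar_mult_eq_scaleR)
    then show ?thesis
      by (simp add: linear_sum[OF lin] linear_scale[OF lin] inner_vec_def grad_def mult.commute)
  qed
  then show ?thesis using D by (metis (no_types, lifting) ext)
qed

lemma grad_eqI:
  fixes \<phi> :: "real ^ 'n \<Rightarrow> real"
  assumes "(\<phi> has_derivative (\<lambda>h. g \<bullet> h)) (at x)" shows "grad \<phi> x = g"
  by (simp add: grad_def vec_eq_iff inner_axis flip: frechet_derivative_at[OF assms])

lemma grad_comb:
  fixes \<phi> \<psi> :: "real ^ 'n \<Rightarrow> real"
  assumes "\<phi> differentiable (at x)" "\<psi> differentiable (at x)"
  shows "grad (\<lambda>x. \<phi> x + c * \<psi> x) x = grad \<phi> x + c *\<^sub>R grad \<psi> x"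
proof (rule grad_eqI)
  show "((\<lambda>x. \<phi> x + c * \<psi> x) has_derivative (\<lambda>h. (grad \<phi> x + c *\<^sub>R grad \<psi> x) \<bullet> h)) (at x)"
    using has_derivative_add[OF differentiable_has_grad[OF assms(1)]
        has_derivative_mult_right[OF differentiable_has_grad[OF assms(2)], of c]]
    by (simp add: inner_add_left)
qed

lemma Ck_comb: "Ck k \<phi> \<Longrightarrow> Ck k \<psi> \<Longrightarrow> Ck k (\<lambda>x. \<phi> x + c * \<psi> x)"
proof (induction k arbitrary: \<phi> \<psi>)
  case 0
  then show ?case by (auto intro!: continuous_intros)
next
  case (Suc k)
  then have diff: "\<phi> differentiable (at x)" "\<psi> differentiable (at x)" for x by auto
  have "(\<lambda>x. grad (\<lambda>x. \<phi> x + c * \<psi> x) x $ i) = (\<lambda>x. grad \<phi> x $ i + c * grad \<psi> x $ i)" for i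
    using grad_comb[OF diff] by auto
  then show ?case using Suc diff by (auto intro!: derivative_intros)
qed

lemma Ck_zero: "Ck k (\<lambda>_ :: real ^ 'n. 0)"
proof (induction k)
  case (Suc k)
  have "grad (\<lambda>_::real ^ 'n. 0::real) x = 0" for x by (rule grad_eqI) simp
  then show ?case using Suc by simp
qed simp

lemma test_function_comb:
  assumes "\<phi> \<in> test_functions \<Omega>" "\<psi> \<in> test_functions \<Omega>"
  shows "(\<lambda>x. \<phi> x + c * \<psi> x) \<in> test_functions \<Omega>"
proof -
  obtain K where K: "compact K" "K \<subseteq> \<Omega>" "\<forall>x. x \<notin> K \<longrightarrow> \<phi> x = 0"
    using assms(1) by (auto simp: test_functions_def)
  obtain K' where K': "compact K'" "K' \<subseteq> \<Omega>" "\<forall>x. x \<notin> K' \<longrightarrow> \<psi> x = 0"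
    using assms(2) by (auto simp: test_functions_def)
  have "compact (K \<union> K')" "K \<union> K' \<subseteq> \<Omega>" "\<forall>x. x \<notin> K \<union> K' \<longrightarrow> \<phi> x + c * \<psi> x = 0"
    using K K' by auto
  moreover have "Ck k (\<lambda>x. \<phi> x + c * \<psi> x)" for k
    using assms by (auto simp: test_functions_def intro: Ck_comb)
  ultimately show ?thesis unfolding test_functions_def by blast
qed

lemma test_function_zero: "(\<lambda>_. 0) \<in> test_functions \<Omega>"
  unfolding test_functions_def using Ck_zero by (auto intro: exI[of _ "{}"])

lemma test_function_differentiable: "\<phi> \<in> test_functions \<Omega> \<Longrightarrow> \<phi> differentiable (at x)"
proof -
  assume "\<phi> \<in> test_functions \<Omega>"
  then have "Ck (Suc 0) \<phi>" unfolding test_functions_def by blast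
  then show ?thesis by simp
qed

lemma test_function_has_grad:
  "\<phi> \<in> test_functions \<Omega> \<Longrightarrow> (\<phi> has_derivative (\<lambda>h. grad \<phi> x \<bullet> h)) (at x)"
  by (intro differentiable_has_grad test_function_differentiable)

lemma test_function_grad_continuous:
  assumes "\<phi> \<in> test_functions \<Omega>" shows "continuous_on UNIV (grad \<phi>)"
proof -
  have "Ck (Suc 0) \<phi>" using assms unfolding test_functions_def by blast
  then have "continuous_on UNIV (\<lambda>x. \<chi> i. grad \<phi> x $ i)" by (intro continuous_on_vec_lambda) simp
  then show ?thesis by simp
qed

lemma test_function_continuous: "\<phi> \<in> test_functions \<Omega> \<Longrightarrow> continuous_on UNIV \<phi>"
proof -
  assume "\<phi> \<in> test_functions \<Omega>"
  then have "Ck 0 \<phi>" unfolding test_functions_def by blast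
  then show ?thesis by simp
qed

lemma test_function_outside:
  assumes \<phi>: "\<phi> \<in> test_functions \<Omega>" and x: "x \<notin> \<Omega>"
  shows "\<phi> x = 0" and "grad \<phi> x = 0"
proof -
  obtain K where K: "compact K" "K \<subseteq> \<Omega>" "\<forall>x. x \<notin> K \<longrightarrow> \<phi> x = 0"
    using \<phi> by (auto simp: test_functions_def)
  have x': "x \<in> - K" "open (- K)" using x K compact_imp_closed by auto
  then show "\<phi> x = 0" using K by blast
  have "(\<phi> has_derivative (\<lambda>h. 0)) (at x)"
  proof (rule has_derivative_transform_within_open[OF _ x'(2,1)])
    show "((\<lambda>_. 0) has_derivative (\<lambda>h. 0)) (at x)" by simp
  qed (use K in auto)
  then show "grad \<phi> x = 0" by (intro grad_eqI) simp
qed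

lemma weak_gradient_comb:
  assumes \<Omega>: "open \<Omega>" "bounded \<Omega>" and L: "u \<in> L2 \<Omega>" "v \<in> L2 \<Omega>" "G \<in> L2 \<Omega>" "H \<in> L2 \<Omega>"
    and w: "weak_gradient \<Omega> u G" "weak_gradient \<Omega> v H"
  shows "weak_gradient \<Omega> (\<lambda>x. u x + c *\<^sub>R v x) (\<lambda>x. G x + c *\<^sub>R H x)"
  unfolding weak_gradient_def
proof
  fix \<phi> assume \<phi>: "\<phi> \<in> test_functions \<Omega>"
  have L\<phi>: "\<phi> \<in> L2 \<Omega>" "grad \<phi> \<in> L2 \<Omega>"
    using test_function_continuous[OF \<phi>] test_function_grad_continuous[OF \<phi>] \<Omega> by (auto intro: L2_continuous)
  note int = L2_scaleR_integrable[OF L(1) L\<phi>(2)] L2_scaleR_integrable[OF L(2) L\<phi>(2)]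
    L2_scaleR_integrable[OF L\<phi>(1) L(3)] L2_scaleR_integrable[OF L\<phi>(1) L(4)]
  have "(\<integral>x. (u x + c *\<^sub>R v x) *\<^sub>R grad \<phi> x \<partial>lebesgue_on \<Omega>)
      = (\<integral>x. u x *\<^sub>R grad \<phi> x + c *\<^sub>R (v x *\<^sub>R grad \<phi> x) \<partial>lebesgue_on \<Omega>)"
    by (simp add: scaleR_add_left)
  also have "\<dots> = (\<integral>x. u x *\<^sub>R grad \<phi> x \<partial>lebesgue_on \<Omega>) + c *\<^sub>R (\<integral>x. v x *\<^sub>R grad \<phi> x \<partial>lebesgue_on \<Omega>)"
    using int by (simp del: scaleR_scaleR)
  also have "\<dots> = - ((\<integral>x. \<phi> x *\<^sub>R G x \<partial>lebesgue_on \<Omega>) + c *\<^sub>R (\<integral>x. \<phi> x *\<^sub>R H x \<partial>lebesgue_on \<Omega>))"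
    using w \<phi> by (simp add: weak_gradient_def)
  also have "(\<integral>x. \<phi> x *\<^sub>R G x \<partial>lebesgue_on \<Omega>) + c *\<^sub>R (\<integral>x. \<phi> x *\<^sub>R H x \<partial>lebesgue_on \<Omega>)
      = (\<integral>x. \<phi> x *\<^sub>R G x + c *\<^sub>R (\<phi> x *\<^sub>R H x) \<partial>lebesgue_on \<Omega>)"
    using int by (simp del: scaleR_scaleR)
  also have "\<dots> = (\<integral>x. \<phi> x *\<^sub>R (G x + c *\<^sub>R H x) \<partial>lebesgue_on \<Omega>)"
    by (simp add: scaleR_add_right mult.commute)
  finally show "(\<integral>x. (u x + c *\<^sub>R v x) *\<^sub>R grad \<phi> x \<partial>lebesgue_on \<Omega>)
      = - (\<integral>x. \<phi> x *\<^sub>R (G x + c *\<^sub>R H x) \<partial>lebesgue_on \<Omega>)" .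
qed

lemma L2_limit_comb:
  fixes f g :: "nat \<Rightarrow> 'a::euclidean_space \<Rightarrow> 'b::euclidean_space"
  assumes L: "\<And>k. f k \<in> L2 \<Omega>" "\<And>k. g k \<in> L2 \<Omega>"
    and f: "(\<lambda>k. \<integral>x. (norm (f k x))\<^sup>2 \<partial>lebesgue_on \<Omega>) \<longlonglongrightarrow> 0"
    and g: "(\<lambda>k. \<integral>x. (norm (g k x))\<^sup>2 \<partial>lebesgue_on \<Omega>) \<longlonglongrightarrow> 0"
  shows "(\<lambda>k. \<integral>x. (norm (f k x + c *\<^sub>R g k x))\<^sup>2 \<partial>lebesgue_on \<Omega>) \<longlonglongrightarrow> 0"
proof (rule tendsto_sandwich[OF _ _ tendsto_const])
  let ?b = "\<lambda>k. 2 * (\<integral>x. (norm (f k x))\<^sup>2 \<partial>lebesgue_on \<Omega>) + 2 * c\<^sup>2 * (\<integral>x. (norm (g k x))\<^sup>2 \<partial>lebesgue_on \<Omega>)"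
  have "?b \<longlonglongrightarrow> 2 * 0 + 2 * c\<^sup>2 * 0" by (intro tendsto_intros f g)
  then show "?b \<longlonglongrightarrow> 0" by simp
  show "\<forall>\<^sub>F k in sequentially. (\<integral>x. (norm (f k x + c *\<^sub>R g k x))\<^sup>2 \<partial>lebesgue_on \<Omega>) \<le> ?b k"
    using L2_comb(2)[OF L(1) L(2)] by simp
qed simp

text \<open>
  The approximating sequences are combined like the functions themselves.
\<close>
lemma H10_comb:
  fixes u v :: "real ^ 'n \<Rightarrow> real"
  assumes \<Omega>: "open \<Omega>" "bounded \<Omega>" and u: "u \<in> H10 \<Omega>" and v: "v \<in> H10 \<Omega>"
  shows "(\<lambda>x. u x + c *\<^sub>R v x) \<in> H10 \<Omega>"
proof -
  obtain G \<phi> where G: "u \<in> L2 \<Omega>" "G \<in> L2 \<Omega>" "weak_gradient \<Omega> u G"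
    and \<phi>: "\<forall>k::nat. \<phi> k \<in> test_functions \<Omega>" "(\<lambda>k. \<integral>x. (\<phi> k x - u x)\<^sup>2 \<partial>lebesgue_on \<Omega>) \<longlonglongrightarrow> 0"
      "(\<lambda>k. \<integral>x. (norm (grad (\<phi> k) x - G x))\<^sup>2 \<partial>lebesgue_on \<Omega>) \<longlonglongrightarrow> 0"
    using u unfolding H10_def by blast
  obtain H \<psi> where H: "v \<in> L2 \<Omega>" "H \<in> L2 \<Omega>" "weak_gradient \<Omega> v H"
    and \<psi>: "\<forall>k::nat. \<psi> k \<in> test_functions \<Omega>" "(\<lambda>k. \<integral>x. (\<psi> k x - v x)\<^sup>2 \<partial>lebesgue_on \<Omega>) \<longlonglongrightarrow> 0"
      "(\<lambda>k. \<integral>x. (norm (grad (\<psi> k) x - H x))\<^sup>2 \<partial>lebesgue_on \<Omega>) \<longlonglongrightarrow> 0"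
    using v unfolding H10_def by blast
  define \<eta> where "\<eta> k x = \<phi> k x + c * \<psi> k x" for k x
  have \<eta>: "\<eta> k \<in> test_functions \<Omega>" for k
    unfolding \<eta>_def[abs_def] using \<phi>(1) \<psi>(1) by (intro test_function_comb) auto
  have L: "\<phi> k \<in> L2 \<Omega>" "\<psi> k \<in> L2 \<Omega>" "grad (\<phi> k) \<in> L2 \<Omega>" "grad (\<psi> k) \<in> L2 \<Omega>" for k
    using \<phi>(1) \<psi>(1) \<Omega> by (auto intro: L2_continuous test_function_continuous test_function_grad_continuous)
  have 1: "(\<lambda>k. \<integral>x. (\<eta> k x - (u x + c *\<^sub>R v x))\<^sup>2 \<partial>lebesgue_on \<Omega>) \<longlonglongrightarrow> 0"
  proof -
    have "(\<lambda>k. \<integral>x. (norm ((\<phi> k x - u x) + c *\<^sub>R (\<psi> k x - v x)))\<^sup>2 \<partial>lebesgue_on \<Omega>) \<longlonglongrightarrow> 0"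
      by (rule L2_limit_comb) (use \<phi>(2) \<psi>(2) L G H in \<open>auto intro: L2_diff\<close>)
    moreover have "(\<phi> k x - u x) + c *\<^sub>R (\<psi> k x - v x) = \<eta> k x - (u x + c *\<^sub>R v x)" for k x
      by (simp add: \<eta>_def algebra_simps)
    ultimately show ?thesis by (simp only: real_norm_def power2_abs)
  qed
  have 2: "(\<lambda>k. \<integral>x. (norm (grad (\<eta> k) x - (G x + c *\<^sub>R H x)))\<^sup>2 \<partial>lebesgue_on \<Omega>) \<longlonglongrightarrow> 0"
  proof -
    have "(\<lambda>k. \<integral>x. (norm ((grad (\<phi> k) x - G x) + c *\<^sub>R (grad (\<psi> k) x - H x)))\<^sup>2 \<partial>lebesgue_on \<Omega>) \<longlonglongrightarrow> 0"
      by (rule L2_limit_comb) (use \<phi>(3) \<psi>(3) L G H in \<open>auto intro: L2_diff\<close>)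
    moreover have "(grad (\<phi> k) x - G x) + c *\<^sub>R (grad (\<psi> k) x - H x) = grad (\<eta> k) x - (G x + c *\<^sub>R H x)" for k x
    proof -
      have "grad (\<eta> k) x = grad (\<phi> k) x + c *\<^sub>R grad (\<psi> k) x"
        unfolding \<eta>_def[abs_def] using \<phi>(1) \<psi>(1) by (intro grad_comb test_function_differentiable) auto
      then show ?thesis by (simp add: algebra_simps)
    qed
    ultimately show ?thesis by simp
  qed
  have wg: "weak_gradient \<Omega> (\<lambda>x. u x + c *\<^sub>R v x) (\<lambda>x. G x + c *\<^sub>R H x)"
    by (rule weak_gradient_comb[OF \<Omega> G(1) H(1) G(2) H(2) G(3) H(3)])
  show ?thesis
    unfolding H10_def
    by (intro CollectI conjI L2_comb(1) G(1) H(1) bexI[of _ "\<lambda>x. G x + c *\<^sub>R H x"] wg exI[of _ \<eta>] allI \<eta> 1 2 G(2) H(2))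
qed

lemma H10_zero:
  assumes "open \<Omega>" "bounded \<Omega>" shows "(\<lambda>_. 0) \<in> H10 (\<Omega> :: (real ^ 'n) set)"
proof -
  have g: "grad (\<lambda>_::real ^ 'n. 0::real) x = 0" for x by (rule grad_eqI) simp
  have L: "(\<lambda>_. 0) \<in> L2 \<Omega>" "(\<lambda>_. 0) \<in> (L2 \<Omega> :: (real ^ 'n \<Rightarrow> real ^ 'n) set)"
    using assms by (auto intro: L2_continuous)
  show ?thesis unfolding H10_def
    by (intro CollectI conjI L bexI[of _ "\<lambda>_. 0"] exI[of _ "\<lambda>_ _. 0"] allI test_function_zero)
      (simp_all add: weak_gradient_def g)
qed

section \<open>Discrete spaces\<close>

context mesh
begin

lemma C_space_comb:
  assumes "u \<in> C_space \<Omega> \<T>" "v \<in> C_space \<Omega> \<T>"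
  shows "(\<lambda>x. u x + c *\<^sub>R v x) \<in> C_space \<Omega> \<T>"
proof -
  have b: "broken u" "broken v" using assms by (auto simp: C_space_def broken_def)
  have "(\<lambda>x. (u x + c *\<^sub>R v x) $ i) \<in> H10 \<Omega>" for i
    using H10_comb[OF open_\<Omega> bounded_\<Omega>, of "\<lambda>x. u x $ i" "\<lambda>x. v x $ i" c] assms by (simp add: C_space_def)
  then show ?thesis using broken_comb[OF b] by (simp add: C_space_def broken_def)
qed

lemma C_space_zero: "(\<lambda>_. 0) \<in> C_space \<Omega> \<T>"
  using H10_zero[OF open_\<Omega> bounded_\<Omega>] by (auto simp: C_space_def intro!: bexI[of _ "\<lambda>_. 0"])

lemma D_space_comb:
  assumes "u \<in> D_space \<Omega> \<T>" "v \<in> D_space \<Omega> \<T>"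
  shows "(\<lambda>x. u x + c *\<^sub>R v x) \<in> D_space \<Omega> \<T>"
proof -
  have "\<exists>r. AE x in lebesgue_on T. u x + c *\<^sub>R v x = r *\<^sub>R (x - barycenter T)" if T: "T \<in> \<T>" for T
  proof -
    obtain r s where r: "AE x in lebesgue_on T. u x = r *\<^sub>R (x - barycenter T)"
      and s: "AE x in lebesgue_on T. v x = s *\<^sub>R (x - barycenter T)"
      using assms T unfolding D_space_def by blast
    have "AE x in lebesgue_on T. u x + c *\<^sub>R v x = (r + c * s) *\<^sub>R (x - barycenter T)"
      using r s by eventually_elim (simp add: scaleR_add_left)
    then show ?thesis by blast
  qed
  then show ?thesis using L2_comb(1)[of u \<Omega> v c] assms by (auto simp: D_space_def)
qed

lemma V_spaceI: "a \<in> C_space \<Omega> \<T> \<Longrightarrow> b \<in> D_space \<Omega> \<T> \<Longrightarrow> (\<lambda>x. a x + b x) \<in> V_space \<Omega> \<T>"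
  unfolding V_space_def by blast

lemma V_space_comb:
  assumes "u \<in> V_space \<Omega> \<T>" "v \<in> V_space \<Omega> \<T>"
  shows "(\<lambda>x. u x + c *\<^sub>R v x) \<in> V_space \<Omega> \<T>"
proof -
  obtain a b where ab: "a \<in> C_space \<Omega> \<T>" "b \<in> D_space \<Omega> \<T>" "u = (\<lambda>x. a x + b x)"
    using assms(1) unfolding V_space_def by blast
  obtain a' b' where ab': "a' \<in> C_space \<Omega> \<T>" "b' \<in> D_space \<Omega> \<T>" "v = (\<lambda>x. a' x + b' x)"
    using assms(2) unfolding V_space_def by blast
  have eq: "(\<lambda>x. u x + c *\<^sub>R v x) = (\<lambda>x. (a x + c *\<^sub>R a' x) + (b x + c *\<^sub>R b' x))"
    by (simp add: ab ab' scaleR_add_right add_ac)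
  show ?thesis unfolding eq
    by (rule V_spaceI[OF C_space_comb[OF ab(1) ab'(1)] D_space_comb[OF ab(2) ab'(2)]])
qed

lemma D_subset_V: "D_space \<Omega> \<T> \<subseteq> V_space \<Omega> \<T>"
  using C_space_zero unfolding V_space_def by force

lemma affine_multiple_P1: "(\<lambda>x. c *\<^sub>R (x - a)) \<in> P1"
  by (intro P1_scaleR P1_diff P1_const P1_linear linear_ident)

lemma V_space_broken: "v \<in> V_space \<Omega> \<T> \<Longrightarrow> broken v"
proof -
  assume "v \<in> V_space \<Omega> \<T>"
  then obtain a b where ab: "a \<in> C_space \<Omega> \<T>" "b \<in> D_space \<Omega> \<T>" "v = (\<lambda>x. a x + b x)"
    unfolding V_space_def by blast
  have "broken a" using ab(1) by (simp add: C_space_def broken_def)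
  moreover have "broken b" unfolding broken_def
  proof
    fix T assume "T \<in> \<T>"
    then obtain r where "AE x in lebesgue_on T. b x = r *\<^sub>R (x - barycenter T)"
      using ab(2) unfolding D_space_def by blast
    then show "\<exists>p\<in>P1. AE x in lebesgue_on T. b x = p x" by (rule bexI[OF _ affine_multiple_P1])
  qed
  ultimately show ?thesis using broken_comb[of a b 1] ab(3) by simp
qed

text \<open>
  The basis function of $\mathbf{D}_h$ that belongs to the element \<open>T\<close>.
\<close>
definition local_dilation :: "(real ^ 'n) set \<Rightarrow> real ^ 'n \<Rightarrow> real ^ 'n" where
  "local_dilation T x = (if x \<in> T then x - barycenter T else 0)"

lemma AE_outside_other:
  assumes "T \<in> \<T>" "T' \<in> \<T>" "T \<noteq> T'" shows "AE x in lebesgue_on T'. x \<notin> T"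
proof -
  have "negligible {x. \<not> (x \<in> T' \<longrightarrow> x \<notin> T)}"
    using meet_negligible[OF assms] by (rule negligible_subset) auto
  then have "AE x in lebesgue. x \<in> T' \<longrightarrow> x \<notin> T"
    by (intro AE_I[of _ _ "{x. \<not> (x \<in> T' \<longrightarrow> x \<notin> T)}"]) (auto simp: negligible_iff_null_sets null_sets_def)
  then show ?thesis using element_lebesgue[OF assms(2)] by (simp add: AE_restrict_space_iff)
qed

lemma local_dilation_AE:
  assumes T: "T \<in> \<T>" and T': "T' \<in> \<T>"
  shows "AE x in lebesgue_on T'. local_dilation T x = (if T' = T then x - barycenter T else 0)"
proof (cases "T' = T")
  case True
  then show ?thesis by (intro AE_I2) (simp add: local_dilation_def space_restrict_space)
next
  case False
  then show ?thesis
    using AE_outside_other[OF T T'] by (auto elim!: eventually_mono simp: local_dilation_def)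
qed

lemma local_dilation_D:
  assumes T: "T \<in> \<T>" shows "local_dilation T \<in> D_space \<Omega> \<T>"
proof -
  have "compact ((\<lambda>x. x - barycenter T) ` T)"
    by (intro compact_continuous_image continuous_intros element_compact T)
  from compact_imp_bounded[OF this] obtain B where B: "\<forall>y\<in>(\<lambda>x. x - barycenter T) ` T. norm y \<le> B"
    unfolding bounded_iff by auto
  have "T \<inter> space borel \<in> sets borel" using element_borel[OF T] by simp
  then have "local_dilation T \<in> borel_measurable borel"
    unfolding local_dilation_def[abs_def] by (intro measurable_If_set) simp_all
  moreover have "norm (local_dilation T x) \<le> max B 0" for x
    using B by (auto simp: local_dilation_def le_max_iff_disj)
  ultimately have L2: "local_dilation T \<in> L2 \<Omega>"
    using open_\<Omega> bounded_\<Omega> by (intro L2_bounded_borel) auto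
  have "\<exists>c. AE x in lebesgue_on T'. local_dilation T x = c *\<^sub>R (x - barycenter T')" if T': "T' \<in> \<T>" for T'
  proof (cases "T' = T")
    case True
    then show ?thesis using local_dilation_AE[OF T T'] by (intro exI[of _ 1]) simp
  next
    case False
    then show ?thesis using local_dilation_AE[OF T T'] by (intro exI[of _ 0]) simp
  qed
  then show ?thesis using L2 by (simp add: D_space_def)
qed

lemma piece_local_dilation:
  assumes T: "T \<in> \<T>" and T': "T' \<in> \<T>"
  shows "piece (local_dilation T) T' = (\<lambda>x. if T' = T then x - barycenter T else 0)"
  using affine_multiple_P1[of 1 "barycenter T"] local_dilation_AE[OF T T']
  by (intro piece_eqI[OF T']) (cases "T' = T"; simp)+

lemma Q_space_broken: "q \<in> Q_space \<Omega> \<T> \<Longrightarrow> broken q"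
  by (auto simp: Q_space_def broken_def intro: bexI[OF _ P1_const])

lemma Q_space_piece:
  assumes "q \<in> Q_space \<Omega> \<T>" "T \<in> \<T>" shows "piece q T = (\<lambda>_. piece q T 0)"
proof -
  obtain c where "AE x in lebesgue_on T. q x = c" using assms by (auto simp: Q_space_def)
  then have "piece q T = (\<lambda>_. c)" by (intro piece_eqI[OF assms(2) P1_const])
  then show ?thesis by simp
qed

lemma L2_integrable_real:
  fixes q :: "real ^ 'n \<Rightarrow> real"
  assumes "q \<in> L2 \<Omega>" shows "integrable (lebesgue_on \<Omega>) q"
proof -
  have "(\<lambda>_. 1::real) \<in> L2 \<Omega>" using open_\<Omega> bounded_\<Omega> by (intro L2_continuous) auto
  from L2_scaleR_integrable[OF this assms] show ?thesis by simp
qed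

lemma Q_space_comb:
  assumes p: "p \<in> Q_space \<Omega> \<T>" and q: "q \<in> Q_space \<Omega> \<T>"
  shows "(\<lambda>x. p x + c *\<^sub>R q x) \<in> Q_space \<Omega> \<T>"
proof -
  have L: "p \<in> L2 \<Omega>" "q \<in> L2 \<Omega>" using p q by (auto simp: Q_space_def)
  have "(\<integral>x. p x + c *\<^sub>R q x \<partial>lebesgue_on \<Omega>) = 0"
    using L2_integrable_real[OF L(1)] L2_integrable_real[OF L(2)] p q by (simp add: Q_space_def)
  moreover have "\<exists>r. AE x in lebesgue_on T. p x + c *\<^sub>R q x = r" if T: "T \<in> \<T>" for T
  proof -
    obtain r s where r: "AE x in lebesgue_on T. p x = r" and s: "AE x in lebesgue_on T. q x = s"
      using p q T unfolding Q_space_def by blast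
    have "AE x in lebesgue_on T. p x + c *\<^sub>R q x = r + c *\<^sub>R s"
      using r s by eventually_elim simp
    then show ?thesis by blast
  qed
  ultimately show ?thesis using L2_comb(1)[OF L, of c] by (simp add: Q_space_def)
qed

lemma Q_space_zero: "(\<lambda>_. 0) \<in> Q_space \<Omega> \<T>"
  using L2_continuous[OF open_\<Omega> bounded_\<Omega>, of "\<lambda>_. 0::real"] by (auto simp: Q_space_def)

end

section \<open>Velocity reconstruction\<close>

context mesh
begin

text \<open>
  A function that agrees almost everywhere with a continuous one is measurable, as Lebesgue measure is
  complete; this matters where only one side is known to be measurable.
\<close>
lemma integral_element_cong_AE:
  fixes f g :: "real ^ 'n \<Rightarrow> real"
  assumes T: "T \<in> \<T>" and ae: "AE x in lebesgue_on T. f x = g x" and g: "continuous_on UNIV g"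
  shows "(\<integral>x. f x \<partial>lebesgue_on T) = (\<integral>x. g x \<partial>lebesgue_on T)"
proof -
  have TL: "T \<in> sets lebesgue" by (rule element_lebesgue[OF T])
  have "g \<in> borel_measurable lebesgue"
    using borel_measurable_continuous_onI[OF g] by (intro measurable_completion) simp
  then have gm: "(\<lambda>x. indicator T x *\<^sub>R g x) \<in> borel_measurable lebesgue" using TL by simp
  have eq: "AE x in lebesgue. indicator T x *\<^sub>R g x = indicator T x *\<^sub>R f x"
    using ae TL by (simp add: AE_restrict_space_iff) (auto elim!: eventually_mono simp: indicator_def)
  have fm: "(\<lambda>x. indicator T x *\<^sub>R f x) \<in> borel_measurable lebesgue"
    by (rule borel_measurable_AE[OF gm eq])
  have "(\<integral>x. indicator T x *\<^sub>R f x \<partial>lebesgue) = (\<integral>x. indicator T x *\<^sub>R g x \<partial>lebesgue)"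
    by (rule integral_cong_AE[OF fm gm]) (use eq in \<open>auto elim!: eventually_mono\<close>)
  then show ?thesis using TL by (simp add: integral_restrict_space)
qed

lemma facet_obtain:
  assumes "e \<in> facets \<T>"
  obtains T b where "T \<in> \<T>" "e facet_of T" "b \<in> verts T" "e = convex hull (verts T - {b})"
    "full_simplex (verts T)"
  using assms facet_iff_opp verts_simplex(1) unfolding facets_def by blast

lemma integrable_facet:
  fixes h :: "real ^ 'n \<Rightarrow> 'b::{banach, second_countable_topology}"
  assumes "e \<in> facets \<T>" "continuous_on UNIV h" shows "integrable (surface_measure e) h"
  using facet_obtain[OF assms(1)] full_simplex.integrable_surface_measure[OF _ _ assms(2)] by metis

lemma integral_facet_cong:
  fixes h h' :: "real ^ 'n \<Rightarrow> 'b::{banach, second_countable_topology}"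
  assumes e: "e \<in> facets \<T>" and h: "continuous_on UNIV h" "continuous_on UNIV h'"
    and eq: "\<And>x. x \<in> e \<Longrightarrow> h x = h' x"
  shows "(\<integral>x. h x \<partial>surface_measure e) = (\<integral>x. h' x \<partial>surface_measure e)"
proof -
  obtain T b where T: "b \<in> verts T" "e = convex hull (verts T - {b})" "full_simplex (verts T)"
    using facet_obtain[OF e] by blast
  show ?thesis unfolding T(2)
    by (rule full_simplex.integral_surface_cong[OF T(3,1) h]) (use eq T(2) in blast)
qed

lemma facet_zero_if_integral_zero:
  fixes h :: "real ^ 'n \<Rightarrow> real"
  assumes e: "e \<in> facets \<T>" and h: "continuous_on UNIV h" "\<And>x. 0 \<le> h x"
    and 0: "(\<integral>x. h x \<partial>surface_measure e) = 0" and x: "x \<in> e"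
  shows "h x = 0"
proof -
  obtain T b where T: "b \<in> verts T" "e = convex hull (verts T - {b})" "full_simplex (verts T)"
    using facet_obtain[OF e] by blast
  show ?thesis
    by (rule full_simplex.continuous_zero_if_surface_integral_zero[OF T(3,1) h]) (use 0 x T(2) in simp_all)
qed

lemma facet_eq_if_moments_eq:
  fixes f g :: "real ^ 'n \<Rightarrow> real"
  assumes e: "e \<in> facets \<T>" and f: "f \<in> P1" and g: "g \<in> P1"
    and mom: "\<And>p. p \<in> P1 \<Longrightarrow> (\<integral>x. f x * p x \<partial>surface_measure e) = (\<integral>x. g x * p x \<partial>surface_measure e)"
    and x: "x \<in> e"
  shows "f x = g x"
proof -
  obtain T b where T: "b \<in> verts T" "e = convex hull (verts T - {b})" "full_simplex (verts T)"
    using facet_obtain[OF e] by blast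
  show ?thesis
    by (rule full_simplex.eq_if_surface_moments_eq[OF T(3,1) f g]) (use mom x T(2) in simp_all)
qed

lemma surface_measure_facet_pos: "e \<in> facets \<T> \<Longrightarrow> 0 < measure (surface_measure e) UNIV"
  using facet_obtain full_simplex.surface_measure_pos by metis

lemma facet_size_pos: "e \<in> facets \<T> \<Longrightarrow> 0 < facet_size e"
proof -
  assume e: "e \<in> facets \<T>"
  obtain T b where T: "b \<in> verts T" "e = convex hull (verts T - {b})" "full_simplex (verts T)"
    using facet_obtain[OF e] by blast
  then have "0 < measure (surface_measure e) e"
    using full_simplex.measure_facet[OF T(3,1)] surface_measure_facet_pos[OF e] by simp
  then show ?thesis by (simp add: facet_size_def)
qed

lemma facet_normal_sign:
  assumes "T \<in> \<T>" "e facet_of T"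
  shows "facet_normal tp e = outward_normal T e \<or> facet_normal tp e = - outward_normal T e"
  using outward_normal_opposite[OF assms(1) tp_mem[OF facetsI[OF assms]] _ assms(2) tp_facet[OF facetsI[OF assms]]]
  by (cases "T = tp e") (auto simp: facet_normal_def)

lemma tminus_mem: "e \<in> interior_facets \<T> \<Longrightarrow> tminus \<T> tp e \<in> \<T>"
  by (rule interior_facet_elements)

lemma jump_P1:
  assumes "\<And>T. T \<in> \<T> \<Longrightarrow> g T \<in> P1" "e \<in> facets \<T>" shows "jump \<T> tp g e \<in> P1"
  using assms tp_mem[OF assms(2)] tminus_mem[of e]
  unfolding jump_def[abs_def] by (cases "e \<in> interior_facets \<T>") (auto intro: P1_diff)

lemma average_P1:
  assumes "\<And>T. T \<in> \<T> \<Longrightarrow> g T \<in> P1" "e \<in> facets \<T>" shows "average \<T> tp g e \<in> P1"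
proof (cases "e \<in> interior_facets \<T>")
  case True
  have "(\<lambda>x. (1 / 2) *\<^sub>R (g (tp e) x + g (tminus \<T> tp e) x)) \<in> P1"
    by (intro P1_scaleR P1_add assms(1) tp_mem[OF assms(2)] tminus_mem[OF True])
  then show ?thesis using True by (simp add: average_def[abs_def])
next
  case False
  then show ?thesis using assms(1)[OF tp_mem[OF assms(2)]] by (simp add: average_def[abs_def])
qed

lemma jump_comb:
  assumes "\<And>T. T \<in> \<T> \<Longrightarrow> g T x = a T x + c *\<^sub>R b T x" "e \<in> facets \<T>"
  shows "jump \<T> tp g e x = jump \<T> tp a e x + c *\<^sub>R jump \<T> tp b e x"
  using assms(1)[OF tp_mem[OF assms(2)]] assms(1)[OF tminus_mem[of e]]
  by (simp add: jump_def scaleR_diff_right)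

lemma average_comb:
  assumes "\<And>T. T \<in> \<T> \<Longrightarrow> g T x = a T x + c *\<^sub>R b T x" "e \<in> facets \<T>"
  shows "average \<T> tp g e x = average \<T> tp a e x + c *\<^sub>R average \<T> tp b e x"
  using assms(1)[OF tp_mem[OF assms(2)]] assms(1)[OF tminus_mem[of e]]
  by (simp add: average_def scaleR_add_right add_ac)

text \<open>
  The normal component that the reconstruction of \<open>v\<close> has to take on the facet \<open>e\<close>, with respect to the
  fixed normal of the facet. Being affine, it is determined by the prescribed moments.
\<close>
definition flux :: "(real ^ 'n \<Rightarrow> real ^ 'n) \<Rightarrow> (real ^ 'n) set \<Rightarrow> real ^ 'n \<Rightarrow> real" where
  "flux v e x = (if e \<in> interior_facets \<T> then average \<T> tp (piece v) e x \<bullet> facet_normal tp e else 0)"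

lemma flux_P1: "broken v \<Longrightarrow> e \<in> facets \<T> \<Longrightarrow> flux v e \<in> P1"
  unfolding flux_def[abs_def]
  by (cases "e \<in> interior_facets \<T>") (simp_all add: P1_inner average_P1 piece_P1)

lemma flux_comb:
  assumes "broken u" "broken v" "e \<in> facets \<T>"
  shows "flux (\<lambda>x. u x + c *\<^sub>R v x) e x = flux u e x + c * flux v e x"
proof -
  have "average \<T> tp (piece (\<lambda>x. u x + c *\<^sub>R v x)) e x
      = average \<T> tp (piece u) e x + c *\<^sub>R average \<T> tp (piece v) e x"
    by (rule average_comb[OF _ assms(3)]) (simp add: piece_comb[OF assms(1,2)])
  then show ?thesis by (simp add: flux_def inner_add_left)
qed

text \<open>
  The sign converts from the fixed normal of the facet to the outward normal of the element.
\<close>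
definition lift_data :: "(real ^ 'n \<Rightarrow> real ^ 'n) \<Rightarrow> (real ^ 'n) set \<Rightarrow> real ^ 'n \<Rightarrow> real ^ 'n \<Rightarrow> real" where
  "lift_data v T b a =
     (let e = convex hull (verts T - {b}) in (outward_normal T e \<bullet> facet_normal tp e) * flux v e a)"

definition lift_piece :: "(real ^ 'n \<Rightarrow> real ^ 'n) \<Rightarrow> (real ^ 'n) set \<Rightarrow> real ^ 'n \<Rightarrow> real ^ 'n" where
  "lift_piece v T = full_simplex.normal_lift (verts T) (lift_data v T)"

text \<open>
  Where elements meet, several terms of the sum are nonzero, but only on a null set.
\<close>
definition lift :: "(real ^ 'n \<Rightarrow> real ^ 'n) \<Rightarrow> real ^ 'n \<Rightarrow> real ^ 'n" where
  "lift v x = (\<Sum>T\<in>\<T>. indicator T x *\<^sub>R lift_piece v T x)"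

lemma lift_piece_P1: "T \<in> \<T> \<Longrightarrow> lift_piece v T \<in> P1"
  unfolding lift_piece_def by (rule full_simplex.normal_lift_P1[OF verts_simplex(1)])

lemma lift_piece_outward:
  assumes v: "broken v" and T: "T \<in> \<T>" and e: "e facet_of T" and x: "x \<in> e"
  shows "lift_piece v T x \<bullet> outward_normal T e = (outward_normal T e \<bullet> facet_normal tp e) * flux v e x"
proof -
  obtain b where b: "b \<in> verts T" "e = convex hull (verts T - {b})" using e facet_iff_opp[OF T] by blast
  have P: "(\<lambda>x. (outward_normal T e \<bullet> facet_normal tp e) *\<^sub>R flux v e x) \<in> P1"
    by (intro P1_scaleR flux_P1 v facetsI[OF T e])
  have "lift_piece v T x \<bullet> full_simplex.onormal (verts T) b
      = (outward_normal T e \<bullet> facet_normal tp e) *\<^sub>R flux v e x"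
    unfolding lift_piece_def
    by (rule full_simplex.normal_lift_normal_P1[OF verts_simplex(1)[OF T] b(1) _ P])
      (use x b(2) in \<open>simp_all add: lift_data_def Let_def\<close>)
  then show ?thesis using outward_normal_facet[OF T b(1)] b(2) by simp
qed

lemma outward_facet_normal_inner:
  assumes "T \<in> \<T>" "e facet_of T"
  shows "(outward_normal T e \<bullet> facet_normal tp e) *\<^sub>R outward_normal T e = facet_normal tp e"
    and "(outward_normal T e \<bullet> facet_normal tp e)\<^sup>2 = 1"
  using facet_normal_sign[OF assms] norm_outward_normal[OF assms] by (auto simp: norm_eq_1)

lemma lift_piece_normal:
  assumes v: "broken v" and T: "T \<in> \<T>" and e: "e facet_of T" and x: "x \<in> e"
  shows "lift_piece v T x \<bullet> facet_normal tp e = flux v e x"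
proof -
  let ?s = "outward_normal T e \<bullet> facet_normal tp e"
  have "lift_piece v T x \<bullet> facet_normal tp e = ?s * (lift_piece v T x \<bullet> outward_normal T e)"
    using outward_facet_normal_inner(1)[OF T e] by (metis inner_scaleR_right)
  also have "\<dots> = ?s\<^sup>2 * flux v e x" by (simp add: lift_piece_outward[OF assms] power2_eq_square)
  finally show ?thesis using outward_facet_normal_inner(2)[OF T e] by simp
qed

lemma lift_AE:
  assumes T: "T \<in> \<T>" shows "AE x in lebesgue_on T. lift v x = lift_piece v T x"
proof -
  have "AE x in lebesgue_on T. \<forall>T'\<in>\<T>. T' \<noteq> T \<longrightarrow> x \<notin> T'"
    using AE_outside_other[OF _ T] by (intro AE_finite_allI) (auto intro: AE_I2)
  moreover have "AE x in lebesgue_on T. x \<in> T" by (rule AE_I2) (simp add: space_restrict_space)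
  ultimately show ?thesis
  proof eventually_elim
    case (elim x)
    have "lift v x = indicator T x *\<^sub>R lift_piece v T x + (\<Sum>T'\<in>\<T> - {T}. indicator T' x *\<^sub>R lift_piece v T' x)"
      unfolding lift_def by (rule sum.remove[OF finite_\<T> T])
    also have "(\<Sum>T'\<in>\<T> - {T}. indicator T' x *\<^sub>R lift_piece v T' x) = 0"
      using elim(1) by (intro sum.neutral) auto
    finally show ?case using elim(2) by simp
  qed
qed

lemma piecewise_L2:
  fixes p :: "(real ^ 'n) set \<Rightarrow> real ^ 'n \<Rightarrow> 'b::euclidean_space"
  assumes p: "\<And>T. T \<in> \<T> \<Longrightarrow> continuous_on UNIV (p T)"
  shows "(\<lambda>x. \<Sum>T\<in>\<T>. indicator T x *\<^sub>R p T x) \<in> L2 \<Omega>"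
proof -
  have meas: "(\<lambda>x. \<Sum>T\<in>\<T>. indicator T x *\<^sub>R p T x) \<in> borel_measurable borel"
    using element_borel borel_measurable_continuous_onI[OF p]
    by (intro borel_measurable_sum borel_measurable_scaleR borel_measurable_indicator) auto
  have "\<exists>B. \<forall>x\<in>T. norm (p T x) \<le> B" if T: "T \<in> \<T>" for T
  proof -
    have "compact (p T ` T)"
      by (rule compact_continuous_image[OF continuous_on_subset[OF p[OF T] subset_UNIV] element_compact[OF T]])
    from compact_imp_bounded[OF this] show ?thesis unfolding bounded_iff by auto
  qed
  then obtain B where B: "\<And>T x. T \<in> \<T> \<Longrightarrow> x \<in> T \<Longrightarrow> norm (p T x) \<le> B T" by metis
  have "norm (\<Sum>T\<in>\<T>. indicator T x *\<^sub>R p T x) \<le> (\<Sum>T\<in>\<T>. max 0 (B T))" for x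
  proof (rule sum_norm_le)
    show "norm (indicator T x *\<^sub>R p T x) \<le> max 0 (B T)" if "T \<in> \<T>" for T
      using B[OF that, of x] by (auto simp: indicator_def)
  qed
  then show ?thesis using open_\<Omega> bounded_\<Omega> by (intro L2_bounded_borel[OF _ _ meas]) auto
qed

text \<open>
  On an interior facet the contributions of the two elements carry opposite signs; on a boundary facet
  the prescribed flux is zero.
\<close>
lemma lift_flux_cancel:
  assumes v: "broken v" and \<phi>: "continuous_on UNIV \<phi>"
  shows "(\<Sum>T\<in>\<T>. \<Sum>e | e facet_of T. \<integral>x. \<phi> x * (lift_piece v T x \<bullet> outward_normal T e) \<partial>surface_measure e) = 0"
proof -
  let ?s = "\<lambda>T e. outward_normal T e \<bullet> facet_normal tp e"
  have c: "continuous_on UNIV (lift_piece v T)" if "T \<in> \<T>" for T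
    by (rule P1_continuous_on[OF lift_piece_P1[OF that]])
  have cf: "continuous_on UNIV (flux v e)" if "e \<in> facets \<T>" for e
    by (rule P1_continuous_on[OF flux_P1[OF v that]])
  have term1: "(\<integral>x. \<phi> x * (lift_piece v T x \<bullet> outward_normal T e) \<partial>surface_measure e)
      = ?s T e * (\<integral>x. \<phi> x * flux v e x \<partial>surface_measure e)" if T: "T \<in> \<T>" and e: "e facet_of T" for T e
  proof -
    have ef: "e \<in> facets \<T>" by (rule facetsI[OF T e])
    have "(\<integral>x. \<phi> x * (lift_piece v T x \<bullet> outward_normal T e) \<partial>surface_measure e)
        = (\<integral>x. ?s T e * (\<phi> x * flux v e x) \<partial>surface_measure e)"
      by (rule integral_facet_cong[OF ef])
        (use lift_piece_outward[OF v T e] in \<open>auto intro!: continuous_intros \<phi> c cf T ef\<close>)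
    then show ?thesis by simp
  qed
  have "(\<Sum>T\<in>\<T>. \<Sum>e | e facet_of T. \<integral>x. \<phi> x * (lift_piece v T x \<bullet> outward_normal T e) \<partial>surface_measure e)
      = (\<Sum>T\<in>\<T>. \<Sum>e | e facet_of T. ?s T e * (\<integral>x. \<phi> x * flux v e x \<partial>surface_measure e))"
    by (intro sum.cong refl term1) auto
  also have "\<dots> = (\<Sum>e\<in>facets \<T>. \<Sum>T | T \<in> \<T> \<and> e facet_of T. ?s T e * (\<integral>x. \<phi> x * flux v e x \<partial>surface_measure e))"
    by (rule sum_facets_swap[symmetric])
  also have "\<dots> = 0"
  proof (rule sum.neutral, rule ballI)
    fix e assume e: "e \<in> facets \<T>"
    show "(\<Sum>T | T \<in> \<T> \<and> e facet_of T. ?s T e * (\<integral>x. \<phi> x * flux v e x \<partial>surface_measure e)) = 0"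
    proof (cases "e \<in> interior_facets \<T>")
      case True
      show ?thesis unfolding interior_facet_elements(4)[OF True]
        using interior_facet_elements(3)[OF True] facet_normal_tminus[OF True] by (simp add: facet_normal_def)
    next
      case False
      then show ?thesis by (simp add: flux_def)
    qed
  qed
  finally show ?thesis .
qed

text \<open>
  Green's formula on each element turns the pairing with the gradient of a test function into the
  elementwise divergence plus facet terms, which add up to zero by \<open>lift_flux_cancel\<close>.
\<close>
lemma lift_Hdiv:
  assumes v: "broken v" shows "lift v \<in> Hdiv \<Omega>"
proof -
  define dv where "dv T = full_simplex.normal_lift_div (verts T) (lift_data v T)" for T
  define g where "g x = (\<Sum>T\<in>\<T>. indicator T x *\<^sub>R dv T)" for x :: "real ^ 'n"
  have c: "continuous_on UNIV (lift_piece v T)" if "T \<in> \<T>" for T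
    by (rule P1_continuous_on[OF lift_piece_P1[OF that]])
  have L: "lift v \<in> L2 \<Omega>" unfolding lift_def[abs_def] by (rule piecewise_L2[OF c])
  have Lg: "g \<in> L2 \<Omega>" unfolding g_def[abs_def] by (rule piecewise_L2) simp
  have "weak_divergence \<Omega> (lift v) g" unfolding weak_divergence_def
  proof
    fix \<phi> assume \<phi>: "\<phi> \<in> test_functions \<Omega>"
    note c\<phi> = test_function_continuous[OF \<phi>] and cg = test_function_grad_continuous[OF \<phi>]
    have int1: "integrable lborel (\<lambda>x. indicator T x * (lift_piece v T x \<bullet> grad \<phi> x))"
      and int2: "integrable lborel (\<lambda>x. indicator T x * \<phi> x)" if T: "T \<in> \<T>" for T
    proof -
      have "continuous_on UNIV (\<lambda>x. lift_piece v T x \<bullet> grad \<phi> x)" by (intro continuous_intros c T cg)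
      then show "integrable lborel (\<lambda>x. indicator T x * (lift_piece v T x \<bullet> grad \<phi> x))"
        using full_simplex.integrable_simplex[OF verts_simplex(1)[OF T]] by (simp add: verts_simplex(2)[OF T])
      show "integrable lborel (\<lambda>x. indicator T x * \<phi> x)"
        using full_simplex.integrable_simplex[OF verts_simplex(1)[OF T] c\<phi>] by (simp add: verts_simplex(2)[OF T])
    qed
    have green: "(\<integral>x. indicator T x * (lift_piece v T x \<bullet> grad \<phi> x) \<partial>lborel)
        = (\<Sum>e | e facet_of T. \<integral>x. \<phi> x * (lift_piece v T x \<bullet> outward_normal T e) \<partial>surface_measure e)
          - dv T * (\<integral>x. indicator T x * \<phi> x \<partial>lborel)" if T: "T \<in> \<T>" for T
      using full_simplex.normal_lift_green[OF verts_simplex(1)[OF T] test_function_has_grad[OF \<phi>] cg, of "lift_data v T"]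
      unfolding sum_facets_of[OF T]
      by (simp add: outward_normal_facet[OF T] lift_piece_def[symmetric] dv_def[symmetric] verts_simplex(2)[OF T])
    have meas: "(\<lambda>x. lift v x \<bullet> grad \<phi> x) \<in> borel_measurable borel" "(\<lambda>x. g x * \<phi> x) \<in> borel_measurable borel"
      unfolding lift_def g_def
      using element_borel borel_measurable_continuous_onI[OF c] borel_measurable_continuous_onI[OF cg]
        borel_measurable_continuous_onI[OF c\<phi>]
      by (intro borel_measurable_sum borel_measurable_scaleR borel_measurable_indicator borel_measurable_inner
          borel_measurable_times borel_measurable_const; simp)+
    have \<Omega>b: "\<Omega> \<in> sets borel" using open_\<Omega> by simp
    have "(\<integral>x. lift v x \<bullet> grad \<phi> x \<partial>lebesgue_on \<Omega>) = (\<integral>x. indicator \<Omega> x *\<^sub>R (lift v x \<bullet> grad \<phi> x) \<partial>lborel)"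
      by (rule integral_lebesgue_on_borel[OF \<Omega>b meas(1)])
    also have "\<dots> = (\<integral>x. (\<Sum>T\<in>\<T>. indicator T x * (lift_piece v T x \<bullet> grad \<phi> x)) \<partial>lborel)"
      by (intro Bochner_Integration.integral_cong refl)
        (auto simp: indicator_def[of \<Omega>] test_function_outside(2)[OF \<phi>] lift_def inner_sum_left)
    also have "\<dots> = (\<Sum>T\<in>\<T>. \<integral>x. indicator T x * (lift_piece v T x \<bullet> grad \<phi> x) \<partial>lborel)"
      by (rule Bochner_Integration.integral_sum[OF int1])
    also have "\<dots> = - (\<Sum>T\<in>\<T>. dv T * (\<integral>x. indicator T x * \<phi> x \<partial>lborel))"
      using lift_flux_cancel[OF v c\<phi>] by (simp add: green sum_subtractf)
    also have "(\<Sum>T\<in>\<T>. dv T * (\<integral>x. indicator T x * \<phi> x \<partial>lborel)) = (\<integral>x. (\<Sum>T\<in>\<T>. dv T * (indicator T x * \<phi> x)) \<partial>lborel)"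
      using int2 by (subst Bochner_Integration.integral_sum) auto
    also have "\<dots> = (\<integral>x. indicator \<Omega> x *\<^sub>R (g x * \<phi> x) \<partial>lborel)"
    proof (intro Bochner_Integration.integral_cong refl)
      fix x
      have "(\<Sum>T\<in>\<T>. dv T * (indicator T x * \<phi> x)) = g x * \<phi> x"
        unfolding g_def sum_distrib_right by (intro sum.cong refl) simp
      then show "(\<Sum>T\<in>\<T>. dv T * (indicator T x * \<phi> x)) = indicator \<Omega> x *\<^sub>R (g x * \<phi> x)"
        using test_function_outside(1)[OF \<phi>, of x] by (cases "x \<in> \<Omega>") simp_all
    qed
    also have "\<dots> = (\<integral>x. g x * \<phi> x \<partial>lebesgue_on \<Omega>)"
      by (rule integral_lebesgue_on_borel[OF \<Omega>b meas(2), symmetric])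
    finally show "(\<integral>x. lift v x \<bullet> grad \<phi> x \<partial>lebesgue_on \<Omega>) = - (\<integral>x. g x * \<phi> x \<partial>lebesgue_on \<Omega>)" .
  qed
  then show ?thesis using L Lg by (auto simp: Hdiv_def)
qed

lemma piece_lift: "T \<in> \<T> \<Longrightarrow> piece (lift v) T = lift_piece v T"
  by (intro piece_eqI lift_piece_P1 lift_AE)

lemma lift_is_reconstruction:
  assumes v: "broken v" shows "is_reconstruction \<Omega> \<T> tp v (lift v)"
  unfolding is_reconstruction_def
proof (intro conjI ballI impI)
  have "\<exists>p\<in>P1. AE x in lebesgue_on T. lift v x = p x" if "T \<in> \<T>" for T
    using lift_AE[OF that] lift_piece_P1[OF that] by (rule bexI)
  then show "lift v \<in> BDM1 \<Omega> \<T>"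
    using lift_Hdiv[OF v] by (simp add: BDM1_def)
next
  have c: "continuous_on UNIV (lift_piece v T)" if "T \<in> \<T>" for T
    by (rule P1_continuous_on[OF lift_piece_P1[OF that]])
  have mom: "(\<integral>x. (piece (lift v) T x \<bullet> facet_normal tp e) * p1 x \<partial>surface_measure e)
      = (\<integral>x. flux v e x * p1 x \<partial>surface_measure e)" if T: "T \<in> \<T>" and e: "e facet_of T" and p: "p1 \<in> P1"
    for T e p1
    unfolding piece_lift[OF T]
  proof (rule integral_facet_cong[OF facetsI[OF T e]])
    show "continuous_on UNIV (\<lambda>x. (lift_piece v T x \<bullet> facet_normal tp e) * p1 x)"
      by (intro continuous_intros c T P1_continuous_on[OF p])
    show "continuous_on UNIV (\<lambda>x. flux v e x * p1 x)"
      by (intro continuous_intros P1_continuous_on[OF p] P1_continuous_on[OF flux_P1[OF v facetsI[OF T e]]])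
  qed (simp add: lift_piece_normal[OF v T e])
  show "(\<integral>x. (piece (lift v) T x \<bullet> facet_normal tp e) * p1 x \<partial>surface_measure e)
      = (\<integral>x. (average \<T> tp (piece v) e x \<bullet> facet_normal tp e) * p1 x \<partial>surface_measure e)"
    if "e \<in> interior_facets \<T>" "T \<in> \<T>" "e facet_of T" "p1 \<in> P1" for e T p1
    using mom[OF that(2-4)] that(1) by (simp add: flux_def)
  show "(\<integral>x. (piece (lift v) (tp e) x \<bullet> facet_normal tp e) * p1 x \<partial>surface_measure e) = 0"
    if "e \<in> boundary_facets \<T>" "p1 \<in> P1" for e p1
  proof -
    have "e \<in> facets \<T>" "e \<notin> interior_facets \<T>" using that(1) by (auto simp: boundary_facets_def)
    then show ?thesis using mom[OF tp_mem tp_facet that(2)] by (simp add: flux_def)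
  qed
qed

abbreviation R :: "(real ^ 'n \<Rightarrow> real ^ 'n) \<Rightarrow> real ^ 'n \<Rightarrow> real ^ 'n" where
  "R v \<equiv> reconstruction \<Omega> \<T> tp v"

text \<open>
  The explicit lift shows that reconstructions exist, so the chosen one has the defining properties.
\<close>
lemma reconstruction: "broken v \<Longrightarrow> is_reconstruction \<Omega> \<T> tp v (R v)"
  unfolding reconstruction_def by (rule someI[where P = "is_reconstruction \<Omega> \<T> tp v", OF lift_is_reconstruction])

lemma reconstruction_broken: "broken v \<Longrightarrow> broken (R v)"
  and reconstruction_L2: "broken v \<Longrightarrow> R v \<in> L2 \<Omega>"
  using reconstruction[of v] by (auto simp: is_reconstruction_def BDM1_def Hdiv_def broken_def)

text \<open>
  Both sides are affine on the facet, and an affine function is determined by its moments against affine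
  functions.
\<close>
lemma reconstruction_normal:
  assumes v: "broken v" and T: "T \<in> \<T>" and e: "e facet_of T" and x: "x \<in> e"
  shows "piece (R v) T x \<bullet> facet_normal tp e = flux v e x"
proof (rule facet_eq_if_moments_eq[OF facetsI[OF T e] _ flux_P1[OF v facetsI[OF T e]] _ x])
  show "(\<lambda>x. piece (R v) T x \<bullet> facet_normal tp e) \<in> P1"
    by (intro P1_inner piece_P1 reconstruction_broken v T)
  fix p :: "real ^ 'n \<Rightarrow> real" assume p: "p \<in> P1"
  show "(\<integral>x. (piece (R v) T x \<bullet> facet_normal tp e) * p x \<partial>surface_measure e) = (\<integral>x. flux v e x * p x \<partial>surface_measure e)"
  proof (cases "e \<in> interior_facets \<T>")
    case True
    then show ?thesis using reconstruction[OF v] T e p by (simp add: is_reconstruction_def flux_def)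
  next
    case False
    then have "e \<in> boundary_facets \<T>" using facetsI[OF T e] by (simp add: boundary_facets_def)
    moreover have "T = tp e" using boundary_facet_elements[OF facetsI[OF T e] False] T e by blast
    ultimately show ?thesis using reconstruction[OF v] p False by (simp add: is_reconstruction_def flux_def)
  qed
qed

lemma element_zero_if_normals_zero:
  assumes T: "T \<in> \<T>" and w: "w \<in> P1"
    and zero: "\<And>e x. e facet_of T \<Longrightarrow> x \<in> e \<Longrightarrow> w x \<bullet> facet_normal tp e = 0"
  shows "w = (\<lambda>_. 0)"
proof (rule full_simplex.zero_if_normal_components_zero[OF verts_simplex(1)[OF T] w])
  fix b x assume b: "b \<in> verts T" and x: "x \<in> convex hull (verts T - {b})"
  let ?e = "convex hull (verts T - {b})"
  have e: "?e facet_of T" using facet_iff_opp[OF T] b by blast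
  have "w x \<bullet> outward_normal T ?e = 0"
    using zero[OF e x] facet_normal_sign[OF T e] by auto
  then show "w x \<bullet> full_simplex.onormal (verts T) b = 0" using outward_normal_facet[OF T b] by simp
qed

text \<open>
  Normal components on all facets determine an affine field, so the choice made in the definition of the
  reconstruction affects neither its pieces nor their linear dependence on the argument.
\<close>
lemma piece_reconstruction_comb:
  assumes u: "broken u" and v: "broken v" and T: "T \<in> \<T>"
  shows "piece (R (\<lambda>x. u x + c *\<^sub>R v x)) T = (\<lambda>x. piece (R u) T x + c *\<^sub>R piece (R v) T x)"
proof -
  let ?w = "\<lambda>x. u x + c *\<^sub>R v x"
  have w: "broken ?w" by (rule broken_comb[OF u v])
  have P: "(\<lambda>x. piece (R ?w) T x - (piece (R u) T x + c *\<^sub>R piece (R v) T x)) \<in> P1"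
    by (intro P1_diff P1_add P1_scaleR piece_P1 reconstruction_broken u v w T)
  have "(\<lambda>x. piece (R ?w) T x - (piece (R u) T x + c *\<^sub>R piece (R v) T x)) = (\<lambda>_. 0)"
  proof (rule element_zero_if_normals_zero[OF T P])
    fix e x assume e: "e facet_of T" and x: "x \<in> e"
    show "(piece (R ?w) T x - (piece (R u) T x + c *\<^sub>R piece (R v) T x)) \<bullet> facet_normal tp e = 0"
      by (simp add: inner_diff_left inner_add_left reconstruction_normal[OF w T e x] reconstruction_normal[OF u T e x]
          reconstruction_normal[OF v T e x] flux_comb[OF u v facetsI[OF T e]])
  qed
  then show ?thesis by (simp add: fun_eq_iff)
qed

lemma piece_reconstruction_zero:
  assumes v: "broken v" and zero: "\<And>T. T \<in> \<T> \<Longrightarrow> piece v T = (\<lambda>_. 0)" and T: "T \<in> \<T>"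
  shows "piece (R v) T = (\<lambda>_. 0)"
proof (rule element_zero_if_normals_zero[OF T piece_P1[OF reconstruction_broken[OF v] T]])
  fix e x assume e: "e facet_of T" and x: "x \<in> e"
  have "flux v e x = 0"
    using zero[OF tp_mem[OF facetsI[OF T e]]] zero[OF tminus_mem[of e]] by (simp add: flux_def average_def)
  then show "piece (R v) T x \<bullet> facet_normal tp e = 0" using reconstruction_normal[OF v T e x] by simp
qed

end

section \<open>The bilinear forms\<close>

lemma P1_has_derivative:
  fixes p :: "'a::euclidean_space \<Rightarrow> 'b::euclidean_space"
  assumes "p \<in> P1" shows "(p has_derivative (\<lambda>h. p h - p 0)) (at x)"
proof -
  have "linear (\<lambda>h. p h - p 0)" using assms by (simp add: P1_iff_linear)
  then have "((\<lambda>h. p h - p 0) has_derivative (\<lambda>h. p h - p 0)) (at x)"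
    by (rule linear_imp_has_derivative)
  from has_derivative_add[OF this has_derivative_const[of "p 0"]] show ?thesis by simp
qed

lemma jacobian_P1:
  fixes p :: "real ^ 'n \<Rightarrow> real ^ 'm"
  assumes p: "p \<in> P1" shows "jacobian p (at x) = matrix (\<lambda>h. p h - p 0)"
proof -
  show ?thesis unfolding jacobian_def frechet_derivative_at[OF P1_has_derivative[OF p], symmetric] ..
qed

text \<open>
  All terms of the three forms are sums of integrals that are linear in one argument in this sense.
\<close>
lemma sum_integral_comb:
  fixes f g h :: "'i \<Rightarrow> 'a \<Rightarrow> real"
  assumes "\<And>i x. i \<in> I \<Longrightarrow> h i x = f i x + c * g i x"
    and "\<And>i. i \<in> I \<Longrightarrow> integrable (M i) (f i)" "\<And>i. i \<in> I \<Longrightarrow> integrable (M i) (g i)"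
  shows "(\<Sum>i\<in>I. \<integral>x. h i x \<partial>M i) = (\<Sum>i\<in>I. \<integral>x. f i x \<partial>M i) + c * (\<Sum>i\<in>I. \<integral>x. g i x \<partial>M i)"
proof -
  have "(\<Sum>i\<in>I. \<integral>x. h i x \<partial>M i) = (\<Sum>i\<in>I. (\<integral>x. f i x \<partial>M i) + c * (\<integral>x. g i x \<partial>M i))"
  proof (intro sum.cong refl)
    fix i assume i: "i \<in> I"
    have "(\<integral>x. h i x \<partial>M i) = (\<integral>x. f i x + c * g i x \<partial>M i)" using assms(1)[OF i] by simp
    also have "\<dots> = (\<integral>x. f i x \<partial>M i) + c * (\<integral>x. g i x \<partial>M i)" using assms(2,3)[OF i] by simp
    finally show "(\<integral>x. h i x \<partial>M i) = (\<integral>x. f i x \<partial>M i) + c * (\<integral>x. g i x \<partial>M i)" .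
  qed
  then show ?thesis by (simp add: sum.distrib sum_distrib_left)
qed

lemma norm_matrix_vector_le:
  fixes A :: "real ^ 'n ^ 'm" shows "norm (A *v n) \<le> norm A * norm n"
proof (rule power2_le_imp_le)
  have "(norm (A *v n))\<^sup>2 = (\<Sum>i\<in>UNIV. (A $ i \<bullet> n)\<^sup>2)"
    unfolding power2_norm_eq_inner
    by (subst inner_vec_def) (simp add: matrix_vector_mul_component power2_eq_square)
  also have "\<dots> \<le> (\<Sum>i\<in>UNIV. (A $ i \<bullet> A $ i) * (n \<bullet> n))" by (intro sum_mono Cauchy_Schwarz_ineq)
  also have "\<dots> = (norm A * norm n)\<^sup>2"
    unfolding power_mult_distrib power2_norm_eq_inner inner_vec_def[of A] sum_distrib_right ..
  finally show "(norm (A *v n))\<^sup>2 \<le> (norm A * norm n)\<^sup>2" .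
qed simp

text \<open>
  Young's inequality with weight \<open>t\<close>.
\<close>
lemma two_inner_le:
  fixes a b :: "'a::real_inner"
  assumes t: "t > 0" shows "2 * (a \<bullet> b) \<le> t * (norm a)\<^sup>2 + inverse t * (norm b)\<^sup>2"
proof -
  have "0 \<le> inverse t * (norm (t *\<^sub>R a - b))\<^sup>2" using t by simp
  also have "\<dots> = t * (norm a)\<^sup>2 + inverse t * (norm b)\<^sup>2 - 2 * (a \<bullet> b)"
    using t by (simp add: power2_norm_eq_inner inner_diff_left inner_diff_right inner_commute field_simps)
  finally show ?thesis by simp
qed

context mesh
begin

lemma elem_grad_const: "broken v \<Longrightarrow> T \<in> \<T> \<Longrightarrow> elem_grad v T x = elem_grad v T 0"
  by (simp add: elem_grad_def jacobian_P1[OF piece_P1])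

lemma elem_grad_comb:
  assumes u: "broken u" and v: "broken v" and T: "T \<in> \<T>"
  shows "elem_grad (\<lambda>x. u x + c *\<^sub>R v x) T x = elem_grad u T x + c *\<^sub>R elem_grad v T x"
  unfolding elem_grad_def jacobian_P1[OF piece_P1[OF u T]] jacobian_P1[OF piece_P1[OF v T]]
    piece_comb[OF u v T] jacobian_P1[OF P1_add[OF piece_P1[OF u T] P1_scaleR[OF piece_P1[OF v T]]]]
  by (simp add: matrix_def vec_eq_iff algebra_simps)

lemma elem_div_comb:
  assumes u: "broken u" and v: "broken v" and T: "T \<in> \<T>"
  shows "elem_div (\<lambda>x. u x + c *\<^sub>R v x) T x = elem_div u T x + c * elem_div v T x"
  by (simp add: elem_div_def elem_grad_comb[OF assms] trace_def sum.distrib sum_distrib_left)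

abbreviation avg_flux :: "(real ^ 'n \<Rightarrow> real ^ 'n) \<Rightarrow> (real ^ 'n) set \<Rightarrow> real ^ 'n \<Rightarrow> real ^ 'n" where
  "avg_flux v e x \<equiv> average \<T> tp (elem_grad v) e x *v facet_normal tp e"

lemma average_grad_const:
  assumes v: "broken v" and e: "e \<in> facets \<T>"
  shows "average \<T> tp (elem_grad v) e x = average \<T> tp (elem_grad v) e 0"
  using elem_grad_const[OF v tp_mem[OF e], of x] elem_grad_const[OF v tminus_mem, of e x]
  by (simp add: average_def)

lemma avg_flux_continuous: "broken v \<Longrightarrow> e \<in> facets \<T> \<Longrightarrow> continuous_on UNIV (avg_flux v e)"
  by (subst average_grad_const) simp_all

lemma elem_grad_continuous: "broken v \<Longrightarrow> T \<in> \<T> \<Longrightarrow> continuous_on UNIV (elem_grad v T)"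
proof -
  assume v: "broken v" and T: "T \<in> \<T>"
  have "elem_grad v T = (\<lambda>_. elem_grad v T 0)" by (rule ext) (rule elem_grad_const[OF v T])
  then show ?thesis by (metis continuous_on_const)
qed

lemma jump_continuous:
  fixes v :: "real ^ 'n \<Rightarrow> 'b::euclidean_space"
  shows "broken v \<Longrightarrow> e \<in> facets \<T> \<Longrightarrow> continuous_on UNIV (jump \<T> tp (piece v) e)"
  by (intro P1_continuous_on jump_P1 piece_P1)

lemma average_continuous:
  fixes v :: "real ^ 'n \<Rightarrow> 'b::euclidean_space"
  shows "broken v \<Longrightarrow> e \<in> facets \<T> \<Longrightarrow> continuous_on UNIV (average \<T> tp (piece v) e)"
  by (intro P1_continuous_on average_P1 piece_P1)

lemma jump_piece_comb:
  fixes u v :: "real ^ 'n \<Rightarrow> 'b::euclidean_space"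
  assumes "broken u" "broken v" "e \<in> facets \<T>"
  shows "jump \<T> tp (piece (\<lambda>x. u x + c *\<^sub>R v x)) e x = jump \<T> tp (piece u) e x + c *\<^sub>R jump \<T> tp (piece v) e x"
  by (rule jump_comb[OF _ assms(3)]) (simp add: piece_comb[OF assms(1,2)])

lemma average_piece_comb:
  fixes u v :: "real ^ 'n \<Rightarrow> 'b::euclidean_space"
  assumes "broken u" "broken v" "e \<in> facets \<T>"
  shows "average \<T> tp (piece (\<lambda>x. u x + c *\<^sub>R v x)) e x = average \<T> tp (piece u) e x + c *\<^sub>R average \<T> tp (piece v) e x"
  by (rule average_comb[OF _ assms(3)]) (simp add: piece_comb[OF assms(1,2)])

lemma avg_flux_comb:
  assumes "broken u" "broken v" "e \<in> facets \<T>"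
  shows "avg_flux (\<lambda>x. u x + c *\<^sub>R v x) e x = avg_flux u e x + c *\<^sub>R avg_flux v e x"
proof -
  have "average \<T> tp (elem_grad (\<lambda>x. u x + c *\<^sub>R v x)) e x
      = average \<T> tp (elem_grad u) e x + c *\<^sub>R average \<T> tp (elem_grad v) e x"
    by (rule average_comb[OF _ assms(3)]) (simp add: elem_grad_comb[OF assms(1,2)])
  then show ?thesis by (simp add: matrix_vector_mult_add_rdistrib scaleR_matrix_vector_assoc)
qed

lemma form_a_comb:
  assumes u: "broken u" and v: "broken v" and w: "broken w"
  shows "form_a \<T> tp \<rho> (\<lambda>x. u x + c *\<^sub>R v x) w = form_a \<T> tp \<rho> u w + c * form_a \<T> tp \<rho> v w"
proof -
  note cont = continuous_intros elem_grad_continuous jump_continuous avg_flux_continuous u v w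
  let ?z = "\<lambda>x. u x + c *\<^sub>R v x"
  have 1: "(\<Sum>T\<in>\<T>. \<integral>x. elem_grad ?z T x \<bullet> elem_grad w T x \<partial>lebesgue_on T)
      = (\<Sum>T\<in>\<T>. \<integral>x. elem_grad u T x \<bullet> elem_grad w T x \<partial>lebesgue_on T)
        + c * (\<Sum>T\<in>\<T>. \<integral>x. elem_grad v T x \<bullet> elem_grad w T x \<partial>lebesgue_on T)"
    by (rule sum_integral_comb)
      (simp add: elem_grad_comb[OF u v] inner_add_left, (intro integrable_element cont; assumption)+)
  have 2: "(\<Sum>e\<in>facets \<T>. \<integral>x. avg_flux ?z e x \<bullet> jump \<T> tp (piece w) e x \<partial>surface_measure e)
      = (\<Sum>e\<in>facets \<T>. \<integral>x. avg_flux u e x \<bullet> jump \<T> tp (piece w) e x \<partial>surface_measure e)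
        + c * (\<Sum>e\<in>facets \<T>. \<integral>x. avg_flux v e x \<bullet> jump \<T> tp (piece w) e x \<partial>surface_measure e)"
    by (rule sum_integral_comb)
      (simp add: avg_flux_comb[OF u v] inner_add_left, (intro integrable_facet cont; assumption)+)
  have 3: "(\<Sum>e\<in>facets \<T>. \<integral>x. avg_flux w e x \<bullet> jump \<T> tp (piece ?z) e x \<partial>surface_measure e)
      = (\<Sum>e\<in>facets \<T>. \<integral>x. avg_flux w e x \<bullet> jump \<T> tp (piece u) e x \<partial>surface_measure e)
        + c * (\<Sum>e\<in>facets \<T>. \<integral>x. avg_flux w e x \<bullet> jump \<T> tp (piece v) e x \<partial>surface_measure e)"
    by (rule sum_integral_comb)
      (simp add: jump_piece_comb[OF u v] inner_add_right, (intro integrable_facet cont; assumption)+)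
  have 4: "(\<Sum>e\<in>facets \<T>. \<integral>x. inverse (facet_size e) *
        (jump \<T> tp (piece w) e x \<bullet> jump \<T> tp (piece ?z) e x) \<partial>surface_measure e)
      = (\<Sum>e\<in>facets \<T>. \<integral>x. inverse (facet_size e) *
          (jump \<T> tp (piece w) e x \<bullet> jump \<T> tp (piece u) e x) \<partial>surface_measure e)
        + c * (\<Sum>e\<in>facets \<T>. \<integral>x. inverse (facet_size e) *
          (jump \<T> tp (piece w) e x \<bullet> jump \<T> tp (piece v) e x) \<partial>surface_measure e)"
    by (rule sum_integral_comb)
      (simp add: jump_piece_comb[OF u v] inner_add_right algebra_simps, (intro integrable_facet cont; assumption)+)
  show ?thesis unfolding form_a_def 1 2 3 4 by (simp add: algebra_simps)
qed

lemma form_a_sym: "form_a \<T> tp \<rho> u v = form_a \<T> tp \<rho> v u"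
  unfolding form_a_def by (simp add: inner_commute)

lemma form_c_eq:
  assumes u: "broken u" and v: "broken v"
  shows "form_c \<Omega> \<T> tp \<rho> u v
    = (\<Sum>T\<in>\<T>. \<integral>x. piece (R u) T x \<bullet> piece (R v) T x \<partial>lebesgue_on T)
      + \<rho> * (\<Sum>e\<in>facets \<T>. \<integral>x. facet_size e *
          (jump \<T> tp (piece v) e x \<bullet> jump \<T> tp (piece u) e x) \<partial>surface_measure e)"
proof -
  have "(\<integral>x. R u x \<bullet> R v x \<partial>lebesgue_on T) = (\<integral>x. piece (R u) T x \<bullet> piece (R v) T x \<partial>lebesgue_on T)"
    if T: "T \<in> \<T>" for T
  proof (rule integral_element_cong_AE[OF T])
    show "AE x in lebesgue_on T. R u x \<bullet> R v x = piece (R u) T x \<bullet> piece (R v) T x"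
      using piece_AE[OF reconstruction_broken[OF u] T] piece_AE[OF reconstruction_broken[OF v] T]
      by eventually_elim simp
    show "continuous_on UNIV (\<lambda>x. piece (R u) T x \<bullet> piece (R v) T x)"
      by (intro continuous_intros P1_continuous_on piece_P1 reconstruction_broken u v T)
  qed
  then show ?thesis by (simp add: form_c_def)
qed

lemma form_c_comb:
  assumes u: "broken u" and v: "broken v" and w: "broken w"
  shows "form_c \<Omega> \<T> tp \<rho> (\<lambda>x. u x + c *\<^sub>R v x) w = form_c \<Omega> \<T> tp \<rho> u w + c * form_c \<Omega> \<T> tp \<rho> v w"
proof -
  have 1: "(\<Sum>T\<in>\<T>. \<integral>x. piece (R (\<lambda>x. u x + c *\<^sub>R v x)) T x \<bullet> piece (R w) T x \<partial>lebesgue_on T)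
      = (\<Sum>T\<in>\<T>. \<integral>x. piece (R u) T x \<bullet> piece (R w) T x \<partial>lebesgue_on T)
        + c * (\<Sum>T\<in>\<T>. \<integral>x. piece (R v) T x \<bullet> piece (R w) T x \<partial>lebesgue_on T)"
    by (rule sum_integral_comb)
      (simp add: piece_reconstruction_comb[OF u v] inner_add_left,
        (intro integrable_element continuous_intros P1_continuous_on piece_P1 reconstruction_broken u v w; assumption)+)
  have 2: "(\<Sum>e\<in>facets \<T>. \<integral>x. facet_size e *
        (jump \<T> tp (piece w) e x \<bullet> jump \<T> tp (piece (\<lambda>x. u x + c *\<^sub>R v x)) e x) \<partial>surface_measure e)
      = (\<Sum>e\<in>facets \<T>. \<integral>x. facet_size e * (jump \<T> tp (piece w) e x \<bullet> jump \<T> tp (piece u) e x) \<partial>surface_measure e)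
        + c * (\<Sum>e\<in>facets \<T>. \<integral>x. facet_size e * (jump \<T> tp (piece w) e x \<bullet> jump \<T> tp (piece v) e x) \<partial>surface_measure e)"
    by (rule sum_integral_comb)
      (simp add: jump_piece_comb[OF u v] inner_add_right algebra_simps,
        (intro integrable_facet continuous_intros jump_continuous u v w; assumption)+)
  show ?thesis
    unfolding form_c_eq[OF broken_comb[OF u v] w] form_c_eq[OF u w] form_c_eq[OF v w] 1 2
    by (simp add: algebra_simps)
qed

lemma form_c_sym: "broken u \<Longrightarrow> broken v \<Longrightarrow> form_c \<Omega> \<T> tp \<rho> u v = form_c \<Omega> \<T> tp \<rho> v u"
  by (simp add: form_c_def inner_commute)

lemma elem_div_continuous: "broken v \<Longrightarrow> T \<in> \<T> \<Longrightarrow> continuous_on UNIV (elem_div v T)"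
proof -
  assume v: "broken v" and T: "T \<in> \<T>"
  have "elem_div v T x = elem_div v T 0" for x
    unfolding elem_div_def by (subst elem_grad_const[OF v T]) (rule refl)
  then have "elem_div v T = (\<lambda>_. elem_div v T 0)" by (rule ext)
  then show ?thesis by (metis continuous_on_const)
qed

lemma form_b_eq:
  assumes w: "broken w" and q: "broken q"
  shows "form_b \<T> tp w q = (\<Sum>T\<in>\<T>. \<integral>x. elem_div w T x * piece q T x \<partial>lebesgue_on T)
     - (\<Sum>e\<in>facets \<T>. \<integral>x. (jump \<T> tp (piece w) e x \<bullet> facet_normal tp e)
                            * average \<T> tp (piece q) e x \<partial>surface_measure e)"
proof -
  have "(\<integral>x. elem_div w T x * q x \<partial>lebesgue_on T) = (\<integral>x. elem_div w T x * piece q T x \<partial>lebesgue_on T)"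
    if T: "T \<in> \<T>" for T
  proof (rule integral_element_cong_AE[OF T])
    show "AE x in lebesgue_on T. elem_div w T x * q x = elem_div w T x * piece q T x"
      using piece_AE[OF q T] by eventually_elim simp
    show "continuous_on UNIV (\<lambda>x. elem_div w T x * piece q T x)"
      by (intro continuous_intros P1_continuous_on piece_P1 elem_div_continuous w q T)
  qed
  then show ?thesis by (simp add: form_b_def)
qed

lemma form_b_comb1:
  assumes u: "broken u" and v: "broken v" and q: "broken q"
  shows "form_b \<T> tp (\<lambda>x. u x + c *\<^sub>R v x) q = form_b \<T> tp u q + c * form_b \<T> tp v q"
proof -
  have 1: "(\<Sum>T\<in>\<T>. \<integral>x. elem_div (\<lambda>x. u x + c *\<^sub>R v x) T x * piece q T x \<partial>lebesgue_on T)
      = (\<Sum>T\<in>\<T>. \<integral>x. elem_div u T x * piece q T x \<partial>lebesgue_on T)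
        + c * (\<Sum>T\<in>\<T>. \<integral>x. elem_div v T x * piece q T x \<partial>lebesgue_on T)"
    by (rule sum_integral_comb)
      (simp add: elem_div_comb[OF u v] algebra_simps,
        (intro integrable_element continuous_intros P1_continuous_on piece_P1 elem_div_continuous u v q; assumption)+)
  have 2: "(\<Sum>e\<in>facets \<T>. \<integral>x. (jump \<T> tp (piece (\<lambda>x. u x + c *\<^sub>R v x)) e x \<bullet> facet_normal tp e)
        * average \<T> tp (piece q) e x \<partial>surface_measure e)
      = (\<Sum>e\<in>facets \<T>. \<integral>x. (jump \<T> tp (piece u) e x \<bullet> facet_normal tp e) * average \<T> tp (piece q) e x \<partial>surface_measure e)
        + c * (\<Sum>e\<in>facets \<T>. \<integral>x. (jump \<T> tp (piece v) e x \<bullet> facet_normal tp e) * average \<T> tp (piece q) e x \<partial>surface_measure e)"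
    by (rule sum_integral_comb)
      (simp add: jump_piece_comb[OF u v] inner_add_left algebra_simps,
        (intro integrable_facet continuous_intros jump_continuous average_continuous u v q; assumption)+)
  show ?thesis
    unfolding form_b_eq[OF broken_comb[OF u v] q] form_b_eq[OF u q] form_b_eq[OF v q] 1 2
    by (simp add: algebra_simps)
qed

lemma form_b_comb2:
  assumes w: "broken w" and p: "broken p" and q: "broken q"
  shows "form_b \<T> tp w (\<lambda>x. p x + c *\<^sub>R q x) = form_b \<T> tp w p + c * form_b \<T> tp w q"
proof -
  have 1: "(\<Sum>T\<in>\<T>. \<integral>x. elem_div w T x * piece (\<lambda>x. p x + c *\<^sub>R q x) T x \<partial>lebesgue_on T)
      = (\<Sum>T\<in>\<T>. \<integral>x. elem_div w T x * piece p T x \<partial>lebesgue_on T)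
        + c * (\<Sum>T\<in>\<T>. \<integral>x. elem_div w T x * piece q T x \<partial>lebesgue_on T)"
    by (rule sum_integral_comb)
      (simp only: piece_comb[OF p q], simp add: algebra_simps,
        (intro integrable_element continuous_intros P1_continuous_on piece_P1 elem_div_continuous w p q; assumption)+)
  have 2: "(\<Sum>e\<in>facets \<T>. \<integral>x. (jump \<T> tp (piece w) e x \<bullet> facet_normal tp e)
        * average \<T> tp (piece (\<lambda>x. p x + c *\<^sub>R q x)) e x \<partial>surface_measure e)
      = (\<Sum>e\<in>facets \<T>. \<integral>x. (jump \<T> tp (piece w) e x \<bullet> facet_normal tp e) * average \<T> tp (piece p) e x \<partial>surface_measure e)
        + c * (\<Sum>e\<in>facets \<T>. \<integral>x. (jump \<T> tp (piece w) e x \<bullet> facet_normal tp e) * average \<T> tp (piece q) e x \<partial>surface_measure e)"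
    by (rule sum_integral_comb)
      (simp only: average_piece_comb[OF p q], simp add: algebra_simps,
        (intro integrable_facet continuous_intros jump_continuous average_continuous w p q; assumption)+)
  show ?thesis
    unfolding form_b_eq[OF w broken_comb[OF p q]] form_b_eq[OF w p] form_b_eq[OF w q] 1 2
    by (simp add: algebra_simps)
qed

lemma jump_zero:
  fixes v :: "real ^ 'n \<Rightarrow> 'b::euclidean_space"
  assumes "\<And>T. T \<in> \<T> \<Longrightarrow> piece v T = (\<lambda>_. 0)" "e \<in> facets \<T>"
  shows "jump \<T> tp (piece v) e x = 0" "average \<T> tp (piece v) e x = 0"
  using assms(1)[OF tp_mem[OF assms(2)]] assms(1)[OF tminus_mem[of e]] by (simp_all add: jump_def average_def)

lemma elem_grad_zero: "piece v T = (\<lambda>_. 0) \<Longrightarrow> elem_grad v T x = 0"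
  by (simp add: elem_grad_def jacobian_P1 matrix_def vec_eq_iff)

lemma forms_zero:
  assumes v: "broken v" and zero: "\<And>T. T \<in> \<T> \<Longrightarrow> piece v T = (\<lambda>_. 0)" and u: "broken u"
  shows "form_a \<T> tp \<rho> u v = 0" "form_c \<Omega> \<T> tp \<rho> u v = 0" "form_b \<T> tp v q = 0"
proof -
  have avg: "average \<T> tp (elem_grad v) e x = 0" if "e \<in> facets \<T>" for e x
    using elem_grad_zero[OF zero[OF tp_mem[OF that]]] elem_grad_zero[OF zero[OF tminus_mem[of e]]]
    by (simp add: average_def)
  show "form_a \<T> tp \<rho> u v = 0"
    by (simp add: form_a_def jump_zero[OF zero] elem_grad_zero[OF zero] avg)
  show "form_c \<Omega> \<T> tp \<rho> u v = 0"
    by (simp add: form_c_eq[OF u v] jump_zero[OF zero] piece_reconstruction_zero[OF v zero])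
  show "form_b \<T> tp v q = 0"
    by (simp add: form_b_def jump_zero[OF zero] elem_div_def elem_grad_zero[OF zero] trace_def)
qed

lemma form_b_zero2:
  assumes w: "broken w" and q: "broken q" and zero: "\<And>T. T \<in> \<T> \<Longrightarrow> piece q T = (\<lambda>_. 0)"
  shows "form_b \<T> tp w q = 0"
  by (simp add: form_b_eq[OF w q] jump_zero[OF zero] zero)

end

section \<open>Well-posedness\<close>

context mesh
begin

lemma element_volume_pos: "T \<in> \<T> \<Longrightarrow> 0 < measure lborel T"
  using full_simplex.measure_simplex_pos[OF verts_simplex(1)] verts_simplex(2) by simp

lemma integral_element_const: "T \<in> \<T> \<Longrightarrow> (\<integral>x. c \<partial>lebesgue_on T) = measure lborel T * (c::real)"
  using integral_lebesgue_on_borel[OF element_borel, of T "\<lambda>_. c"] by simp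

lemma integral_facet_const: "e \<in> facets \<T> \<Longrightarrow> (\<integral>x. c \<partial>surface_measure e) = measure (surface_measure e) UNIV * (c::real)"
proof -
  assume e: "e \<in> facets \<T>"
  obtain T b where T: "b \<in> verts T" "e = convex hull (verts T - {b})" "full_simplex (verts T)"
    using facet_obtain[OF e] by blast
  show ?thesis using full_simplex.space_surface_measure[OF T(3,1)] by (simp add: T(2))
qed

lemma element_zero_if_integral_zero:
  fixes w :: "real ^ 'n \<Rightarrow> real ^ 'n"
  assumes T: "T \<in> \<T>" and w: "w \<in> P1" and 0: "(\<integral>x. w x \<bullet> w x \<partial>lebesgue_on T) = 0"
  shows "w = (\<lambda>_. 0)"
proof -
  have "integrable (lebesgue_on T) (\<lambda>x. w x \<bullet> w x)"
    by (intro integrable_element T continuous_intros P1_continuous_on w)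
  then have "AE x in lebesgue_on T. w x \<bullet> w x = 0"
    using 0 by (subst (asm) integral_nonneg_eq_0_iff_AE) auto
  then have "AE x in lebesgue_on (convex hull (verts T)). w x = 0"
    unfolding verts_simplex(2)[OF T] by simp
  then show ?thesis by (rule full_simplex.P1_eq_if_AE_eq[OF verts_simplex(1)[OF T] w P1_const])
qed

lemma form_c_nonneg:
  assumes v: "broken v" and \<rho>: "0 \<le> \<rho>" shows "0 \<le> form_c \<Omega> \<T> tp \<rho> v v"
proof -
  have A: "0 \<le> (\<integral>x. piece (R v) T x \<bullet> piece (R v) T x \<partial>lebesgue_on T)" for T by simp
  have B: "0 \<le> (\<integral>x. facet_size e * (jump \<T> tp (piece v) e x \<bullet> jump \<T> tp (piece v) e x) \<partial>surface_measure e)"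
    if "e \<in> facets \<T>" for e
    using facet_size_pos[OF that] by (intro Bochner_Integration.integral_nonneg) simp
  show ?thesis
    unfolding form_c_eq[OF v v] by (intro add_nonneg_nonneg mult_nonneg_nonneg sum_nonneg \<rho> A B)
qed

text \<open>
  The integrals of $|\mathcal{R}v|^2$ and of the squared jumps vanish. Thus \<open>v\<close> is zero on the boundary facets,
  and on an interior facet it agrees with its average, whose normal component is that of the
  reconstruction and hence zero. The claim follows from \<open>element_zero_if_normals_zero\<close>.
\<close>
lemma form_c_definite:
  assumes v: "broken v" and \<rho>: "0 < \<rho>" and 0: "form_c \<Omega> \<T> tp \<rho> v v = 0" and T: "T \<in> \<T>"
  shows "piece v T = (\<lambda>_. 0)"
proof -
  let ?J = "\<lambda>e x. jump \<T> tp (piece v) e x"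
  let ?A = "\<Sum>T\<in>\<T>. \<integral>x. piece (R v) T x \<bullet> piece (R v) T x \<partial>lebesgue_on T"
  let ?B = "\<Sum>e\<in>facets \<T>. \<integral>x. facet_size e * (?J e x \<bullet> ?J e x) \<partial>surface_measure e"
  have nnA: "0 \<le> (\<integral>x. piece (R v) T x \<bullet> piece (R v) T x \<partial>lebesgue_on T)" for T by simp
  have nnB: "0 \<le> (\<integral>x. facet_size e * (?J e x \<bullet> ?J e x) \<partial>surface_measure e)" if "e \<in> facets \<T>" for e
    using facet_size_pos[OF that] by (intro Bochner_Integration.integral_nonneg) simp
  have "0 \<le> ?A" "0 \<le> ?B" by (intro sum_nonneg nnA nnB; assumption)+
  moreover have "?A + \<rho> * ?B = 0" using 0 form_c_eq[OF v v] by simp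
  moreover have "a = 0 \<and> b = 0" if "0 \<le> a" "0 \<le> b" "a + \<rho> * b = 0" for a b :: real
    using that \<rho> mult_nonneg_nonneg[of \<rho> b] by (auto simp: add_nonneg_eq_0_iff)
  ultimately have "?A = 0 \<and> ?B = 0" by blast
  then have sums: "?A = 0" "?B = 0" by blast+
  have A: "\<forall>T\<in>\<T>. (\<integral>x. piece (R v) T x \<bullet> piece (R v) T x \<partial>lebesgue_on T) = 0"
    by (rule iffD1[OF sum_nonneg_eq_0_iff[OF finite_\<T>] sums(1)]) (rule nnA)
  have B: "\<forall>e\<in>facets \<T>. (\<integral>x. facet_size e * (?J e x \<bullet> ?J e x) \<partial>surface_measure e) = 0"
    by (rule iffD1[OF sum_nonneg_eq_0_iff[OF finite_facets] sums(2)]) (rule nnB)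
  have Rv: "piece (R v) T = (\<lambda>_. 0)" if "T \<in> \<T>" for T
    by (rule element_zero_if_integral_zero[OF that piece_P1[OF reconstruction_broken[OF v] that] bspec[OF A that]])
  have J: "?J e x = 0" if e: "e \<in> facets \<T>" and x: "x \<in> e" for e x
  proof -
    have "facet_size e * (?J e x \<bullet> ?J e x) = 0"
    proof (rule facet_zero_if_integral_zero[OF e _ _ bspec[OF B e] x])
      show "continuous_on UNIV (\<lambda>x. facet_size e * (?J e x \<bullet> ?J e x))"
        by (intro continuous_intros jump_continuous v e)
      show "0 \<le> facet_size e * (?J e x \<bullet> ?J e x)" for x using facet_size_pos[OF e] by simp
    qed
    then show ?thesis using facet_size_pos[OF e] by simp
  qed
  show ?thesis
  proof (rule element_zero_if_normals_zero[OF T piece_P1[OF v T]])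
    fix e x assume e: "e facet_of T" and x: "x \<in> e"
    have ef: "e \<in> facets \<T>" by (rule facetsI[OF T e])
    have fl: "flux v e x = 0"
      using reconstruction_normal[OF v T e x] Rv[OF T] by simp
    show "piece v T x \<bullet> facet_normal tp e = 0"
    proof (cases "e \<in> interior_facets \<T>")
      case True
      have eq: "piece v (tp e) x = piece v (tminus \<T> tp e) x" using J[OF ef x] True by (simp add: jump_def)
      have "T = tp e \<or> T = tminus \<T> tp e" using interior_facet_elements(4)[OF True] T e by blast
      then have "average \<T> tp (piece v) e x = piece v T x"
        using eq True by (auto simp: average_def simp flip: scaleR_2)
      then show ?thesis using fl True by (simp add: flux_def)
    next
      case False
      then have "T = tp e" using boundary_facet_elements[OF ef False] T e by blast
      then show ?thesis using J[OF ef x] False by (simp add: jump_def)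
    qed
  qed
qed

lemma norm_average_squared_le:
  fixes g :: "(real ^ 'n) set \<Rightarrow> real ^ 'n \<Rightarrow> 'b::euclidean_space"
  assumes e: "e \<in> facets \<T>"
  shows "(norm (average \<T> tp g e x))\<^sup>2 \<le> (\<Sum>T | T \<in> \<T> \<and> e facet_of T. (norm (g T x))\<^sup>2)"
proof (cases "e \<in> interior_facets \<T>")
  case True
  let ?a = "g (tp e) x" and ?b = "g (tminus \<T> tp e) x"
  have "(norm (average \<T> tp g e x))\<^sup>2 = (norm ((1 / 2) *\<^sub>R ?a + (1 / 2) *\<^sub>R ?b))\<^sup>2"
    using True by (simp add: average_def scaleR_add_right)
  also have "\<dots> \<le> 2 * (norm ((1 / 2) *\<^sub>R ?a))\<^sup>2 + 2 * (1 / 2)\<^sup>2 * (norm ?b)\<^sup>2"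
    by (rule norm_add_scaleR_squared_le)
  also have "\<dots> = (norm ?a)\<^sup>2 / 2 + (norm ?b)\<^sup>2 / 2"
    by (simp add: power2_eq_square)
  also have "\<dots> \<le> (norm ?a)\<^sup>2 + (norm ?b)\<^sup>2"
    using zero_le_power2[of "norm ?a"] zero_le_power2[of "norm ?b"] by linarith
  finally show ?thesis unfolding interior_facet_elements(4)[OF True]
    using interior_facet_elements(3)[OF True] by simp
next
  case False
  then show ?thesis unfolding boundary_facet_elements[OF e False] by (simp add: average_def)
qed

lemma norm_facet_normal: "e \<in> facets \<T> \<Longrightarrow> norm (facet_normal tp e) = 1"
  using norm_outward_normal[OF tp_mem tp_facet] by (simp add: facet_normal_def)

text \<open>
  On each facet, Young's inequality bounds the consistency term by
  $(h_e/K)\,|e|\,|\{\nabla v\}|^2$ plus $K$ times the penalty term, where $K=\kappa(d+1)$. By the geometric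
  hypothesis the first part is at most $1/(d+1)$ times the sum of $|T|\,|\nabla v|_T^2$ over the elements at the
  facet. An element has $d+1$ facets, so these bounds add up exactly to the volume term.
\<close>
lemma form_a_nonneg:
  assumes v: "broken v" and \<kappa>: "0 < \<kappa>" and \<rho>: "\<kappa> * real (Suc CARD('n)) \<le> \<rho>"
    and size: "\<And>T e. T \<in> \<T> \<Longrightarrow> e facet_of T \<Longrightarrow>
      facet_size e * measure (surface_measure e) UNIV \<le> \<kappa> * measure lborel T"
  shows "0 \<le> form_a \<T> tp \<rho> v v"
proof -
  let ?G = "\<lambda>T. norm (elem_grad v T 0)" and ?J = "\<lambda>e x. jump \<T> tp (piece v) e x"
  define K where "K = \<kappa> * real (Suc CARD('n))"
  have K: "0 < K" using \<kappa> by (simp add: K_def)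
  define P where "P e = (\<integral>x. inverse (facet_size e) * (?J e x \<bullet> ?J e x) \<partial>surface_measure e)" for e
  have P0: "0 \<le> P e" if "e \<in> facets \<T>" for e
    unfolding P_def using facet_size_pos[OF that] by (intro Bochner_Integration.integral_nonneg) simp
  have vol: "(\<Sum>T\<in>\<T>. \<integral>x. elem_grad v T x \<bullet> elem_grad v T x \<partial>lebesgue_on T)
      = (\<Sum>T\<in>\<T>. measure lborel T * (?G T)\<^sup>2)"
  proof (intro sum.cong refl)
    fix T assume T: "T \<in> \<T>"
    have "elem_grad v T x \<bullet> elem_grad v T x = (?G T)\<^sup>2" for x
      unfolding elem_grad_const[OF v T, of x] by (rule power2_norm_eq_inner[symmetric])
    then have "(\<integral>x. elem_grad v T x \<bullet> elem_grad v T x \<partial>lebesgue_on T) = (\<integral>x. (?G T)\<^sup>2 \<partial>lebesgue_on T)"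
      by (simp only:)
    then show "(\<integral>x. elem_grad v T x \<bullet> elem_grad v T x \<partial>lebesgue_on T) = measure lborel T * (?G T)\<^sup>2"
      by (simp only: integral_element_const[OF T])
  qed
  have facet: "2 * (\<integral>x. avg_flux v e x \<bullet> ?J e x \<partial>surface_measure e)
      \<le> (\<Sum>T | T \<in> \<T> \<and> e facet_of T. \<kappa> / K * (measure lborel T * (?G T)\<^sup>2)) + K * P e"
    if e: "e \<in> facets \<T>" for e
  proof -
    let ?h = "facet_size e" and ?m = "measure (surface_measure e) UNIV"
    let ?a = "average \<T> tp (elem_grad v) e 0"
    have h: "0 < ?h" by (rule facet_size_pos[OF e])
    have pw: "2 * (avg_flux v e x \<bullet> ?J e x) \<le> ?h / K * (norm ?a)\<^sup>2 + K * (inverse ?h * (?J e x \<bullet> ?J e x))" for x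
    proof -
      have "norm (avg_flux v e x) \<le> norm ?a"
        using norm_matrix_vector_le[of ?a "facet_normal tp e"] norm_facet_normal[OF e]
        by (simp add: average_grad_const[OF v e, of x])
      then have "(norm (avg_flux v e x))\<^sup>2 \<le> (norm ?a)\<^sup>2" by (intro power_mono) auto
      then have "?h / K * (norm (avg_flux v e x))\<^sup>2 \<le> ?h / K * (norm ?a)\<^sup>2"
        using h K by (intro mult_left_mono) auto
      moreover have "2 * (avg_flux v e x \<bullet> ?J e x)
          \<le> ?h / K * (norm (avg_flux v e x))\<^sup>2 + inverse (?h / K) * (norm (?J e x))\<^sup>2"
        by (rule two_inner_le) (use h K in simp)
      moreover have "inverse (?h / K) * (norm (?J e x))\<^sup>2 = K * (inverse ?h * (?J e x \<bullet> ?J e x))"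
        by (simp add: power2_norm_eq_inner divide_inverse)
      ultimately show ?thesis by linarith
    qed
    have int: "integrable (surface_measure e) (\<lambda>x. inverse ?h * (?J e x \<bullet> ?J e x))"
      by (intro integrable_facet continuous_intros jump_continuous v e)
    have intc: "integrable (surface_measure e) (\<lambda>x. ?h / K * (norm ?a)\<^sup>2)"
      by (intro integrable_facet continuous_intros e)
    have "2 * (\<integral>x. avg_flux v e x \<bullet> ?J e x \<partial>surface_measure e) = (\<integral>x. 2 * (avg_flux v e x \<bullet> ?J e x) \<partial>surface_measure e)"
      by simp
    also have "\<dots> \<le> (\<integral>x. ?h / K * (norm ?a)\<^sup>2 + K * (inverse ?h * (?J e x \<bullet> ?J e x)) \<partial>surface_measure e)"
      by (intro integral_mono pw integrable_facet continuous_intros avg_flux_continuous jump_continuous v e)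
    also have "\<dots> = ?m * (?h / K * (norm ?a)\<^sup>2) + K * P e"
      unfolding P_def integral_facet_const[OF e, symmetric]
      by (subst Bochner_Integration.integral_add[OF intc integrable_mult_right[OF int]])
        (simp only: integral_mult_right_zero)
    also have "?m * (?h / K * (norm ?a)\<^sup>2) \<le> (\<Sum>T | T \<in> \<T> \<and> e facet_of T. \<kappa> / K * (measure lborel T * (?G T)\<^sup>2))"
    proof -
      have "?m * (?h / K * (norm ?a)\<^sup>2) = (?h * ?m / K) * (norm ?a)\<^sup>2" by simp
      also have "\<dots> \<le> (?h * ?m / K) * (\<Sum>T | T \<in> \<T> \<and> e facet_of T. (?G T)\<^sup>2)"
        using h K by (intro mult_left_mono norm_average_squared_le[OF e]) auto
      also have "\<dots> = (\<Sum>T | T \<in> \<T> \<and> e facet_of T. (?h * ?m / K) * (?G T)\<^sup>2)" by (rule sum_distrib_left)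
      also have "\<dots> \<le> (\<Sum>T | T \<in> \<T> \<and> e facet_of T. (\<kappa> * measure lborel T / K) * (?G T)\<^sup>2)"
        using K size by (intro sum_mono mult_right_mono divide_right_mono) auto
      finally show ?thesis by (simp add: mult_ac)
    qed
    finally show ?thesis by simp
  qed
  have "2 * (\<Sum>e\<in>facets \<T>. \<integral>x. avg_flux v e x \<bullet> ?J e x \<partial>surface_measure e)
      \<le> (\<Sum>e\<in>facets \<T>. (\<Sum>T | T \<in> \<T> \<and> e facet_of T. \<kappa> / K * (measure lborel T * (?G T)\<^sup>2)) + K * P e)"
    unfolding sum_distrib_left by (rule sum_mono) (rule facet)
  also have "\<dots> = (\<Sum>T\<in>\<T>. \<Sum>e | e facet_of T. \<kappa> / K * (measure lborel T * (?G T)\<^sup>2)) + K * (\<Sum>e\<in>facets \<T>. P e)"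
    by (simp only: sum.distrib sum_facets_swap sum_distrib_left)
  also have "(\<Sum>T\<in>\<T>. \<Sum>e | e facet_of T. \<kappa> / K * (measure lborel T * (?G T)\<^sup>2)) = (\<Sum>T\<in>\<T>. measure lborel T * (?G T)\<^sup>2)"
    using K \<kappa> by (intro sum.cong refl) (simp add: card_facets_of, simp add: K_def field_simps)
  also have "K * (\<Sum>e\<in>facets \<T>. P e) \<le> \<rho> * (\<Sum>e\<in>facets \<T>. P e)"
    using \<rho> P0 by (intro mult_right_mono sum_nonneg) (auto simp: K_def)
  finally show ?thesis unfolding form_a_def vol P_def by simp
qed

lemma barycenter_bary:
  assumes T: "T \<in> \<T>" and b: "b \<in> verts T"
  shows "bary (verts T) b (barycenter T) = 1 / real (Suc CARD('n))"
proof -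
  interpret full_simplex "verts T" by (rule verts_simplex(1)[OF T])
  have "barycenter T = (\<Sum>c\<in>verts T. (1 / real (Suc CARD('n))) *\<^sub>R c)"
    using card_C by (simp add: barycenter_def verts_def[symmetric] scaleR_sum_right)
  moreover have "(\<Sum>c\<in>verts T. 1 / real (Suc CARD('n))) = 1" using card_C by simp
  ultimately show ?thesis using bary_combination[OF _ b, of "\<lambda>_. 1 / real (Suc CARD('n))"] by (simp only:)
qed

text \<open>
  The distance from the barycenter to a facet is $1/(d+1)$ of the height, so the flux of the dilation is the
  same through all facets of the element.
\<close>
lemma dilation_facet_flux:
  assumes T: "T \<in> \<T>" and e: "e facet_of T" and x: "x \<in> e"
  shows "((x - barycenter T) \<bullet> outward_normal T e) * measure (surface_measure e) UNIV
    = real CARD('n) * measure lborel T / real (Suc CARD('n))"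
proof -
  interpret full_simplex "verts T" by (rule verts_simplex(1)[OF T])
  obtain b where b: "b \<in> verts T" "e = convex hull (verts T - {b})" using e facet_iff_opp[OF T] by blast
  let ?g = "norm (bary_grad (verts T) b)"
  have "bary (verts T) b x = 0" using x mem_opp_iff[OF b(1)] b(2) by simp
  then have 1: "?g * (onormal b \<bullet> (x - barycenter T)) = 1 / real (Suc CARD('n))"
    using bary_along_normal[OF b(1), of x "barycenter T"] barycenter_bary[OF T b(1)] by simp
  have 2: "measure (surface_measure e) UNIV = real CARD('n) * ?g * measure lborel T"
    using measure_simplex[OF b(1)] unfolding verts_simplex(2)[OF T] b(2) by simp
  have "(x - barycenter T) \<bullet> outward_normal T e = onormal b \<bullet> (x - barycenter T)"
    using outward_normal_facet[OF T b(1)] unfolding b(2) by (simp only: inner_commute)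
  then have "((x - barycenter T) \<bullet> outward_normal T e) * measure (surface_measure e) UNIV
      = real CARD('n) * measure lborel T * (?g * (onormal b \<bullet> (x - barycenter T)))"
    unfolding 2 by (simp only: mult_ac)
  then show ?thesis unfolding 1 by simp
qed

text \<open>
  The divergence of $x-x_T$ is $d$, which gives $d\,|T|\,q_T$; by the previous lemma each of the $d+1$ facets
  subtracts $d\,|T|/(d+1)$ times the average of \<open>q\<close>. On the facets of \<open>T\<close>, jump times facet normal equals the
  value on \<open>T\<close> times its outward normal, whichever side \<open>T\<close> is on.
\<close>
lemma form_b_local_dilation:
  assumes T: "T \<in> \<T>" and q: "q \<in> Q_space \<Omega> \<T>"
  shows "form_b \<T> tp (local_dilation T) q = (real CARD('n) * measure lborel T / real (Suc CARD('n))) *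
    (\<Sum>e | e facet_of T. piece q T 0 - average \<T> tp (piece q) e 0)"
proof -
  let ?v = "local_dilation T" and ?d = "real CARD('n)"
  let ?k = "?d * measure lborel T / real (Suc CARD('n))"
  have v: "broken ?v" using local_dilation_D[OF T] D_subset_V V_space_broken by blast
  have qb: "broken q" by (rule Q_space_broken[OF q])
  have qc: "piece q T' x = piece q T' 0" if "T' \<in> \<T>" for T' x
    using fun_cong[OF Q_space_piece[OF q that]] .
  have div: "elem_div ?v T' x = (if T' = T then ?d else 0)" if "T' \<in> \<T>" for T' x
  proof -
    have "(\<lambda>x. if T' = T then x - barycenter T else 0) \<in> P1"
      using affine_multiple_P1[of 1 "barycenter T"] by (cases "T' = T") simp_all
    then show ?thesis
      by (simp add: elem_div_def elem_grad_def piece_local_dilation[OF T that] jacobian_P1 trace_def matrix_def axis_def)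
  qed
  have vol: "(\<Sum>T'\<in>\<T>. \<integral>x. elem_div ?v T' x * piece q T' x \<partial>lebesgue_on T') = ?d * measure lborel T * piece q T 0"
  proof -
    have "(\<Sum>T'\<in>\<T>. \<integral>x. elem_div ?v T' x * piece q T' x \<partial>lebesgue_on T')
        = (\<Sum>T'\<in>\<T>. if T' = T then ?d * measure lborel T * piece q T 0 else 0)"
    proof (intro sum.cong refl)
      fix T' assume T': "T' \<in> \<T>"
      have "elem_div ?v T' x * piece q T' x = (if T' = T then ?d else 0) * piece q T' 0" for x
        by (subst qc[OF T', of x]) (simp only: div[OF T'])
      then have "(\<integral>x. elem_div ?v T' x * piece q T' x \<partial>lebesgue_on T')
          = (\<integral>x. (if T' = T then ?d else 0) * piece q T' 0 \<partial>lebesgue_on T')"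
        by (simp only:)
      also have "\<dots> = measure lborel T' * ((if T' = T then ?d else 0) * piece q T' 0)"
        by (rule integral_element_const[OF T'])
      finally show "(\<integral>x. elem_div ?v T' x * piece q T' x \<partial>lebesgue_on T')
          = (if T' = T then ?d * measure lborel T * piece q T 0 else 0)" by simp
    qed
    then show ?thesis using T by simp
  qed
  have avg: "average \<T> tp (piece q) e x = average \<T> tp (piece q) e 0" if e: "e \<in> facets \<T>" for e x
    using qc[OF tp_mem[OF e], of x] qc[OF tminus_mem[of e], of x] by (simp add: average_def)
  have facet: "(\<integral>x. (jump \<T> tp (piece ?v) e x \<bullet> facet_normal tp e) * average \<T> tp (piece q) e x \<partial>surface_measure e)
      = (if e facet_of T then ?k * average \<T> tp (piece q) e 0 else 0)" if e: "e \<in> facets \<T>" for e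
  proof (cases "e facet_of T")
    case False
    then have "tp e \<noteq> T" "e \<in> interior_facets \<T> \<Longrightarrow> tminus \<T> tp e \<noteq> T"
      using tp_facet[OF e] interior_facet_elements(2) by auto
    then have "jump \<T> tp (piece ?v) e x = 0" for x
      using tp_mem[OF e] tminus_mem[of e] by (simp add: jump_def piece_local_dilation[OF T])
    then show ?thesis using False by simp
  next
    case eT: True
    have jn: "jump \<T> tp (piece ?v) e x \<bullet> facet_normal tp e = (x - barycenter T) \<bullet> outward_normal T e" for x
    proof (cases "e \<in> interior_facets \<T>")
      case True
      note el = interior_facet_elements[OF True]
      have "T = tp e \<or> T = tminus \<T> tp e" using el(4) T eT by blast
      then show ?thesis
      proof
        assume "T = tp e"
        then show ?thesis
          using True el(3) piece_local_dilation[OF T tp_mem[OF e]] piece_local_dilation[OF T el(1)]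
          by (simp add: jump_def facet_normal_def)
      next
        assume "T = tminus \<T> tp e"
        then show ?thesis
          using True el(3) facet_normal_tminus[OF True] piece_local_dilation[OF T tp_mem[OF e]]
            piece_local_dilation[OF T el(1)]
          by (simp add: jump_def inner_diff_left)
      qed
    next
      case False
      then have "T = tp e" using boundary_facet_elements[OF e False] T eT by blast
      then show ?thesis using False piece_local_dilation[OF T tp_mem[OF e]]
        by (simp add: jump_def facet_normal_def)
    qed
    let ?m = "measure (surface_measure e) UNIV"
    have m: "0 < ?m" by (rule surface_measure_facet_pos[OF e])
    have "(\<integral>x. (jump \<T> tp (piece ?v) e x \<bullet> facet_normal tp e) * average \<T> tp (piece q) e x \<partial>surface_measure e)
        = (\<integral>x. ?k / ?m * average \<T> tp (piece q) e 0 \<partial>surface_measure e)"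
    proof (rule integral_facet_cong[OF e])
      show "continuous_on UNIV (\<lambda>x. (jump \<T> tp (piece ?v) e x \<bullet> facet_normal tp e) * average \<T> tp (piece q) e x)"
        by (intro continuous_intros jump_continuous average_continuous v qb e)
      show "(jump \<T> tp (piece ?v) e x \<bullet> facet_normal tp e) * average \<T> tp (piece q) e x
          = ?k / ?m * average \<T> tp (piece q) e 0" if "x \<in> e" for x
      proof -
        have "(x - barycenter T) \<bullet> outward_normal T e = ?k / ?m"
          using dilation_facet_flux[OF T eT that] m by (simp only: nonzero_eq_divide_eq less_imp_neq[OF m, symmetric] not_False_eq_True)
        then show ?thesis by (simp only: jn avg[OF e, of x])
      qed
    qed simp
    also have "\<dots> = ?m * (?k / ?m * average \<T> tp (piece q) e 0)" by (rule integral_facet_const[OF e])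
    finally show ?thesis using eT m by simp
  qed
  have "(\<Sum>e\<in>facets \<T>. \<integral>x. (jump \<T> tp (piece ?v) e x \<bullet> facet_normal tp e) * average \<T> tp (piece q) e x \<partial>surface_measure e)
      = (\<Sum>e\<in>facets \<T>. if e facet_of T then ?k * average \<T> tp (piece q) e 0 else 0)"
    by (intro sum.cong refl facet)
  also have "\<dots> = (\<Sum>e | e \<in> facets \<T> \<and> e facet_of T. ?k * average \<T> tp (piece q) e 0)"
    by (rule sum.inter_filter[symmetric]) simp
  also have "{e. e \<in> facets \<T> \<and> e facet_of T} = {e. e facet_of T}" using facetsI[OF T] by blast
  finally have "form_b \<T> tp ?v q = ?d * measure lborel T * piece q T 0
      - (\<Sum>e | e facet_of T. ?k * average \<T> tp (piece q) e 0)"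
    unfolding form_b_eq[OF v qb] vol by simp
  also have "?d * measure lborel T * piece q T 0 = (\<Sum>e | e facet_of T. ?k * piece q T 0)"
    by (simp add: card_facets_of[OF T])
  finally show ?thesis by (simp add: sum_subtractf sum_distrib_left right_diff_distrib)
qed

text \<open>
  The maximum principle: on an element where \<open>q\<close> is maximal, all differences $q_T-\{q\}_e$ are nonnegative
  and add up to zero, so the neighbours have the same value.
\<close>
lemma pressure_zero:
  assumes q: "q \<in> Q_space \<Omega> \<T>" and b: "\<And>v. v \<in> V_space \<Omega> \<T> \<Longrightarrow> form_b \<T> tp v q = 0" and T: "T \<in> \<T>"
  shows "piece q T = (\<lambda>_. 0)"
proof -
  let ?q = "\<lambda>T. piece q T 0" and ?avg = "\<lambda>e. average \<T> tp (piece q) e 0"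
  have ne: "\<T> \<noteq> {}" using T by blast
  define M where "M = Max (?q ` \<T>)"
  have M: "?q T \<le> M" if "T \<in> \<T>" for T unfolding M_def using that by (intro Max_ge) auto
  define S where "S = {T \<in> \<T>. ?q T = M}"
  have "M \<in> ?q ` \<T>" unfolding M_def using ne by (intro Max_in) auto
  then have S: "S \<noteq> {}" by (auto simp: S_def)
  have avg: "?avg e = M" if T: "T \<in> S" and e: "e facet_of T" for T e
  proof -
    have TT: "T \<in> \<T>" and qT: "?q T = M" using T by (auto simp: S_def)
    have nonneg: "0 \<le> ?q T - ?avg e" if e: "e facet_of T" for e
    proof -
      have ef: "e \<in> facets \<T>" by (rule facetsI[OF TT e])
      have "?avg e \<le> M"
        using M[OF tp_mem[OF ef]] M[OF tminus_mem[of e]]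
        by (cases "e \<in> interior_facets \<T>") (simp_all add: average_def)
      then show ?thesis using qT by simp
    qed
    have "form_b \<T> tp (local_dilation T) q = 0" using b local_dilation_D[OF TT] D_subset_V by blast
    then have "(\<Sum>e | e facet_of T. ?q T - ?avg e) = 0"
      using form_b_local_dilation[OF TT q] element_volume_pos[OF TT] by simp
    then have "?q T - ?avg e = 0"
      using sum_nonneg_eq_0_iff[OF finite_facets_of[OF TT], of "\<lambda>e. ?q T - ?avg e"] nonneg e by auto
    then show ?thesis using qT by simp
  qed
  have "S = \<T>"
  proof (rule facet_connected[OF _ S])
    show "S \<subseteq> \<T>" by (auto simp: S_def)
    fix T T' e assume T: "T \<in> S" and T': "T' \<in> \<T>" and e: "e facet_of T" "e facet_of T'"
    show "T' \<in> S"
    proof (cases "T' = T")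
      case False
      have TT: "T \<in> \<T>" and qT: "?q T = M" using T by (auto simp: S_def)
      have int: "e \<in> interior_facets \<T>" using TT T' e False by (auto simp: interior_facets_def)
      have "T \<in> {tp e, tminus \<T> tp e}" "T' \<in> {tp e, tminus \<T> tp e}"
        using interior_facet_elements(4)[OF int] TT T' e by blast+
      then have "?avg e = (?q T + ?q T') / 2" using False int by (auto simp: average_def)
      then have "?q T' = M" using avg[OF T e(1)] qT by simp
      then show ?thesis using T' by (simp add: S_def)
    qed (use T in simp)
  qed
  then have qM: "piece q T = (\<lambda>_. M)" if "T \<in> \<T>" for T
    using that Q_space_piece[OF q that] by (auto simp: S_def)
  have "AE x in lebesgue_on \<Omega>. q x = M"
    using piece_AE[OF Q_space_broken[OF q]] qM by (intro AE_domain) simp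
  moreover have "q \<in> borel_measurable (lebesgue_on \<Omega>)" using q by (auto simp: Q_space_def L2_def)
  ultimately have "(\<integral>x. q x \<partial>lebesgue_on \<Omega>) = (\<integral>x. M \<partial>lebesgue_on \<Omega>)" by (intro integral_cong_AE) auto
  also have "\<dots> = measure lborel \<Omega> * M"
    using integral_lebesgue_on_borel[of \<Omega> "\<lambda>_. M"] open_\<Omega> by simp
  finally have "measure lborel \<Omega> * M = 0" using q by (simp add: Q_space_def)
  moreover have "measure lborel \<Omega> \<noteq> 0"
  proof
    assume "measure lborel \<Omega> = 0"
    moreover have "emeasure lborel \<Omega> < \<infinity>" using bounded_\<Omega> by (rule emeasure_bounded_finite)
    ultimately have "emeasure lborel \<Omega> = 0" by (simp add: emeasure_eq_ennreal_measure)
    then have "\<Omega> \<in> null_sets lborel" using open_\<Omega> by auto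
    then have "negligible \<Omega>" by (simp add: negligible_iff_null_sets null_sets_completionI)
    then show False using open_not_negligible open_\<Omega> ne_\<Omega> by blast
  qed
  ultimately show ?thesis using qM[OF T] by simp
qed

lemma load_comb:
  assumes f: "f \<in> L2 \<Omega>" and u: "broken u" and v: "broken v"
  shows "(\<integral>x. f x \<bullet> R (\<lambda>x. u x + c *\<^sub>R v x) x \<partial>lebesgue_on \<Omega>)
    = (\<integral>x. f x \<bullet> R u x \<partial>lebesgue_on \<Omega>) + c * (\<integral>x. f x \<bullet> R v x \<partial>lebesgue_on \<Omega>)"
proof -
  let ?w = "\<lambda>x. u x + c *\<^sub>R v x"
  have w: "broken ?w" by (rule broken_comb[OF u v])
  note int = L2_inner_integrable[OF f reconstruction_L2]
  have "AE x in lebesgue_on \<Omega>. R ?w x = R u x + c *\<^sub>R R v x"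
  proof (rule AE_domain)
    fix T assume T: "T \<in> \<T>"
    show "AE x in lebesgue_on T. R ?w x = R u x + c *\<^sub>R R v x"
      using piece_AE[OF reconstruction_broken[OF w] T] piece_AE[OF reconstruction_broken[OF u] T]
        piece_AE[OF reconstruction_broken[OF v] T]
      unfolding piece_reconstruction_comb[OF u v T] by eventually_elim simp
  qed
  then have "AE x in lebesgue_on \<Omega>. f x \<bullet> R ?w x = f x \<bullet> R u x + c * (f x \<bullet> R v x)"
    by eventually_elim (simp add: inner_add_right)
  then have "(\<integral>x. f x \<bullet> R ?w x \<partial>lebesgue_on \<Omega>) = (\<integral>x. f x \<bullet> R u x + c * (f x \<bullet> R v x) \<partial>lebesgue_on \<Omega>)"
    using int[OF w] int[OF u] int[OF v] by (intro integral_cong_AE) auto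
  then show ?thesis using int[OF u] int[OF v] by simp
qed

lemma load_zero:
  assumes f: "f \<in> L2 \<Omega>" and v: "broken v" and zero: "\<And>T. T \<in> \<T> \<Longrightarrow> piece v T = (\<lambda>_. 0)"
  shows "(\<integral>x. f x \<bullet> R v x \<partial>lebesgue_on \<Omega>) = 0"
proof -
  have "AE x in lebesgue_on \<Omega>. R v x = 0"
    using broken_zero_AE[OF reconstruction_broken[OF v] piece_reconstruction_zero[OF v zero]] .
  then have "AE x in lebesgue_on \<Omega>. f x \<bullet> R v x = 0" by eventually_elim simp
  then show ?thesis by (rule integral_eq_zero_AE)
qed

text \<open>
  The coordinates \<open>D\<close> of a pair are the nodal values of the velocity pieces and the element values of the
  pressure. In the system \<open>B\<close> the two equations are added, so the diagonal of \<open>B\<close> is the velocity form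
  alone. A test pair annihilated by all trial pairs therefore has zero velocity, and the load vanishes on
  it, which is what solvability requires.
\<close>
lemma well_posed:
  assumes \<kappa>: "0 < \<kappa>"
    and size: "\<And>T e. T \<in> \<T> \<Longrightarrow> e facet_of T \<Longrightarrow>
      facet_size e * measure (surface_measure e) UNIV \<le> \<kappa> * measure lborel T"
    and \<rho>1: "\<kappa> * real (Suc CARD('n)) \<le> \<rho>1" and \<rho>2: "0 < \<rho>2" and \<nu>: "0 \<le> \<nu>" and f: "f \<in> L2 \<Omega>"
  shows "\<exists>u p. pr_eg_solution \<Omega> \<T> tp \<nu> \<rho>1 \<rho>2 f u p \<and>
    (\<forall>u' p'. pr_eg_solution \<Omega> \<T> tp \<nu> \<rho>1 \<rho>2 f u' p' \<longrightarrow>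
       (AE x in lebesgue_on \<Omega>. u' x = u x) \<and> (AE x in lebesgue_on \<Omega>. p' x = p x))"
proof -
  let ?V = "V_space \<Omega> \<T>" and ?Q = "Q_space \<Omega> \<T>"
  define A where "A u v = \<nu> * form_a \<T> tp \<rho>1 u v + form_c \<Omega> \<T> tp \<rho>2 u v" for u v
  let ?l = "\<lambda>v. \<integral>x. f x \<bullet> R v x \<partial>lebesgue_on \<Omega>"
  note bV = V_space_broken and bQ = Q_space_broken
  have A1: "A (\<lambda>x. u x + c *\<^sub>R v x) w = A u w + c * A v w" if "u \<in> ?V" "v \<in> ?V" "w \<in> ?V" for u v w c
    unfolding A_def form_a_comb[OF bV[OF that(1)] bV[OF that(2)] bV[OF that(3)]]
      form_c_comb[OF bV[OF that(1)] bV[OF that(2)] bV[OF that(3)]] by (simp add: algebra_simps)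
  have Asym: "A u v = A v u" if "u \<in> ?V" "v \<in> ?V" for u v
    using form_a_sym form_c_sym[OF bV[OF that(1)] bV[OF that(2)]] by (simp add: A_def)
  have A2: "A w (\<lambda>x. u x + c *\<^sub>R v x) = A w u + c * A w v" if "u \<in> ?V" "v \<in> ?V" "w \<in> ?V" for u v w c
    using A1[OF that] Asym[OF V_space_comb[OF that(1,2)] that(3)] Asym[OF that(1,3)] Asym[OF that(2,3)] by simp
  have A0: "A u v = 0" if "u \<in> ?V" "v \<in> ?V" "\<And>T. T \<in> \<T> \<Longrightarrow> piece v T = (\<lambda>_. 0)" for u v
    using forms_zero(1,2)[OF bV[OF that(2)] that(3) bV[OF that(1)]] by (simp add: A_def)
  have definite: "piece v T = (\<lambda>_. 0)" if v: "v \<in> ?V" and "A v v = 0" "T \<in> \<T>" for v T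
  proof (rule form_c_definite[OF bV[OF v] \<rho>2 _ that(3)])
    have "0 \<le> \<nu> * form_a \<T> tp \<rho>1 v v"
      by (intro mult_nonneg_nonneg \<nu> form_a_nonneg[OF bV[OF v] \<kappa> \<rho>1 size])
    moreover have "0 \<le> form_c \<Omega> \<T> tp \<rho>2 v v" using form_c_nonneg[OF bV[OF v]] \<rho>2 by simp
    ultimately show "form_c \<Omega> \<T> tp \<rho>2 v v = 0" using that(2) by (simp add: A_def)
  qed
  have V0: "(\<lambda>_. 0) \<in> ?V"
  proof -
    have "(\<lambda>_. 0) \<in> D_space \<Omega> \<T>"
      using L2_continuous[OF open_\<Omega> bounded_\<Omega>, of "\<lambda>_. 0 :: real ^ 'n"]
      by (auto simp: D_space_def intro: exI[of _ 0])
    from V_spaceI[OF C_space_zero this] show ?thesis by simp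
  qed
  have zero_piece: "piece (\<lambda>_. 0 :: 'b) T = (\<lambda>_. 0 :: 'b::euclidean_space)" if "T \<in> \<T>" for T
    by (intro piece_eqI that) auto

  define X where "X = ?V \<times> ?Q"
  define comb where "comb y c z = (\<lambda>x. fst y x + c *\<^sub>R fst z x, \<lambda>x. snd y x + c *\<^sub>R snd z x)"
    for y z :: "(real ^ 'n \<Rightarrow> real ^ 'n) \<times> (real ^ 'n \<Rightarrow> real)" and c :: real
  define B where "B y z = A (fst y) (fst z) - form_b \<T> tp (fst z) (snd y) + form_b \<T> tp (fst y) (snd z)"
    for y z :: "(real ^ 'n \<Rightarrow> real ^ 'n) \<times> (real ^ 'n \<Rightarrow> real)"
  \<comment> \<open>\<open>Some (a, i)\<close> stands for component \<open>i\<close> of the velocity at the vertex \<open>a\<close>, \<open>None\<close> for the pressure\<close>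
  define K where "K = (SIGMA T:\<T>. Some ` (verts T \<times> (UNIV :: 'n set)) \<union> {None})"
  define D where "D k z = (case k of (T, Some (a, i)) \<Rightarrow> piece (fst z) T a $ i | (T, None) \<Rightarrow> piece (snd z) T 0)"
    for k :: "(real ^ 'n) set \<times> ((real ^ 'n) \<times> 'n) option"
      and z :: "(real ^ 'n \<Rightarrow> real ^ 'n) \<times> (real ^ 'n \<Rightarrow> real)"
  have pieces_zero: "piece (fst z) T = (\<lambda>_. 0)" "piece (snd z) T = (\<lambda>_. 0)"
    if z: "z \<in> X" and D0: "\<And>k. k \<in> K \<Longrightarrow> D k z = 0" and T: "T \<in> \<T>" for z T
  proof -
    interpret full_simplex "verts T" by (rule verts_simplex(1)[OF T])
    have zV: "fst z \<in> ?V" and zQ: "snd z \<in> ?Q" using z by (auto simp: X_def)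
    show "piece (fst z) T = (\<lambda>_. 0)"
    proof (rule P1_eqI[OF piece_P1[OF bV[OF zV] T] P1_const])
      fix a assume a: "a \<in> verts T"
      have "piece (fst z) T a $ i = 0" for i
        using D0[of "(T, Some (a, i))"] T a by (simp add: K_def D_def)
      then show "piece (fst z) T a = 0" by (simp add: vec_eq_iff)
    qed
    have "piece (snd z) T 0 = 0" using D0[of "(T, None)"] T by (simp add: K_def D_def)
    then show "piece (snd z) T = (\<lambda>_. 0)" using Q_space_piece[OF zQ T] by simp
  qed
  have "\<exists>y\<in>X. \<forall>z\<in>X. B y z = ?l (fst z)"
  proof (rule finite_rank_system_solvable[where K = K and D = D and comb = comb and B = B])
    show "finite K" unfolding K_def using full_simplex.finite_C[OF verts_simplex(1)] by simp
    show "X \<noteq> {}" using V0 Q_space_zero by (auto simp: X_def)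
    show "comb y c z \<in> X" "comb y c z \<in> X" if "y \<in> X" "z \<in> X" for y z c
      using that V_space_comb Q_space_comb by (auto simp: X_def comb_def)
    show "D k (comb y c z) = D k y + c * D k z" if k: "k \<in> K" and y: "y \<in> X" and z: "z \<in> X" for k y z c
    proof -
      obtain T j where kT: "k = (T, j)" "T \<in> \<T>" using k by (auto simp: K_def)
      have yz: "broken (fst y)" "broken (fst z)" "broken (snd y)" "broken (snd z)"
        using y z bV bQ by (auto simp: X_def)
      show ?thesis
      proof (cases j)
        case None
        then show ?thesis using piece_comb[OF yz(3,4) kT(2), of c] kT(1) by (simp add: D_def comb_def)
      next
        case (Some ai)
        then show ?thesis using piece_comb[OF yz(1,2) kT(2), of c] kT(1)
          by (cases ai) (simp add: D_def comb_def)
      qed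
    qed
    show "B (comb y c z) w = B y w + c * B z w" if "y \<in> X" "z \<in> X" "w \<in> X" for y z w c
      using that A1[of "fst y" "fst z" "fst w" c] form_b_comb1[of "fst y" "fst z" "snd w" c]
        form_b_comb2[of "fst w" "snd y" "snd z" c] bV bQ
      by (auto simp: B_def comb_def X_def algebra_simps)
    show "B w (comb y c z) = B w y + c * B w z" if "y \<in> X" "z \<in> X" "w \<in> X" for y z w c
      using that A2[of "fst y" "fst z" "fst w" c] form_b_comb1[of "fst y" "fst z" "snd w" c]
        form_b_comb2[of "fst w" "snd y" "snd z" c] bV bQ
      by (auto simp: B_def comb_def X_def algebra_simps)
    show "?l (fst (comb y c z)) = ?l (fst y) + c * ?l (fst z)" if "y \<in> X" "z \<in> X" for y z c
      using load_comb[OF f, of "fst y" "fst z" c] that bV by (auto simp: comb_def X_def)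
    show "B y z = 0" if y: "y \<in> X" and z: "z \<in> X" and D0: "\<And>k. k \<in> K \<Longrightarrow> D k z = 0" for y z
    proof -
      have yz: "fst y \<in> ?V" "fst z \<in> ?V" "snd z \<in> ?Q" using y z by (auto simp: X_def)
      note p = pieces_zero[OF z D0]
      show ?thesis
        using A0[OF yz(1,2) p(1)] forms_zero(3)[OF bV[OF yz(2)] p(1) bV[OF yz(1)]]
          form_b_zero2[OF bV[OF yz(1)] bQ[OF yz(3)] p(2)] by (simp add: B_def)
    qed
    show "?l (fst z) = 0" if z: "z \<in> X" and B0: "\<And>y. y \<in> X \<Longrightarrow> B y z = 0" for z
    proof -
      have zV: "fst z \<in> ?V" using z by (auto simp: X_def)
      have "A (fst z) (fst z) = 0" using B0[OF z] by (simp add: B_def)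
      then show ?thesis using load_zero[OF f bV[OF zV] definite[OF zV]] by blast
    qed
  qed
  then obtain u p where up: "u \<in> ?V" "p \<in> ?Q" and sol: "\<And>v q. v \<in> ?V \<Longrightarrow> q \<in> ?Q \<Longrightarrow> B (u, p) (v, q) = ?l v"
    by (force simp: X_def)
  have zQ: "form_b \<T> tp w (\<lambda>_. 0) = 0" if "w \<in> ?V" for w
    using form_b_zero2[OF bV[OF that] bQ[OF Q_space_zero] zero_piece] .
  have zV: "A u (\<lambda>_. 0) = 0" "form_b \<T> tp (\<lambda>_. 0) q = 0" "?l (\<lambda>_. 0) = 0" for q
    using A0[OF up(1) V0 zero_piece] forms_zero(3)[OF bV[OF V0] zero_piece bV[OF V0]]
      load_zero[OF f bV[OF V0] zero_piece] by auto
  have "pr_eg_solution \<Omega> \<T> tp \<nu> \<rho>1 \<rho>2 f u p"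
    unfolding pr_eg_solution_def
  proof (intro conjI ballI up)
    fix v assume v: "v \<in> ?V"
    show "\<nu> * form_a \<T> tp \<rho>1 u v + form_c \<Omega> \<T> tp \<rho>2 u v - form_b \<T> tp v p = ?l v"
      using sol[OF v Q_space_zero] zQ[OF up(1)] by (simp add: B_def A_def)
  next
    fix q assume q: "q \<in> ?Q"
    show "form_b \<T> tp u q = 0" using sol[OF V0 q] zV by (simp add: B_def)
  qed
  moreover have "(AE x in lebesgue_on \<Omega>. u' x = u x) \<and> (AE x in lebesgue_on \<Omega>. p' x = p x)"
    if s: "pr_eg_solution \<Omega> \<T> tp \<nu> \<rho>1 \<rho>2 f u p" and s': "pr_eg_solution \<Omega> \<T> tp \<nu> \<rho>1 \<rho>2 f u' p'" for u' p'
  proof -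
    have m: "u' \<in> ?V" "p' \<in> ?Q" using s' by (auto simp: pr_eg_solution_def)
    define w where "w = (\<lambda>x. u' x + (-1) *\<^sub>R u x)"
    define r where "r = (\<lambda>x. p' x + (-1) *\<^sub>R p x)"
    have w: "w \<in> ?V" unfolding w_def by (rule V_space_comb[OF m(1) up(1)])
    have r: "r \<in> ?Q" unfolding r_def by (rule Q_space_comb[OF m(2) up(2)])
    have mom: "A w v - form_b \<T> tp v r = 0" if v: "v \<in> ?V" for v
    proof -
      have "A u v - form_b \<T> tp v p = ?l v" "A u' v - form_b \<T> tp v p' = ?l v"
        using s s' v by (simp_all add: pr_eg_solution_def A_def)
      then show ?thesis
        using A1[OF m(1) up(1) v, of "-1"] form_b_comb2[OF bV[OF v] bQ[OF m(2)] bQ[OF up(2)], of "-1"]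
        unfolding w_def r_def by linarith
    qed
    have "form_b \<T> tp w r = 0"
      using s s' r form_b_comb1[OF bV[OF m(1)] bV[OF up(1)] bQ[OF r], of "-1"]
      unfolding pr_eg_solution_def w_def by auto
    then have "A w w = 0" using mom[OF w] by simp
    note w0 = definite[OF w this]
    have Aw: "A w v = 0" if "v \<in> ?V" for v
      using A0[OF that w w0] Asym[OF w that] by simp
    have r0: "piece r T = (\<lambda>_. 0)" if "T \<in> \<T>" for T
      using pressure_zero[OF r _ that] mom Aw by simp
    have "AE x in lebesgue_on \<Omega>. w x = 0" "AE x in lebesgue_on \<Omega>. r x = 0"
      using broken_zero_AE[OF bV[OF w] w0] broken_zero_AE[OF bQ[OF r] r0] by auto
    then show ?thesis by (simp add: w_def r_def)
  qed
  ultimately show ?thesis by blast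
qed

end

theorem theorem5p7:
  fixes \<Omega> :: "(real ^ 'n) set" and \<sigma> :: real
  assumes dim: "CARD('n) = 2 \<or> CARD('n) = 3"
    and domain: "bounded_lipschitz_domain \<Omega>"
    and simply: "simply_connected \<Omega> \<or> simply_connected (frontier \<Omega>)"
  shows "\<exists>\<rho>1\<^sub>0>0. \<exists>\<rho>2\<^sub>0>0. \<forall>\<rho>1>\<rho>1\<^sub>0. \<forall>\<rho>2>\<rho>2\<^sub>0.
    \<forall>\<T> tp \<nu>. \<forall>f :: real ^ 'n \<Rightarrow> real ^ 'n.
      simplicial_mesh \<Omega> \<T> \<and> shape_regular \<sigma> \<T> \<and> orientation \<T> tp \<and>
      0 \<le> \<nu> \<and> \<nu> \<le> 1 \<and> f \<in> L2 \<Omega> \<longrightarrow>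
      (\<exists>u p. pr_eg_solution \<Omega> \<T> tp \<nu> \<rho>1 \<rho>2 f u p \<and>
         (\<forall>u' p'. pr_eg_solution \<Omega> \<T> tp \<nu> \<rho>1 \<rho>2 f u' p' \<longrightarrow>
            (AE x in lebesgue_on \<Omega>. u' x = u x) \<and> (AE x in lebesgue_on \<Omega>. p' x = p x)))"
proof -
  define \<kappa>0 where "\<kappa>0 = real CARD('n) * \<bar>\<sigma>\<bar> *
      (real CARD('n) * \<bar>\<sigma>\<bar> * unit_ball_vol CARD('n)) powr (1 / (real CARD('n) - 1))"
  \<comment> \<open>for $\sigma=0$ the constant of \<open>facet_size_bound\<close> is zero, whereas the threshold has to be positive\<close>
  define \<kappa> where "\<kappa> = max 1 \<kappa>0"
  have \<kappa>: "0 < \<kappa>" "\<kappa>0 \<le> \<kappa>" by (auto simp: \<kappa>_def)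
  have d: "CARD('n) \<ge> 2" using dim by auto
  show ?thesis
  proof (rule exI[of _ "\<kappa> * real (Suc CARD('n))"], rule conjI, use \<kappa>(1) in simp,
      rule exI[of _ 1], rule conjI, rule zero_less_one, intro allI impI)
    fix \<rho>1 \<rho>2 \<nu> :: real and \<T> tp and f :: "real ^ 'n \<Rightarrow> real ^ 'n"
    assume \<rho>1: "\<kappa> * real (Suc CARD('n)) < \<rho>1" and \<rho>2: "1 < \<rho>2"
      and H: "simplicial_mesh \<Omega> \<T> \<and> shape_regular \<sigma> \<T> \<and> orientation \<T> tp \<and> 0 \<le> \<nu> \<and> \<nu> \<le> 1 \<and> f \<in> L2 \<Omega>"
    interpret mesh \<Omega> \<T> tp
      using domain H by unfold_locales (auto simp: bounded_lipschitz_domain_def)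
    have size: "facet_size e * measure (surface_measure e) UNIV \<le> \<kappa> * measure lborel T"
      if T: "T \<in> \<T>" and e: "e facet_of T" for T e
    proof -
      obtain b where b: "b \<in> verts T" "e = convex hull (verts T - {b})" using e facet_iff_opp[OF T] by blast
      have "diameter T \<le> \<sigma> * inball_diameter T" using H T by (auto simp: shape_regular_def)
      then have "facet_size e * measure (surface_measure e) UNIV \<le> \<kappa>0 * measure lborel T"
        using facet_size_bound[OF verts_simplex(1)[OF T] b(1) d, of \<sigma>]
        unfolding \<kappa>0_def b(2) by (simp add: verts_simplex(2)[OF T])
      also have "\<dots> \<le> \<kappa> * measure lborel T" by (intro mult_right_mono \<kappa>) simp
      finally show ?thesis .
    qed
    show "\<exists>u p. pr_eg_solution \<Omega> \<T> tp \<nu> \<rho>1 \<rho>2 f u p \<and>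
         (\<forall>u' p'. pr_eg_solution \<Omega> \<T> tp \<nu> \<rho>1 \<rho>2 f u' p' \<longrightarrow>
            (AE x in lebesgue_on \<Omega>. u' x = u x) \<and> (AE x in lebesgue_on \<Omega>. p' x = p x))"
      by (rule well_posed[OF \<kappa>(1) size]) (use \<rho>1 \<rho>2 H in auto)
  qed
qed

end
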